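(* Consider the sequence of bandwidth sharing networks indexed by $\epsilon\in(0,1)$ described in the context, operated under a weighted proportionally fair policy, with phase-type file size distributions in the class $\mathcal D$ and arrival rate vector $\bm\lambda^{(\epsilon)}=(1-\epsilon)\bm\lambda^{(0)}$, where under $\bm\lambda^{(0)}$ exactly the $L_s$ links in $\mathcal L_s$ are critically loaded. Let $\overline{\bm N}^{(\epsilon)}$ be a random vector distributed according to the stationary distribution of the flow count process $(\bm N^{(\epsilon)}(t):t\ge 0)$, and let $\|\overline{\bm N}^{(\epsilon)}_\perp\|$ denote its distance to the cone $\mathcal K$ in the norm $\|\cdot\|$ induced by the inner product $\langle\cdot,\cdot\rangle$ of the context. Then for every nonnegative integer $m$, as $\epsilon\to0^+$, $$\mathbb E\Bigl[\bigl\|\overline{\bm N}^{(\epsilon)}_\perp\bigr\|^m\Bigr]=O\Bigl(\bigl(1/\sqrt\epsilon\bigr)^m\Bigr).$$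
   Context: **Network.** Links $\mathcal L=\{1,\dots,L\}$ with capacities $C_\ell>0$; routes $\mathcal R=\{1,\dots,R\}$, each route being a nonempty set of links ($\ell\in r$ means link $\ell$ is on route $r$). The routing matrix $H=(h_{\ell r})$, $h_{\ell r}=1$ if $\ell\in r$ and $0$ otherwise, has full row rank. Each route $r$ has a weight $\kappa_r>0$. **File sizes (class $\mathcal D$).** For each route $r$, the file size is the absorption time of a continuous-time Markov chain with an absorbing state $0$ and transient states (phases) $1,\dots,K_r$, initial distribution $\bm\pi_r$ (a $1\times K_r$ row probability vector on the phases), and transient generator $S_r$ ($K_r\times K_r$; the absorption rates are the entries of $-S_r\bm 1$). $S_r$ is block diagonal with blocks $S_r^{(1)},\dots,S_r^{(B_r)}$, where each $S_r^{(b)}$ is a square matrix with $-\mu_r^{(b)}$ on the diagonal, $\mu_r^{(b)}>0$ on the superdiagonal, and zeros elsewhere, the $\mu_r^{(b)}$ being distinct for different $b$. Moreover $\pi_{r,k}>0$ for each phase $k$ corresponding to the first row of some block, and $\pi_{r,k}\ge0$ for the other phases. The mean file size is $1/\mu_r=\bm\pi_r(-S_r)^{-1}\bm 1$. Let $S=\mathrm{diag}(S_1,\dots,S_R)$ and $K=\sum_rK_r$. **Weighted proportionally fair policy.** A state is $\bm n=(n_{r,k})_{r\in\mathcal R,k\in\{1,\dots,K_r\}}\in\mathbb Z_+^K$, where $n_{r,k}$ is the number of flows in phase $k$ on route $r$; $n_r=\sum_kn_{r,k}$. In state $\bm n$ each flow on route $r$ gets rate $x_r=x_r(\bm n)$,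 where $(x_r)$ maximizes $\sum_r\kappa_rn_r\log x_r$ subject to $\sum_{r:\ell\in r}n_rx_r\le C_\ell$ for all $\ell$ and $x_r\ge0$, with $x_r=0$ when $n_r=0$. **Flow count process.** Flows arrive on route $r$ as independent Poisson processes of rate $\lambda_r$; file sizes are i.i.d. on each route and independent across routes. With $\bm e^{(r,k)}$ the standard basis vectors of $\mathbb R^K$, the flow count process is the continuous-time Markov chain on $\mathbb Z_+^K$ with transition rates: $\bm n\to\bm n+\bm e^{(r,k)}$ at rate $\lambda_r\pi_{r,k}$; $\bm n\to\bm n-\bm e^{(r,k_1)}+\bm e^{(r,k_2)}$ ($k_1\ne k_2$) at rate $n_{r,k_1}x_r(S_r)_{k_1,k_2}$; $\bm n\to\bm n-\bm e^{(r,k)}$ at rate $n_{r,k}x_r\sum_{k'}(-S_r)_{k,k'}$. **Heavy traffic.** Fix $\bm\lambda^{(0)}$ with all $\lambda^{(0)}_r>0$ on the boundary of the capacity region: with $\rho_r^{(0)}=\lambda_r^{(0)}/\mu_r$, $\sum_{r:\ell\in r}\rho_r^{(0)}=C_\ell$ for $\ell$ in a nonempty set $\mathcal L_s\subseteq\mathcal L$ of critically loaded links and $\sum_{r:\ell\in r}\rho_r^{(0)}<C_\ell$ for $\ell\notin\mathcal L_s$; $L_s=|\mathcal L_s|$. The $\epsilon$-th system has $\bm\lambda^{(\epsilon)}=(1-\epsilon)\bm\lambda^{(0)}$, everything else being independent of $\epsilon$. For $0<\epsilon<1$ the flow count process has a unique stationary distribution. **Cone.** Let $\bm\rho_r^{(0)}=\lambda_r^{(0)}(-S_r)^{-T}\bm\pi_r^T\in\mathbb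 R^{K_r}$ with entries $\rho^{(0)}_{r,k}$. For each link $\ell$ define $\bm b^{(\ell)}\in\mathbb R^K$ by $b^{(\ell)}_{r,k}=\rho^{(0)}_{r,k}\mathbb 1_{\{\ell\in r\}}/\kappa_r$, and $\mathcal K=\{\sum_{\ell\in\mathcal L_s}\alpha_\ell\bm b^{(\ell)}:\alpha_\ell\ge0\}$. **Inner product.** $\langle\bm y,\bm z\rangle=\bm y^TM\bm z$ on $\mathbb R^K$, $M=\mathrm{diag}(M_1,\dots,M_R)$ block diagonal with $$M_r=\frac{\kappa_r}{\lambda_r^{(0)}}\int_0^{\infty}\frac{\exp(S_r\sigma)\bm 1\bm 1^T\exp(S_r^T\sigma)}{\bm\pi_r(-S_r)^{-1}\exp(S_r\sigma)\bm 1}\,d\sigma,$$ where $\bm 1$ is the all-ones column vector; $M$ is finite and positive definite. $\|\cdot\|$ is the induced norm. For $\bm n\in\mathbb R^K$, $\bm n_\parallel$ is the projection (nearest point in $\|\cdot\|$) of $\bm n$ onto $\mathcal K$ and $\bm n_\perp=\bm n-\bm n_\parallel$. *)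

theory Defs
  imports
    "HOL-Probability.Probability"
    "HOL-Library.Landau_Symbols"
    "Jordan_Normal_Form.Matrix"
    "Jordan_Normal_Form.Gauss_Jordan_Elimination"
begin

no_notation Finite_Cartesian_Product.vec_nth (infixl \<open>$\<close> 90)
no_notation Inner_Product.real_inner_class.inner (infix \<open>\<bullet>\<close> 70)
notation Matrix.vec_index (infixl \<open>$\<close> 100)
notation Matrix.scalar_prod (infix \<open>\<bullet>\<close> 70)

definition minv :: "real mat \<Rightarrow> real mat" where
  "minv A = the (mat_inverse A)"

text \<open>Matrix exponential, entrywise by its power series.\<close>

definition mexp :: "real mat \<Rightarrow> real mat" where
  "mexp A = mat (dim_row A) (dim_row A) (\<lambda>(i, j). \<Sum>k. (A ^\<^sub>m k) $$ (i, j) / fact k)"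

definition ones :: "nat \<Rightarrow> real Matrix.vec" where
  "ones n = Matrix.vec n (\<lambda>_. 1)"

definition erlang_block :: "nat \<Rightarrow> real \<Rightarrow> real mat" where
  "erlang_block m \<mu> = mat m m (\<lambda>(i, j). if i = j then - \<mu> else if j = Suc i then \<mu> else 0)"

text \<open>The list \<open>bs\<close> gives size and rate of the diagonal blocks; block number \<open>b\<close> starts at
  the row whose index is the total size of the blocks before it (indices start at 0).\<close>

definition class_D :: "real Matrix.vec \<Rightarrow> real mat \<Rightarrow> bool" where
  "class_D p S \<longleftrightarrow> (\<exists>bs :: (nat \<times> real) list.
     (\<forall>(m, \<mu>) \<in> set bs. 0 < m \<and> 0 < \<mu>) \<and>
     distinct (map snd bs) \<and>
     S = diag_block_mat (map (\<lambda>(m, \<mu>). erlang_block m \<mu>) bs) \<and>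
     p \<in> carrier_vec (dim_row S) \<and>
     (\<forall>k < dim_row S. 0 \<le> p $ k) \<and>
     (\<Sum>k < dim_row S. p $ k) = 1 \<and>
     (\<forall>b < length bs. 0 < p $ (sum_list (map fst (take b bs)))))"

definition mean_size :: "real Matrix.vec \<Rightarrow> real mat \<Rightarrow> real" where
  "mean_size p S = p \<bullet> (minv (- S) *\<^sub>v ones (dim_row S))"

text \<open>Links and routes are the elements of the finite types \<open>'l\<close> and \<open>'r\<close>.
  The field \<open>arrival\<close> is the critical arrival rate vector \<open>\<lambda>\<^sup>0\<close>.\<close>

record ('l, 'r) network =
  route :: "'r \<Rightarrow> 'l set"
  capacity :: "'l \<Rightarrow> real"
  weight :: "'r \<Rightarrow> real"
  init :: "'r \<Rightarrow> real Matrix.vec"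
  gen :: "'r \<Rightarrow> real mat"
  arrival :: "'r \<Rightarrow> real"

definition routing_matrix :: "('l::finite, 'r::finite) network \<Rightarrow> real ^ 'r ^ 'l" where
  "routing_matrix net = (\<chi> l r. if l \<in> route net r then 1 else 0)"

definition phases :: "('l, 'r) network \<Rightarrow> 'r \<Rightarrow> nat" where
  "phases net r = dim_row (gen net r)"

definition bandwidth_sharing_network :: "('l::finite, 'r::finite) network \<Rightarrow> bool" where
  "bandwidth_sharing_network net \<longleftrightarrow>
     (\<forall>l. 0 < capacity net l) \<and>
     (\<forall>r. route net r \<noteq> {}) \<and>
     rank (routing_matrix net) = CARD('l) \<and>
     (\<forall>r. 0 < weight net r) \<and>
     (\<forall>r. class_D (init net r) (gen net r)) \<and>
     (\<forall>r. 0 < arrival net r)"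

definition link_load :: "('l, 'r::finite) network \<Rightarrow> 'l \<Rightarrow> real" where
  "link_load net l =
     (\<Sum>r | l \<in> route net r. arrival net r * mean_size (init net r) (gen net r))"

definition critically_loaded :: "('l, 'r::finite) network \<Rightarrow> 'l set \<Rightarrow> bool" where
  "critically_loaded net Ls \<longleftrightarrow> Ls \<noteq> {} \<and>
     (\<forall>l \<in> Ls. link_load net l = capacity net l) \<and>
     (\<forall>l. l \<notin> Ls \<longrightarrow> link_load net l < capacity net l)"

definition states :: "('l, 'r) network \<Rightarrow> ('r \<Rightarrow> nat Matrix.vec) set" where
  "states net = {n. \<forall>r. n r \<in> carrier_vec (phases net r)}"

definition flows :: "nat Matrix.vec \<Rightarrow> nat" where
  "flows v = (\<Sum>k < dim_vec v. v $ k)"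

text \<open>The logarithm with value \<open>-\<infinity>\<close> at 0 (whereas \<open>ln 0 = 0\<close> in the library).
  A route without flows contributes 0 to the objective since \<open>0 * (-\<infinity>) = 0\<close> in \<open>ereal\<close>.\<close>

definition elog :: "real \<Rightarrow> ereal" where
  "elog t = (if 0 < t then ereal (ln t) else - \<infinity>)"

definition feasible :: "('l, 'r::finite) network \<Rightarrow> ('r \<Rightarrow> nat Matrix.vec) \<Rightarrow> ('r \<Rightarrow> real) \<Rightarrow> bool"
  where
  "feasible net n x \<longleftrightarrow>
     (\<forall>r. 0 \<le> x r) \<and> (\<forall>r. flows (n r) = 0 \<longrightarrow> x r = 0) \<and>
     (\<forall>l. (\<Sum>r | l \<in> route net r. real (flows (n r)) * x r) \<le> capacity net l)"

definition utility :: "('l, 'r::finite) network \<Rightarrow> ('r \<Rightarrow> nat Matrix.vec) \<Rightarrow> ('r \<Rightarrow> real) \<Rightarrow> ereal"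
  where
  "utility net n x = (\<Sum>r \<in> UNIV. ereal (weight net r * real (flows (n r))) * elog (x r))"

definition weighted_proportionally_fair ::
    "('l, 'r::finite) network \<Rightarrow> (('r \<Rightarrow> nat Matrix.vec) \<Rightarrow> 'r \<Rightarrow> real) \<Rightarrow> bool" where
  "weighted_proportionally_fair net x \<longleftrightarrow>
     (\<forall>n \<in> states net. feasible net n (x n) \<and>
        (\<forall>y. feasible net n y \<longrightarrow> utility net n y \<le> utility net n (x n)))"

text \<open>\<open>P t x\<close> is the distribution at time \<open>t\<close> of the chain started in \<open>x\<close>, and \<open>q x y\<close>
  is the rate of transitions from \<open>x\<close> to \<open>y \<noteq> x\<close>.\<close>

definition transition_function :: "'s set \<Rightarrow> (real \<Rightarrow> 's \<Rightarrow> 's pmf) \<Rightarrow> bool" where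
  "transition_function X P \<longleftrightarrow>
     (\<forall>t \<ge> 0. \<forall>x \<in> X. set_pmf (P t x) \<subseteq> X) \<and>
     (\<forall>x \<in> X. P 0 x = return_pmf x) \<and>
     (\<forall>s \<ge> 0. \<forall>t \<ge> 0. \<forall>x \<in> X. P (s + t) x = bind_pmf (P s x) (P t))"

definition has_transition_rates ::
    "'s set \<Rightarrow> (real \<Rightarrow> 's \<Rightarrow> 's pmf) \<Rightarrow> ('s \<Rightarrow> 's \<Rightarrow> real) \<Rightarrow> bool" where
  "has_transition_rates X P q \<longleftrightarrow>
     (\<forall>x \<in> X. \<forall>y \<in> X. x \<noteq> y \<longrightarrow> ((\<lambda>t. pmf (P t x) y / t) \<longlongrightarrow> q x y) (at_right 0)) \<and>
     (\<forall>x \<in> X. ((\<lambda>t. (1 - pmf (P t x) x) / t) \<longlongrightarrow> (\<Sum>\<^sub>\<infinity>y \<in> X - {x}. q x y)) (at_right 0))"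

text \<open>Invariance under the transition function of the chain. The rates of the flow count process
  are bounded, so that the transition function \<open>P\<close> is uniquely determined by them.\<close>

definition stationary_distribution :: "'s set \<Rightarrow> ('s \<Rightarrow> 's \<Rightarrow> real) \<Rightarrow> 's pmf \<Rightarrow> bool" where
  "stationary_distribution X q p \<longleftrightarrow> set_pmf p \<subseteq> X \<and>
     (\<exists>P. transition_function X P \<and> has_transition_rates X P q \<and>
          (\<forall>t \<ge> 0. bind_pmf p (P t) = p))"

definition add_flow :: "('r \<Rightarrow> nat Matrix.vec) \<Rightarrow> 'r \<Rightarrow> nat \<Rightarrow> 'r \<Rightarrow> nat Matrix.vec" where
  "add_flow n r k = n(r := n r + unit_vec (dim_vec (n r)) k)"

definition remove_flow :: "('r \<Rightarrow> nat Matrix.vec) \<Rightarrow> 'r \<Rightarrow> nat \<Rightarrow> 'r \<Rightarrow> nat Matrix.vec" where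
  "remove_flow n r k = n(r := n r - unit_vec (dim_vec (n r)) k)"

text \<open>The truncated subtraction in \<open>remove_flow\<close> is harmless: if there is no flow to remove,
  then the rate of the transition is 0.\<close>

definition flow_rate ::
    "('l, 'r::finite) network \<Rightarrow> (('r \<Rightarrow> nat Matrix.vec) \<Rightarrow> 'r \<Rightarrow> real) \<Rightarrow> real \<Rightarrow>
     ('r \<Rightarrow> nat Matrix.vec) \<Rightarrow> ('r \<Rightarrow> nat Matrix.vec) \<Rightarrow> real" where
  "flow_rate net x \<epsilon> n n' = (\<Sum>r \<in> UNIV.
     (\<Sum>k < phases net r. (1 - \<epsilon>) * arrival net r * init net r $ k
         * of_bool (n' = add_flow n r k)) +
     (\<Sum>k1 < phases net r. \<Sum>k2 \<in> {..<phases net r} - {k1}.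
         real (n r $ k1) * x n r * gen net r $$ (k1, k2)
         * of_bool (n' = add_flow (remove_flow n r k1) r k2)) +
     (\<Sum>k < phases net r. real (n r $ k) * x n r * (\<Sum>k' < phases net r. (- gen net r) $$ (k, k'))
         * of_bool (n' = remove_flow n r k)))"

definition load_vec :: "('l, 'r) network \<Rightarrow> 'r \<Rightarrow> real Matrix.vec" where
  "load_vec net r =
     arrival net r \<cdot>\<^sub>v (transpose_mat (minv (- gen net r)) *\<^sub>v init net r)"

definition cone_gen :: "('l, 'r) network \<Rightarrow> 'l \<Rightarrow> 'r \<Rightarrow> real Matrix.vec" where
  "cone_gen net l r = (of_bool (l \<in> route net r) / weight net r) \<cdot>\<^sub>v load_vec net r"

definition cone_of :: "('l, 'r) network \<Rightarrow> 'l set \<Rightarrow> ('r \<Rightarrow> real Matrix.vec) set" where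
  "cone_of net Ls =
     {\<lambda>r. Matrix.vec (phases net r) (\<lambda>k. \<Sum>l \<in> Ls. \<alpha> l * cone_gen net l r $ k) | \<alpha>.
        \<forall>l \<in> Ls. 0 \<le> \<alpha> l}"

text \<open>The constant matrix in the middle is \<open>1 1\<^sup>T\<close>.\<close>

definition M_integrand :: "real Matrix.vec \<Rightarrow> real mat \<Rightarrow> real \<Rightarrow> real mat" where
  "M_integrand p S \<sigma> =
     (1 / (p \<bullet> (minv (- S) *\<^sub>v (mexp (\<sigma> \<cdot>\<^sub>m S) *\<^sub>v ones (dim_row S))))) \<cdot>\<^sub>m
     (mexp (\<sigma> \<cdot>\<^sub>m S) * mat (dim_row S) (dim_row S) (\<lambda>_. 1) * mexp (\<sigma> \<cdot>\<^sub>m transpose_mat S))"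

definition M_mat :: "('l, 'r) network \<Rightarrow> 'r \<Rightarrow> real mat" where
  "M_mat net r = mat (phases net r) (phases net r) (\<lambda>(i, j).
     weight net r / arrival net r *
     (LINT \<sigma>:{0..}|lborel. M_integrand (init net r) (gen net r) \<sigma> $$ (i, j)))"

definition M_inner ::
    "('l, 'r::finite) network \<Rightarrow> ('r \<Rightarrow> real Matrix.vec) \<Rightarrow> ('r \<Rightarrow> real Matrix.vec) \<Rightarrow> real" where
  "M_inner net y z = (\<Sum>r \<in> UNIV. y r \<bullet> (M_mat net r *\<^sub>v z r))"

definition M_norm :: "('l, 'r::finite) network \<Rightarrow> ('r \<Rightarrow> real Matrix.vec) \<Rightarrow> real" where
  "M_norm net y = sqrt (M_inner net y y)"

text \<open>The nearest point of the cone; it is unique because \<open>M\<close> is positive definite.\<close>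

definition par :: "('l, 'r::finite) network \<Rightarrow> 'l set \<Rightarrow> ('r \<Rightarrow> real Matrix.vec) \<Rightarrow> 'r \<Rightarrow> real Matrix.vec"
  where
  "par net Ls y = (ARG_MIN (\<lambda>z. M_norm net (\<lambda>r. y r - z r)) z. z \<in> cone_of net Ls)"

definition perp :: "('l, 'r::finite) network \<Rightarrow> 'l set \<Rightarrow> ('r \<Rightarrow> real Matrix.vec) \<Rightarrow> 'r \<Rightarrow> real Matrix.vec"
  where
  "perp net Ls y = (\<lambda>r. y r - par net Ls y r)"

definition real_state :: "('r \<Rightarrow> nat Matrix.vec) \<Rightarrow> 'r \<Rightarrow> real Matrix.vec" where
  "real_state n = (\<lambda>r. map_vec real (n r))"

end

theory Submission
  imports Defs
begin

text \<open>For a vector \<open>v\<close> of phase counts on a route let \<open>\<phi>(s)\<close> be the expected number of its flows with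
  residual size above \<open>s\<close>, let \<open>F\<close> be the tail of the file size distribution and \<open>h\<close> the tail integral
  of \<open>F\<close>. Then \<open>\<parallel>v\<parallel>\<^sup>2\<close> is a multiple of the integral of \<open>\<phi>\<^sup>2 / h\<close>, and under the fluid dynamics
  \<open>\<phi>\<close> solves the transport equation \<open>d\<phi>/dt = \<lambda> F + x \<phi>'\<close>. Integration by parts and completing the
  square bound the drift of \<open>\<parallel>n\<parallel>\<^sup>2\<close> by a negative multiple of \<open>\<epsilon> |n|\<close>, where \<open>|n|\<close> is the number of
  flows, and also by a negative multiple of \<open>\<parallel>n\<^sub>\<bottom>\<parallel>\<^sup>2 / |n|\<close>, since the prices of the links define a
  point of the cone whose distance from \<open>n\<close> is controlled by the completed square. Removing the
  projection changes the drift by at most a multiple of \<open>\<epsilon> |n|\<close>. Applied to powers of \<open>\<parallel>n\<parallel>\<^sup>2\<close>, the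
  first bound shows that \<open>\<epsilon> |n|\<close> has bounded moments in equilibrium. Applied to powers of
  \<open>\<parallel>n\<^sub>\<bottom>\<parallel>\<^sup>2\<close>, the second one then bounds the moments of \<open>\<epsilon> \<parallel>n\<^sub>\<bottom>\<parallel>\<^sup>2\<close>.\<close>

section \<open>Stationary distributions and Lyapunov functions\<close>

text \<open>The weight 1/h makes the cone generators measure work: the load vector has profile h, so
  pairing with it cancels the denominator and leaves the residual work of the flows. The work of a
  critical link falls at rate at most \<epsilon> times its capacity, which is why removing the
  projection is cheap. The price is a denominator that vanishes at infinity. The class D keeps it
  harmless: every block starts with positive probability, so F and h both dominate all residual
  survival functions up to a factor. Hence \<phi>/h stays bounded, and h is at most a multiple of F,
  which turns the weight F of the completed square into the weight of the norm. The dissipation of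
  the squared distance d carries the unbounded factor |n| in its denominator. In the scaled
  quantities u = \<epsilon> d and v = \<epsilon> (1 + |n|) it reads u^(k+1) / v for the power k + 1,
  and pointwise case distinctions trade such quotients against powers of v, whose moments come from
  the bound linear in |n|.\<close>

lemma stationary_balance:
  assumes st: "stationary_distribution X q p" and y: "y \<in> X"
  shows "(\<integral>\<^sup>+x. ennreal (q x y) * indicator (- {y}) x \<partial>p)
           \<le> ennreal (pmf p y * (\<Sum>\<^sub>\<infinity>z \<in> X - {y}. q y z))"
proof -
  from st obtain P where supp: "set_pmf p \<subseteq> X"
    and rates: "has_transition_rates X P q" and inv: "\<And>t. 0 \<le> t \<Longrightarrow> bind_pmf p (P t) = p"
    unfolding stationary_distribution_def by blast
  \<comment> \<open>Fatou's lemma works along sequences, so time tends to 0 through the points 1 /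
    (i + 1).\<close>
  define t :: "nat \<Rightarrow> real" where "t i = inverse (real (Suc i))" for i
  have tpos: "0 < t i" for i by (simp add: t_def)
  have tlim: "filterlim t (at_right 0) sequentially"
    unfolding filterlim_at using LIMSEQ_inverse_real_of_nat by (auto simp: t_def[abs_def])
  \<comment> \<open>At positive times invariance balances exactly: the mass that enters
    \<open>y\<close> from elsewhere equals the mass that leaves \<open>y\<close>.\<close>
  have eq: "(\<integral>\<^sup>+x. ennreal (pmf (P (t i) x) y / t i) * indicator (- {y}) x \<partial>p)
      = ennreal (pmf p y * ((1 - pmf (P (t i) y) y) / t i))" (is "?L = ?R") for i
  proof -
    have "ennreal (pmf p y) = (\<integral>\<^sup>+x. ennreal (pmf (P (t i) x) y) \<partial>p)"
      using inv[of "t i"] tpos[of i] by (metis ennreal_pmf_bind less_imp_le)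
    also have "\<dots> = (\<integral>\<^sup>+x. ennreal (pmf (P (t i) x) y) * indicator (- {y}) x
        + ennreal (pmf (P (t i) y) y) * indicator {y} x \<partial>p)"
      by (intro nn_integral_cong) (auto split: split_indicator)
    also have "\<dots> = (\<integral>\<^sup>+x. ennreal (pmf (P (t i) x) y) * indicator (- {y}) x \<partial>p)
        + ennreal (pmf (P (t i) y) y * pmf p y)"
      by (subst nn_integral_add) (auto simp: emeasure_pmf_single ennreal_mult nn_integral_cmult)
    finally have eq: "ennreal (pmf p y) = (\<integral>\<^sup>+x. ennreal (pmf (P (t i) x) y) * indicator (- {y}) x \<partial>p)
        + ennreal (pmf (P (t i) y) y * pmf p y)" .
    have *: "(\<integral>\<^sup>+x. ennreal (pmf (P (t i) x) y) * indicator (- {y}) x \<partial>p)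
        = ennreal (pmf p y * (1 - pmf (P (t i) y) y))"
    proof -
      have "(\<integral>\<^sup>+x. ennreal (pmf (P (t i) x) y) * indicator (- {y}) x \<partial>p)
          = ennreal (pmf p y) - ennreal (pmf (P (t i) y) y * pmf p y)"
        unfolding eq by simp
      also have "\<dots> = ennreal (pmf p y * (1 - pmf (P (t i) y) y))"
        by (subst ennreal_minus) (auto simp: algebra_simps)
      finally show ?thesis .
    qed
    have "?L = (\<integral>\<^sup>+x. ennreal (1 / t i) * (ennreal (pmf (P (t i) x) y) * indicator (- {y}) x) \<partial>p)"
      using tpos[of i] by (intro nn_integral_cong)
        (auto simp: ennreal_mult[symmetric] split: split_indicator)
    also have "\<dots> = ennreal (1 / t i) * ennreal (pmf p y * (1 - pmf (P (t i) y) y))"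
      by (subst nn_integral_cmult) (auto simp: *)
    also have "\<dots> = ?R"
      using tpos[of i] by (subst ennreal_mult[symmetric]) (auto simp: pmf_le_1)
    finally show ?thesis .
  qed
  have lim1: "(\<lambda>i. ennreal (pmf (P (t i) x) y / t i) * indicator (- {y}) x)
      \<longlonglongrightarrow> ennreal (q x y) * indicator (- {y}) x" if "x \<in> X" for x
  proof (cases "x = y")
    case False
    then have "((\<lambda>t. pmf (P t x) y / t) \<longlongrightarrow> q x y) (at_right 0)"
      using rates that y unfolding has_transition_rates_def by blast
    from filterlim_compose[OF this tlim] show ?thesis
      using False by (auto intro: tendsto_ennrealI)
  qed auto
  have "((\<lambda>t. (1 - pmf (P t y) y) / t) \<longlongrightarrow> (\<Sum>\<^sub>\<infinity>z \<in> X - {y}. q y z)) (at_right 0)"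
    using rates y unfolding has_transition_rates_def by blast
  from filterlim_compose[OF this tlim]
  have lim2: "(\<lambda>i. ennreal (pmf p y * ((1 - pmf (P (t i) y) y) / t i)))
      \<longlonglongrightarrow> ennreal (pmf p y * (\<Sum>\<^sub>\<infinity>z \<in> X - {y}. q y z))"
    by (intro tendsto_ennrealI tendsto_mult tendsto_const)
  have "(\<integral>\<^sup>+x. ennreal (q x y) * indicator (- {y}) x \<partial>p)
      = (\<integral>\<^sup>+x. liminf (\<lambda>i. ennreal (pmf (P (t i) x) y / t i) * indicator (- {y}) x) \<partial>p)"
    using supp lim1
    by (intro nn_integral_cong_AE)
      (auto simp: AE_measure_pmf_iff subset_eq intro!: lim_imp_Liminf[symmetric])
  \<comment> \<open>Fatou's lemma turns the exact balance into an inequality, inflow at most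
    outflow. This is the direction that nonnegative test functions need later.\<close>
  also have "\<dots> \<le> liminf (\<lambda>i. \<integral>\<^sup>+x. ennreal (pmf (P (t i) x) y / t i) * indicator (- {y}) x \<partial>p)"
    by (intro nn_integral_liminf) auto
  also have "\<dots> = ennreal (pmf p y * (\<Sum>\<^sub>\<infinity>z \<in> X - {y}. q y z))"
    unfolding eq using lim2 by (intro lim_imp_Liminf) auto
  finally show ?thesis .
qed

text \<open>Different jumps may share a target, so the sum over target states is regrouped by jumps;
  a jump that stays in place drops out on both sides.\<close>

lemma infsum_jump_rates:
  fixes rate :: "'j \<Rightarrow> real"
  assumes "finite J" and "\<And>j. j \<in> J \<Longrightarrow> rate j \<noteq> 0 \<Longrightarrow> tgt j \<in> X"
  shows "(\<Sum>\<^sub>\<infinity>z \<in> X - {y}. \<Sum>j\<in>J. rate j * of_bool (z = tgt j))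
           = (\<Sum>j\<in>J. rate j * of_bool (tgt j \<noteq> y))"
proof -
  have "(\<Sum>\<^sub>\<infinity>z \<in> X - {y}. \<Sum>j\<in>J. rate j * of_bool (z = tgt j))
      = (\<Sum>\<^sub>\<infinity>z \<in> (X - {y}) \<inter> tgt ` J. \<Sum>j\<in>J. rate j * of_bool (z = tgt j))"
    by (intro infsum_cong_neutral) (auto intro!: sum.neutral)
  also have "\<dots> = (\<Sum>z \<in> (X - {y}) \<inter> tgt ` J. \<Sum>j\<in>J. rate j * of_bool (z = tgt j))"
    using assms(1) by simp
  also have "\<dots> = (\<Sum>j\<in>J. \<Sum>z \<in> (X - {y}) \<inter> tgt ` J. rate j * of_bool (z = tgt j))"
    by (rule sum.swap)
  also have "\<dots> = (\<Sum>j\<in>J. rate j * of_bool (tgt j \<noteq> y))"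
  proof (rule sum.cong)
    fix j assume j: "j \<in> J"
    have "(\<Sum>z \<in> (X - {y}) \<inter> tgt ` J. rate j * of_bool (z = tgt j))
        = (\<Sum>z \<in> (X - {y}) \<inter> tgt ` J. if z = tgt j then rate j else 0)"
      by (intro sum.cong) auto
    then show "(\<Sum>z \<in> (X - {y}) \<inter> tgt ` J. rate j * of_bool (z = tgt j))
        = rate j * of_bool (tgt j \<noteq> y)"
      using assms(1) assms(2)[OF j] j by (cases "rate j = 0") (auto simp: sum.delta)
  qed auto
  finally show ?thesis .
qed

text \<open>The truncation of \<open>V\<close> at level \<open>T\<close> keeps the drift inequality where \<open>V < T\<close> and has
  nonpositive drift elsewhere; so no integrability of \<open>V\<close> is needed.\<close>

lemma stationary_drift_comparison:
  fixes rate :: "'j \<Rightarrow> 's \<Rightarrow> real" and V g b :: "'s \<Rightarrow> real"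
  assumes st: "stationary_distribution X q p" and cnt: "countable X"
    and J: "finite J"
    and q: "\<And>n y. n \<in> X \<Longrightarrow> y \<in> X \<Longrightarrow> q n y = (\<Sum>j\<in>J. rate j n * of_bool (y = tgt j n))"
    and rate0: "\<And>j n. n \<in> X \<Longrightarrow> j \<in> J \<Longrightarrow> 0 \<le> rate j n"
    and tgt: "\<And>j n. n \<in> X \<Longrightarrow> j \<in> J \<Longrightarrow> rate j n \<noteq> 0 \<Longrightarrow> tgt j n \<in> X"
    and bounded: "\<And>n. n \<in> X \<Longrightarrow> (\<Sum>j\<in>J. rate j n) \<le> \<Lambda>"
    and nonneg: "\<And>n. n \<in> X \<Longrightarrow> 0 \<le> V n" "\<And>n. n \<in> X \<Longrightarrow> 0 \<le> g n" "\<And>n. n \<in> X \<Longrightarrow> 0 \<le> b n"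
    and drift: "\<And>n. n \<in> X \<Longrightarrow> (\<Sum>j\<in>J. rate j n * (V (tgt j n) - V n)) \<le> b n - g n"
  shows "(\<integral>\<^sup>+n. ennreal (g n) \<partial>p) \<le> (\<integral>\<^sup>+n. ennreal (b n) \<partial>p)"
proof -
  have supp: "set_pmf p \<subseteq> X" using st unfolding stationary_distribution_def by blast
  define out where "out n = (\<Sum>j\<in>J. rate j n * of_bool (tgt j n \<noteq> n))" for n
  have out0: "0 \<le> out n" if "n \<in> X" for n
    unfolding out_def using rate0 that by (intro sum_nonneg) auto
  have out_le: "out n \<le> \<Lambda>" if "n \<in> X" for n
  proof -
    have "out n \<le> (\<Sum>j\<in>J. rate j n)"
      unfolding out_def using rate0[OF that] by (intro sum_mono) auto
    with bounded[OF that] show ?thesis by linarith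
  qed
  have \<Lambda>0: "0 \<le> \<Lambda>" if "n \<in> X" for n using out0[OF that] out_le[OF that] by linarith
  have out: "(\<Sum>\<^sub>\<infinity>z \<in> X - {n}. q n z) = out n" if n: "n \<in> X" for n
  proof -
    have "(\<Sum>\<^sub>\<infinity>z \<in> X - {n}. q n z)
        = (\<Sum>\<^sub>\<infinity>z \<in> X - {n}. \<Sum>j\<in>J. rate j n * of_bool (z = tgt j n))"
      by (intro infsum_cong) (use n q in auto)
    also have "\<dots> = out n"
      unfolding out_def by (rule infsum_jump_rates[OF J]) (use tgt n in auto)
    finally show ?thesis .
  qed
  have main: "(\<integral>\<^sup>+n. ennreal (g n) * indicator {n. V n < T} n \<partial>p) \<le> (\<integral>\<^sup>+n. ennreal (b n) \<partial>p)"
    if T: "0 \<le> T" for T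
  proof -
    \<comment> \<open>\<open>u\<close> is \<open>T\<close> minus the truncation of \<open>V\<close>:
      bounded, and nonnegative, so that it can serve as a weight in the balance inequality.\<close>
    define u where "u n = max 0 (T - V n)" for n
    have u0: "0 \<le> u n" for n by (simp add: u_def)
    have uT: "u n \<le> T" if "n \<in> X" for n using nonneg(1)[OF that] T by (simp add: u_def)
    have "(\<integral>\<^sup>+n. ennreal (\<Sum>j\<in>J. rate j n * of_bool (tgt j n \<noteq> n) * u (tgt j n)) \<partial>p)
        = (\<integral>\<^sup>+n. \<integral>\<^sup>+y. ennreal (u y) * (ennreal (q n y) * indicator (- {y}) n) \<partial>count_space X \<partial>p)"
    proof (rule nn_integral_cong_AE, unfold AE_measure_pmf_iff, intro ballI)
      fix n assume "n \<in> set_pmf p"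
      then have n: "n \<in> X" using supp by auto
      have "(\<integral>\<^sup>+y. ennreal (u y) * (ennreal (q n y) * indicator (- {y}) n) \<partial>count_space X)
          = (\<Sum>y\<in>X \<inter> (\<lambda>j. tgt j n) ` J. ennreal (u y) * (ennreal (q n y) * indicator (- {y}) n))"
      proof (rule nn_integral_count_space')
        show "finite (X \<inter> (\<lambda>j. tgt j n) ` J)" using J by auto
        show "X \<inter> (\<lambda>j. tgt j n) ` J \<subseteq> X" by auto
        fix y assume y: "y \<in> X" "y \<notin> X \<inter> (\<lambda>j. tgt j n) ` J"
        then have "q n y = 0" using q[OF n y(1)] by (auto intro!: sum.neutral)
        then show "ennreal (u y) * (ennreal (q n y) * indicator (- {y}) n) = 0" by simp
      qed
      also have "\<dots> = (\<Sum>y\<in>X \<inter> (\<lambda>j. tgt j n) ` J.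
          ennreal (\<Sum>j\<in>J. u y * (rate j n * of_bool (y = tgt j n) * of_bool (tgt j n \<noteq> n))))"
      proof (rule sum.cong)
        fix y assume "y \<in> X \<inter> (\<lambda>j. tgt j n) ` J"
        then have y: "y \<in> X" by auto
        have q0: "0 \<le> q n y" using q[OF n y] rate0[OF n] by (auto intro!: sum_nonneg)
        have "ennreal (u y) * (ennreal (q n y) * indicator (- {y}) n)
            = ennreal (u y * (q n y * of_bool (y \<noteq> n)))"
          using u0 q0 by (auto simp: ennreal_mult split: split_indicator)
        also have "u y * (q n y * of_bool (y \<noteq> n))
            = (\<Sum>j\<in>J. u y * (rate j n * of_bool (y = tgt j n) * of_bool (tgt j n \<noteq> n)))"
          unfolding q[OF n y] sum_distrib_left sum_distrib_right
          by (intro sum.cong) (auto simp: mult_ac)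
        finally show "ennreal (u y) * (ennreal (q n y) * indicator (- {y}) n)
            = ennreal (\<Sum>j\<in>J. u y * (rate j n * of_bool (y = tgt j n) * of_bool (tgt j n \<noteq> n)))" .
      qed auto
      also have "\<dots> = ennreal (\<Sum>y\<in>X \<inter> (\<lambda>j. tgt j n) ` J.
          (\<Sum>j\<in>J. u y * (rate j n * of_bool (y = tgt j n) * of_bool (tgt j n \<noteq> n))))"
        using u0 rate0[OF n] by (intro sum_ennreal) (auto intro!: sum_nonneg)
      also have "(\<Sum>y\<in>X \<inter> (\<lambda>j. tgt j n) ` J.
          (\<Sum>j\<in>J. u y * (rate j n * of_bool (y = tgt j n) * of_bool (tgt j n \<noteq> n))))
          = (\<Sum>j\<in>J. \<Sum>y\<in>X \<inter> (\<lambda>j. tgt j n) ` J.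
              u y * (rate j n * of_bool (y = tgt j n) * of_bool (tgt j n \<noteq> n)))"
        by (rule sum.swap)
      also have "\<dots> = (\<Sum>j\<in>J. rate j n * of_bool (tgt j n \<noteq> n) * u (tgt j n))"
      proof (rule sum.cong)
        fix j assume j: "j \<in> J"
        have "(\<Sum>y\<in>X \<inter> (\<lambda>j. tgt j n) ` J.
              u y * (rate j n * of_bool (y = tgt j n) * of_bool (tgt j n \<noteq> n)))
            = (\<Sum>y\<in>X \<inter> (\<lambda>j. tgt j n) ` J. if y = tgt j n
                 then u (tgt j n) * (rate j n * of_bool (tgt j n \<noteq> n)) else 0)"
          by (intro sum.cong) auto
        then show "(\<Sum>y\<in>X \<inter> (\<lambda>j. tgt j n) ` J.
              u y * (rate j n * of_bool (y = tgt j n) * of_bool (tgt j n \<noteq> n)))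
            = rate j n * of_bool (tgt j n \<noteq> n) * u (tgt j n)"
          using J j tgt[OF n j] by (cases "rate j n = 0") (auto simp: sum.delta)
      qed auto
      finally show "ennreal (\<Sum>j\<in>J. rate j n * of_bool (tgt j n \<noteq> n) * u (tgt j n))
          = (\<integral>\<^sup>+y. ennreal (u y) * (ennreal (q n y) * indicator (- {y}) n) \<partial>count_space X)" ..
    qed
    also have "\<dots> = (\<integral>\<^sup>+y. \<integral>\<^sup>+n. ennreal (u y) * (ennreal (q n y) * indicator (- {y}) n) \<partial>p \<partial>count_space X)"
      by (subst nn_integral_count_space_nn_integral[OF cnt]) auto
    also have "\<dots> = (\<integral>\<^sup>+y. ennreal (u y) * (\<integral>\<^sup>+n. ennreal (q n y) * indicator (- {y}) n \<partial>p) \<partial>count_space X)"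
      by (intro nn_integral_cong nn_integral_cmult) auto
    \<comment> \<open>After the interchange of sum and expectation, the balance inequality is
      applied to each target state \<open>y\<close> with weight \<open>u y\<close>.\<close>
    also have "\<dots> \<le> (\<integral>\<^sup>+y. ennreal (u y) * ennreal (pmf p y * out y) \<partial>count_space X)"
      using stationary_balance[OF st] out
      by (intro nn_integral_mono mult_left_mono) (auto simp: space_count_space)
    also have "\<dots> = (\<integral>\<^sup>+y. ennreal (pmf p y) * ennreal (out y * u y) \<partial>count_space X)"
      using u0 out0 by (intro nn_integral_cong) (auto simp: ennreal_mult[symmetric] mult_ac)
    also have "\<dots> = (\<integral>\<^sup>+y. ennreal (pmf p y) * ennreal (out y * u y) \<partial>count_space UNIV)"
      using supp by (subst (1) nn_integral_count_space_indicator, simp)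
        (auto intro!: nn_integral_cong split: split_indicator simp: set_pmf_iff)
    also have "\<dots> = (\<integral>\<^sup>+y. ennreal (out y * u y) \<partial>p)"
      by (simp add: nn_integral_measure_pmf)
    finally have bal: "(\<integral>\<^sup>+n. ennreal (\<Sum>j\<in>J. rate j n * of_bool (tgt j n \<noteq> n) * u (tgt j n)) \<partial>p)
        \<le> (\<integral>\<^sup>+n. ennreal (out n * u n) \<partial>p)" .
    \<comment> \<open>Above level \<open>T\<close> the left side vanishes. Below it, replacing
      \<open>T - V\<close> by the larger \<open>u\<close> at the targets only increases the right
      side.\<close>
    have pw: "ennreal (out n * u n) + ennreal (g n) * indicator {n. V n < T} n
        \<le> ennreal (\<Sum>j\<in>J. rate j n * of_bool (tgt j n \<noteq> n) * u (tgt j n)) + ennreal (b n)"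
      if n: "n \<in> X" for n
    proof (cases "V n < T")
      case False
      then show ?thesis by (simp add: u_def)
    next
      case True
      have "out n * (T - V n) + g n - b n
          \<le> out n * (T - V n) - (\<Sum>j\<in>J. rate j n * (V (tgt j n) - V n))"
        using drift[OF n] by simp
      also have "\<dots> = (\<Sum>j\<in>J. rate j n * of_bool (tgt j n \<noteq> n) * (T - V (tgt j n)))"
        unfolding out_def sum_distrib_right sum_subtractf[symmetric]
        by (intro sum.cong) (auto simp: algebra_simps)
      also have "\<dots> \<le> (\<Sum>j\<in>J. rate j n * of_bool (tgt j n \<noteq> n) * u (tgt j n))"
        using rate0[OF n] by (intro sum_mono mult_left_mono) (auto simp: u_def)
      finally have "out n * u n + g n \<le> (\<Sum>j\<in>J. rate j n * of_bool (tgt j n \<noteq> n) * u (tgt j n)) + b n"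
        using True by (simp add: u_def)
      moreover have "0 \<le> (\<Sum>j\<in>J. rate j n * of_bool (tgt j n \<noteq> n) * u (tgt j n))"
        using rate0[OF n] u0 by (intro sum_nonneg) auto
      ultimately show ?thesis
        using True n nonneg out0[OF n] u0[of n] by (simp add: ennreal_plus[symmetric] del: ennreal_plus)
    qed
    have "(\<integral>\<^sup>+n. ennreal (out n * u n) \<partial>p) + (\<integral>\<^sup>+n. ennreal (g n) * indicator {n. V n < T} n \<partial>p)
        = (\<integral>\<^sup>+n. ennreal (out n * u n) + ennreal (g n) * indicator {n. V n < T} n \<partial>p)"
      by (subst nn_integral_add) auto
    also have "\<dots> \<le> (\<integral>\<^sup>+n. ennreal (\<Sum>j\<in>J. rate j n * of_bool (tgt j n \<noteq> n) * u (tgt j n)) + ennreal (b n) \<partial>p)"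
      using pw supp by (intro nn_integral_mono_AE) (auto simp: AE_measure_pmf_iff)
    also have "\<dots> = (\<integral>\<^sup>+n. ennreal (\<Sum>j\<in>J. rate j n * of_bool (tgt j n \<noteq> n) * u (tgt j n)) \<partial>p)
        + (\<integral>\<^sup>+n. ennreal (b n) \<partial>p)"
      by (subst nn_integral_add) auto
    also have "\<dots> \<le> (\<integral>\<^sup>+n. ennreal (out n * u n) \<partial>p) + (\<integral>\<^sup>+n. ennreal (b n) \<partial>p)"
      using bal by (rule add_right_mono)
    finally have le: "(\<integral>\<^sup>+n. ennreal (out n * u n) \<partial>p) + (\<integral>\<^sup>+n. ennreal (g n) * indicator {n. V n < T} n \<partial>p)
        \<le> (\<integral>\<^sup>+n. ennreal (out n * u n) \<partial>p) + (\<integral>\<^sup>+n. ennreal (b n) \<partial>p)" .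
    \<comment> \<open>Finiteness of the common term allows it to be cancelled.\<close>
    have "(\<integral>\<^sup>+n. ennreal (out n * u n) \<partial>p) \<le> (\<integral>\<^sup>+n. ennreal (\<Lambda> * T) \<partial>p)"
      using supp out_le out0 u0 uT \<Lambda>0
      by (intro nn_integral_mono_AE) (auto simp: AE_measure_pmf_iff subset_eq intro!: ennreal_leI mult_mono)
    also have "\<dots> < \<top>" by simp
    finally show ?thesis using le by (auto simp: ennreal_add_left_cancel_le)
  qed
  have inc: "incseq (\<lambda>i::nat. \<lambda>n. ennreal (g n) * indicator {n. V n < real i} n)"
    by (auto simp: incseq_def le_fun_def split: split_indicator)
  have "(\<integral>\<^sup>+n. ennreal (g n) \<partial>p) = (\<integral>\<^sup>+n. (SUP i::nat. ennreal (g n) * indicator {n. V n < real i} n) \<partial>p)"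
  proof (intro nn_integral_cong)
    fix n
    obtain i :: nat where i: "V n < real i" using reals_Archimedean2 by blast
    show "ennreal (g n) = (SUP i::nat. ennreal (g n) * indicator {n. V n < real i} n)"
    proof (rule antisym)
      show "ennreal (g n) \<le> (SUP i::nat. ennreal (g n) * indicator {n. V n < real i} n)"
        by (rule SUP_upper2[of i]) (use i in auto)
      show "(SUP i::nat. ennreal (g n) * indicator {n. V n < real i} n) \<le> ennreal (g n)"
        by (intro SUP_least) (auto split: split_indicator)
    qed
  qed
  also have "\<dots> = (SUP i::nat. \<integral>\<^sup>+n. ennreal (g n) * indicator {n. V n < real i} n \<partial>p)"
    by (rule nn_integral_monotone_convergence_SUP[OF inc]) auto
  also have "\<dots> \<le> (\<integral>\<^sup>+n. ennreal (b n) \<partial>p)" by (intro SUP_least main) auto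
  finally show ?thesis .
qed

text \<open>A second-order Taylor bound for powers of a squared norm: a bounded jump changes F by
  some d of order sqrt F, so the remainder has order k - 1 in F. The induction multiplies by
  \<open>F + d\<close>, which must therefore be nonnegative; the new terms cost a factor of at most
  1 + 2A, and the summand 2 in the base of the constant also absorbs the factor k.\<close>

lemma power_add_le:
  fixes F d :: real
  assumes "1 \<le> k" "0 \<le> A" "0 \<le> F" "0 \<le> F + d" "d\<^sup>2 \<le> A * (1 + F)" "d \<le> A * (1 + F)"
  shows "(F + d) ^ k \<le> F ^ k + real k * F ^ (k - 1) * d + (2 + 2 * A) ^ k * (1 + F) ^ (k - 1)"
  using assms(1)
proof (induction k rule: dec_induct)
  case base
  show ?case using assms by simp
next
  case (step k)
  then obtain j where k: "k = Suc j" by (cases k) auto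
  define C where "C = (2 + 2 * A) ^ k"
  have "real k \<le> 2 ^ k" by (metis less_exp less_imp_le of_nat_le_iff of_nat_numeral of_nat_power)
  also have "\<dots> \<le> C" unfolding C_def using assms(2) by (intro power_mono) auto
  finally have kC: "real k \<le> C" .
  have C0: "0 \<le> C" using assms(2) by (simp add: C_def)
  have "(F + d) ^ Suc k \<le> (F + d) * (F ^ k + real k * F ^ j * d + C * (1 + F) ^ j)"
    using step.IH assms(4) by (auto simp: k C_def intro!: mult_left_mono)
  also have "\<dots> = F ^ Suc k + real (Suc k) * F ^ k * d + (real k * F ^ j) * d\<^sup>2
      + (F + d) * (C * (1 + F) ^ j)"
    by (simp add: k algebra_simps power2_eq_square)
  also have "\<dots> \<le> F ^ Suc k + real (Suc k) * F ^ k * d + (C * (1 + F) ^ j) * (A * (1 + F))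
      + ((1 + A) * (1 + F)) * (C * (1 + F) ^ j)"
  proof -
    have "(real k * F ^ j) * d\<^sup>2 \<le> (C * (1 + F) ^ j) * (A * (1 + F))"
      using assms kC C0 by (intro mult_mono power_mono) auto
    moreover have "(F + d) * (C * (1 + F) ^ j) \<le> ((1 + A) * (1 + F)) * (C * (1 + F) ^ j)"
      using assms C0 by (intro mult_right_mono) (auto simp: algebra_simps)
    ultimately show ?thesis by linarith
  qed
  also have "\<dots> = F ^ Suc k + real (Suc k) * F ^ k * d + (1 + 2 * A) * C * (1 + F) ^ k"
    by (simp add: k algebra_simps)
  also have "\<dots> \<le> F ^ Suc k + real (Suc k) * F ^ k * d + (2 + 2 * A) ^ Suc k * (1 + F) ^ k"
  proof -
    have "(1 + 2 * A) * C \<le> (2 + 2 * A) ^ Suc k" using C0 by (auto simp: C_def intro!: mult_right_mono)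
    then have "(1 + 2 * A) * C * (1 + F) ^ k \<le> (2 + 2 * A) ^ Suc k * (1 + F) ^ k"
      using assms(3) by (intro mult_right_mono) auto
    then show ?thesis by linarith
  qed
  finally show ?case by simp
qed

text \<open>\<open>F\<close> is a squared distance, \<open>l j\<close> the inner product of the
  displacement with jump \<open>j\<close>, and \<open>A\<close> bounds the squared jump.
  \<open>F' j\<close> is bounded from above only, because after a jump the distance to the cone is
  compared with the distance to the old nearest point.\<close>

lemma power_drift:
  fixes rate F' l :: "'j \<Rightarrow> real"
  assumes k: "1 \<le> k" and A: "0 \<le> A" "0 \<le> F"
    and rate0: "\<And>j. j \<in> J \<Longrightarrow> 0 \<le> rate j" and bounded: "(\<Sum>j\<in>J. rate j) \<le> \<Lambda>"
    and F': "\<And>j. j \<in> J \<Longrightarrow> rate j \<noteq> 0 \<Longrightarrow> 0 \<le> F' j \<and> F' j \<le> F + 2 * l j + A"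
    and l: "\<And>j. j \<in> J \<Longrightarrow> rate j \<noteq> 0 \<Longrightarrow> (l j)\<^sup>2 \<le> A * F"
    and b: "(\<Sum>j\<in>J. rate j * l j) \<le> b"
  shows "(\<Sum>j\<in>J. rate j * (F' j ^ k - F ^ k))
           \<le> real k * F ^ (k - 1) * (2 * b + A * \<Lambda>)
             + (6 + 20 * A + 4 * A\<^sup>2) ^ k * \<Lambda> * (1 + F) ^ (k - 1)"
proof -
  \<comment> \<open>Chosen so that \<open>B * (1 + F)\<close> dominates both d and d^2 for
    \<open>d = 2 * l j + A\<close>. The base of the constant in the statement is
    \<open>2 + 2 * B\<close>.\<close>
  define B where "B = 2 + 10 * A + 2 * A\<^sup>2"
  have B0: "0 \<le> B" using A by (simp add: B_def)
  have AF: "0 \<le> A * F" "0 \<le> A\<^sup>2 * F" "0 \<le> A\<^sup>2" using A by auto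
  have BF: "B * (1 + F) = 2 + 2 * F + 10 * A + 10 * (A * F) + 2 * A\<^sup>2 + 2 * (A\<^sup>2 * F)"
    by (simp add: B_def algebra_simps)
  have step: "rate j * (F' j ^ k - F ^ k)
      \<le> rate j * (real k * F ^ (k - 1) * (2 * l j + A) + (2 + 2 * B) ^ k * (1 + F) ^ (k - 1))"
    if j: "j \<in> J" for j
  proof (cases "rate j = 0")
    case False
    define d where "d = 2 * l j + A"
    have F'j: "0 \<le> F' j" "F' j \<le> F + d" using F'[OF j False] by (auto simp: d_def)
    have l2: "(l j)\<^sup>2 \<le> A * F" by (rule l[OF j False])
    have "d\<^sup>2 \<le> 8 * (l j)\<^sup>2 + 2 * A\<^sup>2"
      using sum_squares_bound[of "2 * l j" A] by (simp add: d_def power2_sum power_mult_distrib)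
    also have "\<dots> \<le> B * (1 + F)" unfolding BF using l2 A AF by linarith
    finally have 1: "d\<^sup>2 \<le> B * (1 + F)" .
    have "2 * l j \<le> 1 + (l j)\<^sup>2" using sum_squares_bound[of "l j" 1] by simp
    then have 2: "d \<le> B * (1 + F)" unfolding BF d_def using l2 A AF by linarith
    have "F' j ^ k \<le> (F + d) ^ k" using F'j by (intro power_mono)
    also have "\<dots> \<le> F ^ k + real k * F ^ (k - 1) * d + (2 + 2 * B) ^ k * (1 + F) ^ (k - 1)"
      using F'j by (intro power_add_le[OF k B0 A(2) _ 1 2]) auto
    finally show ?thesis using rate0[OF j] by (intro mult_left_mono) (auto simp: d_def)
  qed auto
  have "(\<Sum>j\<in>J. rate j * (F' j ^ k - F ^ k)) \<le> (\<Sum>j\<in>J. rate j *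
      (real k * F ^ (k - 1) * (2 * l j + A) + (2 + 2 * B) ^ k * (1 + F) ^ (k - 1)))"
    by (intro sum_mono step)
  also have "\<dots> = (\<Sum>j\<in>J. (real k * F ^ (k - 1) * 2) * (rate j * l j)
      + (real k * F ^ (k - 1) * A + (2 + 2 * B) ^ k * (1 + F) ^ (k - 1)) * rate j)"
    by (intro sum.cong) (auto simp: algebra_simps)
  also have "\<dots> = (real k * F ^ (k - 1) * 2) * (\<Sum>j\<in>J. rate j * l j)
      + (real k * F ^ (k - 1) * A + (2 + 2 * B) ^ k * (1 + F) ^ (k - 1)) * (\<Sum>j\<in>J. rate j)"
    by (simp add: sum.distrib sum_distrib_left)
  also have "\<dots> \<le> (real k * F ^ (k - 1) * 2) * b
      + (real k * F ^ (k - 1) * A + (2 + 2 * B) ^ k * (1 + F) ^ (k - 1)) * \<Lambda>"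
    using A B0 b bounded by (intro add_mono mult_left_mono) auto
  finally show ?thesis by (simp add: B_def algebra_simps)
qed

section \<open>Mixtures of Erlang distributions\<close>

lemma integral_FTC_atLeast:
  fixes f F :: "real \<Rightarrow> real"
  assumes deriv: "\<And>x. a \<le> x \<Longrightarrow> DERIV F x :> f x" and cont: "\<And>x. a \<le> x \<Longrightarrow> isCont f x"
    and int: "set_integrable lborel {a..} f" and lim: "(F \<longlongrightarrow> T) at_top"
  shows "(LINT x:{a..}|lborel. f x) = T - F a"
proof -
  have "((\<lambda>b. LINT x:{a..b}|lborel. f x) \<longlongrightarrow> (LINT x:{a..}|lborel. f x)) at_top"
    by (rule tendsto_set_lebesgue_integral_at_top[OF _ int]) simp
  moreover have "eventually (\<lambda>b. (LINT x:{a..b}|lborel. f x) = F b - F a) at_top"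
    using eventually_ge_at_top[of a]
  proof eventually_elim
    case (elim b)
    have "(\<integral>x. f x * indicator {a..b} x \<partial>lborel) = F b - F a"
      using elim deriv cont by (intro integral_FTC_Icc_real) auto
    then show ?case by (simp add: set_lebesgue_integral_def mult.commute)
  qed
  ultimately have "((\<lambda>b. F b - F a) \<longlongrightarrow> (LINT x:{a..}|lborel. f x)) at_top"
    by (blast intro: Lim_transform_eventually)
  moreover have "((\<lambda>b. F b - F a) \<longlongrightarrow> T - F a) at_top" using lim by (intro tendsto_intros)
  ultimately show ?thesis using tendsto_unique[OF trivial_limit_at_top_linorder] by blast
qed

lemma
  fixes c :: real
  assumes "0 < c"
  shows set_integrable_exp_decay: "set_integrable lborel {0..} (\<lambda>s. exp (- (c * s)))"
    and set_integral_exp_decay: "(LINT s:{0..}|lborel. exp (- (c * s))) = 1 / c"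
proof -
  have d: "DERIV (\<lambda>s. - exp (- (c * s)) / c) x :> exp (- (c * x))" for x
    using assms by (auto intro!: derivative_eq_intros simp: field_simps)
  have "((\<lambda>s. - exp (- (c * s)) / c) \<longlongrightarrow> - 0 / c) at_top"
    using assms by (intro tendsto_intros filterlim_compose[OF exp_at_bot]
      filterlim_compose[OF filterlim_uminus_at_bot_at_top] filterlim_tendsto_pos_mult_at_top[OF tendsto_const] filterlim_ident) auto
  then have lim: "((\<lambda>s. - exp (- (c * s)) / c) \<longlongrightarrow> 0) at_top" by simp
  have "(\<integral>\<^sup>+s. ennreal (exp (- (c * s))) * indicator {0..} s \<partial>lborel) = ennreal (0 - (- exp (- (c * 0)) / c))"
    by (rule nn_integral_FTC_atLeast[OF _ d _ lim]) auto
  also have "\<dots> < \<infinity>" by simp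
  finally have "(\<integral>\<^sup>+s. ennreal (norm (indicator {0..} s *\<^sub>R exp (- (c * s)))) \<partial>lborel) < \<infinity>"
    by (simp add: mult.commute indicator_mult_ennreal)
  then show int: "set_integrable lborel {0..} (\<lambda>s. exp (- (c * s)))"
    unfolding set_integrable_def by (intro integrableI_bounded) auto
  show "(LINT s:{0..}|lborel. exp (- (c * s))) = 1 / c"
    by (subst integral_FTC_atLeast[OF d _ int lim]) auto
qed

lemma set_integrable_exp_bound:
  fixes f :: "real \<Rightarrow> real"
  assumes "0 < c" and "continuous_on {0..} f" and "\<And>s. 0 \<le> s \<Longrightarrow> \<bar>f s\<bar> \<le> C * exp (- (c * s))"
  shows "set_integrable lborel {0..} f"
proof (rule set_integrable_bound)
  show "set_integrable lborel {0..} (\<lambda>s. C * exp (- (c * s)))"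
    using set_integrable_exp_decay[OF assms(1)] by simp
  show "set_borel_measurable lborel {0..} f"
    unfolding set_borel_measurable_def
    using borel_measurable_continuous_on_indicator[OF _ assms(2)] by simp
  show "AE s in lborel. s \<in> {0..} \<longrightarrow> norm (f s) \<le> norm (C * exp (- (c * s)))"
    using assms(3) by (auto intro!: AE_I2 order_trans[OF _ abs_ge_self])
qed

text \<open>\<open>cnt i\<close> is the number of phases from \<open>i\<close> to the end of its block, \<open>\<nu> i\<close> the rate of
  the block.\<close>

locale erlang_mixture =
  fixes K :: nat and cnt :: "nat \<Rightarrow> nat" and \<nu> p :: "nat \<Rightarrow> real"
  assumes \<nu>_pos: "i < K \<Longrightarrow> 0 < \<nu> i"
    and cnt_pos: "i < K \<Longrightarrow> 0 < cnt i"
    and cnt_le: "i < K \<Longrightarrow> i + cnt i \<le> K"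
    and cnt_Suc: "i < K \<Longrightarrow> 1 < cnt i \<Longrightarrow> cnt (Suc i) = cnt i - 1"
    and \<nu>_Suc: "i < K \<Longrightarrow> 1 < cnt i \<Longrightarrow> \<nu> (Suc i) = \<nu> i"
    and p_nonneg: "i < K \<Longrightarrow> 0 \<le> p i"
    and p_sum: "(\<Sum>i<K. p i) = 1"
    and first: "i < K \<Longrightarrow> \<exists>f<K. 0 < p f \<and> \<nu> f = \<nu> i \<and> cnt i \<le> cnt f"
begin

definition S :: "nat \<Rightarrow> nat \<Rightarrow> real" where
  "S i j = (if i = j then - \<nu> i else if j = Suc i \<and> 1 < cnt i then \<nu> i else 0)"

text \<open>The Erlang survival function: from phase \<open>i\<close> the residual size exceeds s
  iff a Poisson process of rate \<open>\<nu> i\<close> has fewer than \<open>cnt i\<close> points up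
  to s.\<close>

definition surv :: "nat \<Rightarrow> real \<Rightarrow> real" where
  "surv i s = exp (- (\<nu> i * s)) * (\<Sum>k<cnt i. (\<nu> i * s) ^ k / fact k)"

text \<open>The Green matrix of the phases, which is the inverse of -S: mean size spent in phase
  \<open>j\<close> by a flow now in phase \<open>i\<close>.\<close>

definition B :: "nat \<Rightarrow> nat \<Rightarrow> real" where
  "B i j = (if i \<le> j \<and> j < i + cnt i then 1 / \<nu> i else 0)"

definition load :: "nat \<Rightarrow> real" where
  "load j = (\<Sum>k<K. p k * B k j)"

text \<open>The function \<phi> of the overview. The weights may be negative, since differences of
  states and cone points occur.\<close>

definition prof :: "(nat \<Rightarrow> real) \<Rightarrow> real \<Rightarrow> real" where
  "prof v s = (\<Sum>i<K. v i * surv i s)"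

definition mean :: real where
  "mean = (\<Sum>j<K. load j)"

definition Sv :: "(nat \<Rightarrow> real) \<Rightarrow> nat \<Rightarrow> real" where
  "Sv v j = (\<Sum>i<K. v i * S i j)"

lemma K_pos: "0 < K"
  using p_sum by (cases K) auto

lemma Suc_less: "i < K \<Longrightarrow> 1 < cnt i \<Longrightarrow> Suc i < K"
  using cnt_le[of i] by linarith

lemma sum_S:
  assumes "i < K"
  shows "(\<Sum>j<K. S i j * f j) = \<nu> i * ((if 1 < cnt i then f (Suc i) else 0) - f i)"
proof -
  have "(\<Sum>j<K. S i j * f j) = (\<Sum>j<K. (if j = i then - \<nu> i * f i else 0)
      + (if j = Suc i then if 1 < cnt i then \<nu> i * f (Suc i) else 0 else 0))"
    by (intro sum.cong) (auto simp: S_def)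
  then show ?thesis
    using assms Suc_less[OF assms] by (auto simp: sum.distrib sum.delta algebra_simps)
qed

text \<open>The backward equation. Differentiating the truncated exponential series removes its last
  term, and what is left is the series of the next phase.\<close>

lemma surv_deriv:
  assumes "i < K"
  shows "(surv i has_real_derivative (\<Sum>j<K. S i j * surv j s)) (at s)"
proof -
  obtain c where c: "cnt i = Suc c" using cnt_pos[OF assms] by (cases "cnt i") auto
  define e where "e k s = (\<nu> i * s) ^ k / fact k" for k s
  have e: "((\<lambda>s. \<Sum>k<Suc c. e k s) has_real_derivative \<nu> i * (\<Sum>k<c. e k s)) (at s)" for c
  proof (induction c)
    case 0
    then show ?case by (simp add: e_def)
  next
    case (Suc c)
    have "(e (Suc c) has_real_derivative \<nu> i * e c s) (at s)"
      unfolding e_def by (rule derivative_eq_intros refl | simp)+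
    from DERIV_add[OF Suc this] show ?case by (simp add: algebra_simps)
  qed
  have "((\<lambda>s. exp (- (\<nu> i * s)) * (\<Sum>k<Suc c. e k s)) has_real_derivative
      (- \<nu> i * exp (- (\<nu> i * s))) * (\<Sum>k<Suc c. e k s)
        + (\<nu> i * (\<Sum>k<c. e k s)) * exp (- (\<nu> i * s))) (at s)"
    by (rule DERIV_mult[OF _ e]) (auto intro!: derivative_eq_intros)
  moreover have "surv i = (\<lambda>s. exp (- (\<nu> i * s)) * (\<Sum>k<Suc c. e k s))"
    by (auto simp: surv_def e_def c)
  moreover have "(\<Sum>j<K. S i j * surv j s) = (- \<nu> i * exp (- (\<nu> i * s))) * (\<Sum>k<Suc c. e k s)
        + (\<nu> i * (\<Sum>k<c. e k s)) * exp (- (\<nu> i * s))"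
    using cnt_Suc[OF assms] \<nu>_Suc[OF assms] c
    by (cases "1 < cnt i") (auto simp: sum_S[OF assms] surv_def e_def algebra_simps)
  ultimately show ?thesis by simp
qed

lemma surv_0: "i < K \<Longrightarrow> surv i 0 = 1"
  using cnt_pos[of i] by (cases "cnt i") (auto simp: surv_def sum.lessThan_Suc_shift simp del: sum.lessThan_Suc)

lemma surv_ge:
  assumes "i < K" "0 \<le> s"
  shows "exp (- (\<nu> i * s)) \<le> surv i s"
proof -
  have "(1::real) = (\<Sum>k<1. (\<nu> i * s) ^ k / fact k)" by simp
  also have "\<dots> \<le> (\<Sum>k<cnt i. (\<nu> i * s) ^ k / fact k)"
    using cnt_pos[OF assms(1)] \<nu>_pos[OF assms(1)] assms(2) by (intro sum_mono2) auto
  finally show ?thesis unfolding surv_def by simp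
qed

lemma surv_pos: "i < K \<Longrightarrow> 0 \<le> s \<Longrightarrow> 0 < surv i s"
  using surv_ge[of i s] exp_gt_zero[of "- (\<nu> i * s)"] by linarith

lemma surv_mono:
  assumes "i < K" "f < K" "\<nu> f = \<nu> i" "cnt i \<le> cnt f" "0 \<le> s"
  shows "surv i s \<le> surv f s"
  unfolding surv_def using assms \<nu>_pos[OF assms(1)] by (auto intro!: mult_left_mono sum_mono2)

lemma surv_le_exp:
  obtains c C where "0 < c" "0 < C" "\<And>i s. i < K \<Longrightarrow> 0 \<le> s \<Longrightarrow> surv i s \<le> C * exp (- (c * s))"
proof
  \<comment> \<open>Half of the smallest rate. With x = \<nu> i * s / 2 the other half of the
    exponent absorbs the polynomial, because (2x)^k / k! is at most 2^k exp x.\<close>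
  define c where "c = Min (\<nu> ` {..<K}) / 2"
  define C where "C = (\<Sum>i<K. \<Sum>k<cnt i. (2::real) ^ k)"
  have "Min (\<nu> ` {..<K}) \<in> \<nu> ` {..<K}" using K_pos by (intro Min_in) auto
  then show c: "0 < c" using \<nu>_pos by (auto simp: c_def)
  have "0 < (\<Sum>k<cnt i. (2::real) ^ k)" if "i < K" for i
    using cnt_pos[OF that] by (intro sum_pos) (auto simp: lessThan_empty_iff)
  then show "0 < C" unfolding C_def using K_pos by (subst sum_pos) (auto simp: lessThan_empty_iff)
  fix i s assume i: "i < K" and s: "(0::real) \<le> s"
  have ci: "2 * c \<le> \<nu> i" using i by (auto simp: c_def)
  define x where "x = \<nu> i * s / 2"
  have x: "0 \<le> x" using \<nu>_pos[OF i] s by (simp add: x_def)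
  have "(\<Sum>k<cnt i. (\<nu> i * s) ^ k / fact k) \<le> (\<Sum>k<cnt i. 2 ^ k * exp x)"
  proof (rule sum_mono)
    fix k
    have "(\<nu> i * s) ^ k / fact k = 2 ^ k * (x ^ k / fact k)"
      by (simp add: x_def power_divide)
    moreover have "x ^ k / fact k \<le> exp x"
    proof -
      have "(\<Sum>n\<in>{k}. x ^ n / fact n) \<le> (\<Sum>n. x ^ n / fact n)"
        using x summable_exp[of x] by (intro sum_le_suminf) (auto simp: divide_inverse mult.commute)
      then show ?thesis by (simp add: exp_def divide_inverse mult.commute)
    qed
    ultimately show "(\<nu> i * s) ^ k / fact k \<le> 2 ^ k * exp x"
      by (metis mult_left_mono zero_le_numeral zero_le_power)
  qed
  also have "\<dots> = (\<Sum>k<cnt i. 2 ^ k) * exp x" by (simp add: sum_distrib_right)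
  finally have "surv i s \<le> exp (- (\<nu> i * s)) * ((\<Sum>k<cnt i. 2 ^ k) * exp x)"
    unfolding surv_def by (intro mult_left_mono) auto
  also have "\<dots> = (\<Sum>k<cnt i. 2 ^ k) * exp (- x)"
    by (simp add: x_def flip: exp_add)
  also have "\<dots> \<le> C * exp (- (c * s))"
  proof (rule mult_mono)
    show "(\<Sum>k<cnt i. (2::real) ^ k) \<le> C"
      unfolding C_def using i by (intro member_le_sum) (auto intro!: sum_nonneg)
    show "exp (- x) \<le> exp (- (c * s))"
      using ci s mult_right_mono[OF ci s] by (simp add: x_def)
    show "0 \<le> C" using \<open>0 < C\<close> by simp
  qed auto
  finally show "surv i s \<le> C * exp (- (c * s))" .
qed

lemma prof_deriv: "(prof v has_real_derivative prof (Sv v) s) (at s)"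
proof -
  have "((\<lambda>s. \<Sum>i<K. v i * surv i s) has_real_derivative (\<Sum>i<K. v i * (\<Sum>j<K. S i j * surv j s))) (at s)"
    by (intro DERIV_sum DERIV_cmult surv_deriv) auto
  also have "(\<Sum>i<K. v i * (\<Sum>j<K. S i j * surv j s)) = (\<Sum>i<K. \<Sum>j<K. v i * S i j * surv j s)"
    by (simp add: sum_distrib_left mult.assoc)
  also have "\<dots> = prof (Sv v) s"
    unfolding prof_def Sv_def by (subst sum.swap) (simp add: sum_distrib_right)
  finally show ?thesis by (simp add: prof_def[abs_def])
qed

lemma prof_cont: "isCont (prof v) s"
  using prof_deriv DERIV_isCont by blast

lemma prof_cont_on: "continuous_on X (prof v)"
  using prof_cont by (simp add: continuous_at_imp_continuous_on)

lemma S_B: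
  assumes "i < K" "j < K"
  shows "(\<Sum>k<K. S i k * B k j) = - of_bool (i = j)"
proof -
  have "(\<Sum>k<K. S i k * B k j) = \<nu> i * ((if 1 < cnt i then B (Suc i) j else 0) - B i j)"
    by (rule sum_S[OF assms(1)])
  then show ?thesis
    using cnt_Suc[OF assms(1)] \<nu>_Suc[OF assms(1)] cnt_pos[OF assms(1)] \<nu>_pos[OF assms(1)]
    by (auto simp: B_def)
qed

lemma B_S:
  assumes "i < K" "j < K"
  shows "(\<Sum>k<K. B i k * S k j) = - of_bool (i = j)"
proof -
  have cnt_add: "d < cnt i \<Longrightarrow> i + d < K \<and> cnt (i + d) = cnt i - d \<and> \<nu> (i + d) = \<nu> i" for d
  proof (induction d)
    case 0
    then show ?case using assms by simp
  next
    case (Suc d)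
    then show ?case
      using cnt_Suc[of "i + d"] \<nu>_Suc[of "i + d"] cnt_le[OF assms(1)] by auto
  qed
  have S_col: "S k j = (if k = j then - \<nu> j else 0) + (if j = Suc k \<and> 1 < cnt k then \<nu> k else 0)" for k
    by (auto simp: S_def)
  have "(\<Sum>k<K. B i k * S k j) = - B i j * \<nu> j + (\<Sum>k<K. B i k * (if j = Suc k \<and> 1 < cnt k then \<nu> k else 0))"
    using assms(2) unfolding S_col by (simp add: sum.distrib distrib_left if_distrib[of "\<lambda>x. _ * x"] cong: if_cong)
  \<comment> \<open>Off the diagonal, column \<open>j\<close> of S has at most the entry in row
    \<open>j - 1\<close>. The first column is separate because subtraction on naturals is
    truncated.\<close>
  also have "(\<Sum>k<K. B i k * (if j = Suc k \<and> 1 < cnt k then \<nu> k else 0))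
      = (if j = 0 then 0 else B i (j - 1) * (if 1 < cnt (j - 1) then \<nu> (j - 1) else 0))"
  proof (cases j)
    case 0
    then show ?thesis by (auto intro!: sum.neutral)
  next
    case (Suc k)
    have "(\<Sum>ka<K. B i ka * (if j = Suc ka \<and> 1 < cnt ka then \<nu> ka else 0))
        = (\<Sum>ka<K. if ka = k then B i k * (if 1 < cnt k then \<nu> k else 0) else 0)"
      using Suc by (intro sum.cong) auto
    then show ?thesis using Suc assms(2) by simp
  qed
  also have "- B i j * \<nu> j + (if j = 0 then 0 else B i (j - 1) * (if 1 < cnt (j - 1) then \<nu> (j - 1) else 0))
      = - of_bool (i = j)"
  proof (cases "i \<le> j \<and> j < i + cnt i")
    case True
    then obtain d where d: "j = i + d" "d < cnt i" using le_Suc_ex by (auto simp: nat_le_iff_add)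
    show ?thesis
    proof (cases d)
      case 0
      then show ?thesis using d \<nu>_pos[OF assms(1)] by (auto simp: B_def)
    next
      case (Suc e)
      then show ?thesis using d cnt_add[of e] cnt_add[of d] \<nu>_pos[OF assms(1)] by (auto simp: B_def)
    qed
  next
    case False
    then have "B i j = 0" by (auto simp: B_def)
    moreover have "\<not> (j \<noteq> 0 \<and> i \<le> j - 1 \<and> j - 1 < i + cnt i \<and> 1 < cnt (j - 1))"
    proof
      assume a: "j \<noteq> 0 \<and> i \<le> j - 1 \<and> j - 1 < i + cnt i \<and> 1 < cnt (j - 1)"
      then obtain d where d: "j - 1 = i + d" "d < cnt i" by (auto simp: nat_le_iff_add)
      with cnt_add[of d] a False show False by auto
    qed
    moreover have "i \<noteq> j" using False cnt_pos[OF assms(1)] by auto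
    ultimately show ?thesis by (auto simp: B_def)
  qed
  finally show ?thesis .
qed

lemma load_nonneg: "j < K \<Longrightarrow> 0 \<le> load j"
  unfolding load_def B_def using p_nonneg \<nu>_pos by (intro sum_nonneg) (auto simp: less_imp_le)

lemma Sv_load:
  assumes "j < K"
  shows "Sv load j = - p j"
proof -
  have "Sv load j = (\<Sum>k<K. \<Sum>i<K. p i * B i k * S k j)"
    by (simp add: Sv_def load_def sum_distrib_right)
  also have "\<dots> = (\<Sum>i<K. p i * (\<Sum>k<K. B i k * S k j))"
    by (subst sum.swap) (simp add: sum_distrib_left mult.assoc)
  also have "\<dots> = (\<Sum>i<K. p i * - of_bool (i = j))"
    using assms by (intro sum.cong) (auto simp: B_S)
  also have "\<dots> = (\<Sum>i<K. if i = j then - p j else 0)" by (intro sum.cong) auto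
  also have "\<dots> = - p j" using assms by simp
  finally show ?thesis .
qed

text \<open>These two are h and F of the overview; \<open>excess_deriv\<close> gives F = -
  h'.\<close>

abbreviation excess :: "real \<Rightarrow> real" where "excess \<equiv> prof load"
abbreviation tail :: "real \<Rightarrow> real" where "tail \<equiv> prof p"

lemma prof_cong: "(\<And>i. i < K \<Longrightarrow> u i = v i) \<Longrightarrow> prof u s = prof v s"
  by (simp add: prof_def)

lemma excess_deriv: "(excess has_real_derivative - tail s) (at s)"
proof -
  have "prof (Sv load) s = prof (\<lambda>j. - p j) s" by (rule prof_cong) (rule Sv_load)
  also have "\<dots> = - tail s" by (simp add: prof_def sum_negf)
  finally show ?thesis using prof_deriv[of load s] by simp
qed

text \<open>A residual size only grows stochastically when phases of the same rate are added. So
  positive weight on one phase with at least as many phases left makes the mixture dominate the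
  survival function of \<open>i\<close>.\<close>

lemma surv_le_prof:
  assumes w: "\<And>i. i < K \<Longrightarrow> 0 \<le> w i"
    and pos: "\<And>i. i < K \<Longrightarrow> \<exists>f<K. 0 < w f \<and> \<nu> f = \<nu> i \<and> cnt i \<le> cnt f"
  obtains C where "0 < C" "\<And>i s. i < K \<Longrightarrow> 0 \<le> s \<Longrightarrow> surv i s \<le> C * prof w s"
proof
  \<comment> \<open>Summing the reciprocals of all positive weights gives one constant for every
    \<open>i\<close>; the summand 1 keeps it positive.\<close>
  define C where "C = 1 + (\<Sum>k<K. if 0 < w k then 1 / w k else 0)"
  have "0 \<le> (\<Sum>k<K. if 0 < w k then 1 / w k else 0)" by (intro sum_nonneg) auto
  then show C: "0 < C" by (simp add: C_def)
  fix i s assume i: "i < K" and s: "(0::real) \<le> s"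
  obtain f where f: "f < K" "0 < w f" "\<nu> f = \<nu> i" "cnt i \<le> cnt f" using pos[OF i] by blast
  have "(if 0 < w f then 1 / w f else 0) \<le> (\<Sum>k<K. if 0 < w k then 1 / w k else 0)"
    using f by (intro member_le_sum) auto
  then have "1 \<le> C * w f" using f by (simp add: C_def field_simps)
  then have "surv f s \<le> (C * w f) * surv f s" using surv_pos[OF f(1) s] by simp
  moreover have "w f * surv f s \<le> prof w s"
    unfolding prof_def using f s surv_pos w
    by (intro member_le_sum[where f = "\<lambda>i. w i * surv i s"]) (auto simp: less_imp_le)
  then have "C * (w f * surv f s) \<le> C * prof w s" using C by simp
  moreover have "surv i s \<le> surv f s" using surv_mono[OF i f(1,3,4) s] .
  ultimately show "surv i s \<le> C * prof w s" by (simp add: mult.assoc)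
qed

lemma surv_le_tail:
  obtains C where "0 < C" "\<And>i s. i < K \<Longrightarrow> 0 \<le> s \<Longrightarrow> surv i s \<le> C * tail s"
  using p_nonneg first by (rule surv_le_prof) blast+

text \<open>The starting phases keep positive weight in \<open>load\<close>, because a file spends a
  positive mean size in the phase in which it starts.\<close>

lemma surv_le_excess:
  obtains C where "0 < C" "\<And>i s. i < K \<Longrightarrow> 0 \<le> s \<Longrightarrow> surv i s \<le> C * excess s"
proof -
  have pos: "\<exists>f<K. 0 < load f \<and> \<nu> f = \<nu> i \<and> cnt i \<le> cnt f" if "i < K" for i
  proof -
    obtain f where f: "f < K" "0 < p f" "\<nu> f = \<nu> i" "cnt i \<le> cnt f" using first \<open>i < K\<close> by blast
    have "p f * B f f \<le> load f"
      unfolding load_def using f p_nonneg \<nu>_pos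
      by (intro member_le_sum[where f = "\<lambda>k. p k * B k f"]) (auto simp: B_def less_imp_le)
    moreover have "0 < p f * B f f" using f \<nu>_pos[OF f(1)] cnt_pos[OF f(1)] by (simp add: B_def)
    ultimately have "0 < load f" by linarith
    with f show ?thesis by blast
  qed
  show ?thesis
    using load_nonneg pos by (rule surv_le_prof) (fact | rule that | assumption)+
qed

lemma excess_pos:
  assumes "0 \<le> s"
  shows "0 < excess s"
proof -
  obtain C where C: "0 < C" "\<And>i s. i < K \<Longrightarrow> 0 \<le> s \<Longrightarrow> surv i s \<le> C * excess s"
    by (rule surv_le_excess) blast
  have "0 < C * excess s" using C(2)[OF K_pos assms] surv_pos[OF K_pos assms] by linarith
  then show ?thesis using C(1) by (simp add: zero_less_mult_iff)
qed

text \<open>The hazard rate F / h of the stationary residual size is bounded below: h is a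
  nonnegative combination of survival functions, each dominated by a multiple of F.
  \<open>Q_drift\<close> needs this to bound the completed square by the norm.\<close>

lemma excess_le_tail:
  obtains c where "0 < c" "\<And>s. 0 \<le> s \<Longrightarrow> c * excess s \<le> tail s"
proof -
  obtain C where C: "0 < C" "\<And>i s. i < K \<Longrightarrow> 0 \<le> s \<Longrightarrow> surv i s \<le> C * tail s"
    by (rule surv_le_tail) blast
  define D where "D = 1 + mean * C"
  have mean0: "0 \<le> mean" unfolding mean_def by (intro sum_nonneg) (auto intro: load_nonneg)
  have "1 / D * excess s \<le> tail s" if s: "0 \<le> s" for s
  proof -
    have t0: "0 \<le> tail s" unfolding prof_def using p_nonneg surv_pos s
      by (intro sum_nonneg mult_nonneg_nonneg) (auto simp: less_imp_le)
    have "excess s \<le> (\<Sum>j<K. load j * (C * tail s))"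
      unfolding prof_def[of load] by (intro sum_mono mult_left_mono C load_nonneg s) auto
    also have "\<dots> = mean * C * tail s" by (simp add: mean_def sum_distrib_right mult.assoc)
    also have "\<dots> \<le> D * tail s" using t0 by (simp add: D_def distrib_right)
    finally show ?thesis using mean0 C(1) by (simp add: D_def field_simps add_pos_nonneg)
  qed
  moreover have "0 < 1 / D" using mean0 C(1) by (simp add: D_def add_pos_nonneg)
  ultimately show ?thesis using that by blast
qed

text \<open>The exponential bound serves integrability; the bound by \<open>excess\<close> keeps
  quotients by h bounded although h tends to 0. Adding the two constants lets one \<open>C\<close>
  serve both.\<close>

lemma prof_bounds:
  obtains c C where "0 < c" "0 < C" "\<And>v s. 0 \<le> s \<Longrightarrow> \<bar>prof v s\<bar> \<le> (\<Sum>i<K. \<bar>v i\<bar>) * C * exp (- (c * s))"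
    "\<And>v s. 0 \<le> s \<Longrightarrow> \<bar>prof v s\<bar> \<le> (\<Sum>i<K. \<bar>v i\<bar>) * C * excess s"
proof -
  obtain c C1 where 1: "0 < c" "0 < C1" "\<And>i s. i < K \<Longrightarrow> 0 \<le> s \<Longrightarrow> surv i s \<le> C1 * exp (- (c * s))"
    by (rule surv_le_exp) blast
  obtain C2 where 2: "0 < C2" "\<And>i s. i < K \<Longrightarrow> 0 \<le> s \<Longrightarrow> surv i s \<le> C2 * excess s"
    by (rule surv_le_excess) blast
  have gen: "\<bar>prof v s\<bar> \<le> (\<Sum>i<K. \<bar>v i\<bar>) * (C1 + C2) * y"
    if s: "0 \<le> s" and y: "0 \<le> y" "(\<forall>i<K. surv i s \<le> C1 * y) \<or> (\<forall>i<K. surv i s \<le> C2 * y)" for v s y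
  proof -
    have sy: "surv i s \<le> (C1 + C2) * y" if "i < K" for i
      using y that mult_nonneg_nonneg[OF less_imp_le[OF 1(2)] y(1)] mult_nonneg_nonneg[OF less_imp_le[OF 2(1)] y(1)]
      by (fastforce simp: distrib_right)
    have "\<bar>prof v s\<bar> \<le> (\<Sum>i<K. \<bar>v i * surv i s\<bar>)" unfolding prof_def by (rule sum_abs)
    also have "\<dots> \<le> (\<Sum>i<K. \<bar>v i\<bar> * ((C1 + C2) * y))"
      using surv_pos s sy by (intro sum_mono) (auto simp: abs_mult less_imp_le intro!: mult_left_mono)
    finally show ?thesis by (simp add: sum_distrib_right mult.assoc)
  qed
  show ?thesis
  proof (rule that[of c "C1 + C2"])
    show "\<bar>prof v s\<bar> \<le> (\<Sum>i<K. \<bar>v i\<bar>) * (C1 + C2) * exp (- (c * s))" if "0 \<le> s" for v s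
      by (rule gen) (use that 1(3) in auto)
    show "\<bar>prof v s\<bar> \<le> (\<Sum>i<K. \<bar>v i\<bar>) * (C1 + C2) * excess s" if "0 \<le> s" for v s
      by (rule gen) (use that 2(2) excess_pos[of s] in auto)
  qed (use 1 2 in auto)
qed

definition Q :: "(nat \<Rightarrow> real) \<Rightarrow> (nat \<Rightarrow> real) \<Rightarrow> real" where
  "Q u v = (LINT s:{0..}|lborel. prof u s * prof v s / excess s)"

lemma excess_nz: "0 \<le> s \<Longrightarrow> excess s \<noteq> 0"
  using excess_pos[of s] by simp

lemma prof_integrable: "set_integrable lborel {0..} (prof v)"
proof -
  obtain c C where "0 < c" "\<And>v s. 0 \<le> s \<Longrightarrow> \<bar>prof v s\<bar> \<le> (\<Sum>i<K. \<bar>v i\<bar>) * C * exp (- (c * s))"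
    by (rule prof_bounds) blast
  then show ?thesis by (intro set_integrable_exp_bound[where C = "(\<Sum>i<K. \<bar>v i\<bar>) * C"] prof_cont_on)
qed

lemma Q_integrable: "set_integrable lborel {0..} (\<lambda>s. prof u s * prof v s / excess s)"
proof -
  obtain c C where c: "0 < c" "\<And>v s. 0 \<le> s \<Longrightarrow> \<bar>prof v s\<bar> \<le> (\<Sum>i<K. \<bar>v i\<bar>) * C * exp (- (c * s))"
    "\<And>v s. 0 \<le> s \<Longrightarrow> \<bar>prof v s\<bar> \<le> (\<Sum>i<K. \<bar>v i\<bar>) * C * excess s"
    by (rule prof_bounds) blast
  show ?thesis
  proof (rule set_integrable_exp_bound[OF c(1)])
    show "continuous_on {0..} (\<lambda>s. prof u s * prof v s / excess s)"
      by (intro continuous_intros prof_cont_on) (auto simp: excess_nz)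
    fix s :: real assume s: "0 \<le> s"
    have "\<bar>prof u s * prof v s / excess s\<bar> = \<bar>prof u s\<bar> * (\<bar>prof v s\<bar> / excess s)"
      using excess_pos[OF s] by (simp add: abs_mult)
    also have "\<dots> \<le> ((\<Sum>i<K. \<bar>u i\<bar>) * C * exp (- (c * s))) * ((\<Sum>i<K. \<bar>v i\<bar>) * C)"
      using c(2,3)[OF s] excess_pos[OF s]
      by (intro mult_mono) (auto simp: pos_divide_le_eq intro: order_trans[OF abs_ge_zero])
    finally show "\<bar>prof u s * prof v s / excess s\<bar>
        \<le> ((\<Sum>i<K. \<bar>u i\<bar>) * C * ((\<Sum>i<K. \<bar>v i\<bar>) * C)) * exp (- (c * s))"
      by (simp add: mult_ac)
  qed
qed

lemma Q_sq_nonneg: "0 \<le> Q v v"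
  unfolding Q_def set_lebesgue_integral_def
  using excess_pos by (intro integral_nonneg_AE AE_I2) (auto simp: less_imp_le split: split_indicator)

lemma Q_add: "Q u (\<lambda>i. v i + w i) = Q u v + Q u w"
proof -
  have "prof (\<lambda>i. v i + w i) s = prof v s + prof w s" for s
    by (simp add: prof_def distrib_right sum.distrib)
  then show ?thesis
    using Q_integrable by (simp add: Q_def distrib_left add_divide_distrib set_integral_add(2))
qed

lemma Q_scale: "Q u (\<lambda>i. c * v i) = c * Q u v"
proof -
  have "prof (\<lambda>i. c * v i) s = c * prof v s" for s
    by (simp add: prof_def sum_distrib_left mult.assoc)
  then have "Q u (\<lambda>i. c * v i) = (LINT s:{0..}|lborel. c * (prof u s * prof v s / excess s))"
    by (simp add: Q_def mult_ac)
  then show ?thesis by (simp only: Q_def set_integral_mult_right)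
qed

lemma Q_sum: "finite A \<Longrightarrow> Q u (\<lambda>i. \<Sum>a\<in>A. f a i) = (\<Sum>a\<in>A. Q u (f a))"
proof (induction A rule: finite_induct)
  case empty
  then show ?case by (simp add: Q_def prof_def)
next
  case (insert a A)
  then show ?case by (simp add: Q_add)
qed

lemma Q_commute: "Q u v = Q v u"
  by (simp add: Q_def mult.commute)

lemma prof_lim: "(prof v \<longlongrightarrow> 0) at_top"
proof -
  obtain c C where c: "0 < c" "\<And>v s. 0 \<le> s \<Longrightarrow> \<bar>prof v s\<bar> \<le> (\<Sum>i<K. \<bar>v i\<bar>) * C * exp (- (c * s))"
    by (rule prof_bounds) blast
  have "((\<lambda>s. (\<Sum>i<K. \<bar>v i\<bar>) * C * exp (- (c * s))) \<longlongrightarrow> (\<Sum>i<K. \<bar>v i\<bar>) * C * 0) at_top"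
    using c(1) by (intro tendsto_intros filterlim_compose[OF exp_at_bot]
      filterlim_compose[OF filterlim_uminus_at_bot_at_top] filterlim_tendsto_pos_mult_at_top[OF tendsto_const] filterlim_ident) auto
  then have "((\<lambda>s. (\<Sum>i<K. \<bar>v i\<bar>) * C * exp (- (c * s))) \<longlongrightarrow> 0) at_top" by simp
  then show ?thesis
    by (rule Lim_null_comparison[rotated])
      (use c(2) in \<open>auto intro!: eventually_mono[OF eventually_ge_at_top[of 0]]\<close>)
qed

lemma prof_0: "prof v 0 = (\<Sum>i<K. v i)"
  by (simp add: prof_def surv_0)

lemma excess_0: "excess 0 = mean"
  by (simp add: prof_0 mean_def)

lemma mean_pos: "0 < mean"
  using excess_pos[of 0] by (simp add: excess_0)

text \<open>The profile of the load vector cancels the denominator, so pairing with it is the mean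
  residual work of the flows counted by \<open>v\<close>.\<close>

lemma Q_load: "Q load v = (LINT s:{0..}|lborel. prof v s)"
  unfolding Q_def by (intro set_lebesgue_integral_cong) (auto simp: excess_nz)

text \<open>Each flow served at unit rate loses work at rate 1: the integral of \<phi>' is -
  \<phi>(0).\<close>

lemma Q_load_Sv: "Q load (Sv v) = - (\<Sum>i<K. v i)"
  unfolding Q_load
  using integral_FTC_atLeast[where a = 0, OF prof_deriv prof_cont prof_integrable prof_lim, of v]
  by (simp add: prof_0)

lemma integral_tail: "(LINT s:{0..}|lborel. tail s) = mean"
proof -
  have "(LINT s:{0..}|lborel. - tail s) = - mean"
    using integral_FTC_atLeast[where a = 0, OF excess_deriv _ _ prof_lim] prof_cont prof_integrable[of p]
    by (simp add: excess_0 set_integrable_def)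
  then show ?thesis by (simp add: set_lebesgue_integral_def)
qed

lemma Q_load_p: "Q load p = mean"
  unfolding Q_load by (rule integral_tail)

text \<open>Nonnegative weights cannot cancel, so \<phi>(s) is at least the number of flows times
  exp (- N s) with \<open>N\<close> above all rates, while h is bounded above.\<close>

lemma Q_lower:
  obtains c where "0 < c" "\<And>v. (\<And>i. i < K \<Longrightarrow> 0 \<le> v i) \<Longrightarrow> c * (\<Sum>i<K. v i)\<^sup>2 \<le> Q v v"
proof -
  define N where "N = 1 + Max (\<nu> ` {..<K})"
  have N: "\<nu> i \<le> N" if "i < K" for i
  proof -
    have "\<nu> i \<le> Max (\<nu> ` {..<K})" by (rule Max_ge) (use that in auto)
    then show ?thesis by (simp add: N_def)
  qed
  have N0: "0 < N" using N[OF K_pos] \<nu>_pos[OF K_pos] by linarith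
  obtain C where C: "0 < C" "\<And>s. 0 \<le> s \<Longrightarrow> excess s \<le> C"
  proof -
    obtain c C where c: "0 < c" "\<And>v s. 0 \<le> s \<Longrightarrow> \<bar>prof v s\<bar> \<le> (\<Sum>i<K. \<bar>v i\<bar>) * C * exp (- (c * s))" "0 < C"
      by (rule prof_bounds) blast
    have "excess s \<le> 1 + (\<Sum>i<K. \<bar>load i\<bar>) * C" if "0 \<le> s" for s
    proof -
      have "excess s \<le> (\<Sum>i<K. \<bar>load i\<bar>) * C * exp (- (c * s))" using c(2)[OF that, of load] by simp
      also have "\<dots> \<le> (\<Sum>i<K. \<bar>load i\<bar>) * C * 1"
        using c that by (intro mult_left_mono) (auto intro!: mult_nonneg_nonneg sum_nonneg)
      finally show ?thesis by simp
    qed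
    moreover have "0 < 1 + (\<Sum>i<K. \<bar>load i\<bar>) * C" using c(3) by (intro add_pos_nonneg) (auto intro!: mult_nonneg_nonneg sum_nonneg)
    ultimately show ?thesis using that by blast
  qed
  have "1 / (2 * N * C) * (\<Sum>i<K. v i)\<^sup>2 \<le> Q v v" if v: "\<And>i. i < K \<Longrightarrow> 0 \<le> v i" for v
  proof -
    have "1 / (2 * N * C) * (\<Sum>i<K. v i)\<^sup>2 = (\<Sum>i<K. v i)\<^sup>2 / C * (1 / (2 * N))"
      using N0 C(1) by (simp add: field_simps)
    also have "\<dots> = (LINT s:{0..}|lborel. (\<Sum>i<K. v i)\<^sup>2 / C * exp (- (2 * N * s)))"
      using N0 by (simp add: set_integral_exp_decay)
    also have "\<dots> \<le> Q v v"
      unfolding Q_def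
    proof (rule set_integral_mono)
      show "set_integrable lborel {0..} (\<lambda>s. (\<Sum>i<K. v i)\<^sup>2 / C * exp (- (2 * N * s)))"
        using set_integrable_exp_decay[of "2 * N"] N0 by simp
      fix s :: real assume "s \<in> {0..}"
      then have s: "0 \<le> s" by simp
      have "(\<Sum>i<K. v i) * exp (- (N * s)) \<le> prof v s"
        unfolding prof_def sum_distrib_right
      proof (intro sum_mono mult_left_mono)
        fix i assume i: "i \<in> {..<K}"
        have "exp (- (N * s)) \<le> exp (- (\<nu> i * s))" using N[of i] i s by (simp add: mult_right_mono)
        also have "\<dots> \<le> surv i s" using i s by (intro surv_ge) auto
        finally show "exp (- (N * s)) \<le> surv i s" .
      qed (use v in auto)
      moreover have "0 \<le> (\<Sum>i<K. v i) * exp (- (N * s))" using v by (intro mult_nonneg_nonneg sum_nonneg) auto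
      ultimately have "((\<Sum>i<K. v i) * exp (- (N * s)))\<^sup>2 \<le> (prof v s)\<^sup>2" by (intro power_mono)
      then have "((\<Sum>i<K. v i) * exp (- (N * s)))\<^sup>2 / C \<le> (prof v s)\<^sup>2 / excess s"
        using C s excess_pos[OF s] by (intro frac_le) auto
      then show "(\<Sum>i<K. v i)\<^sup>2 / C * exp (- (2 * N * s)) \<le> prof v s * prof v s / excess s"
        by (simp add: power2_eq_square mult_ac flip: exp_add)
    qed (rule Q_integrable)
    finally show ?thesis .
  qed
  moreover have "0 < 1 / (2 * N * C)" using N0 C(1) by simp
  ultimately show ?thesis using that by blast
qed

text \<open>Integrate \<open>\<phi> (l F + x \<phi>') / h = (x/2) (\<phi>\<^sup>2 / h)' - (x/2) F (\<phi> / h - l / x)\<^sup>2 + l\<^sup>2 F / (2 x)\<close> with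
  \<open>\<phi> = prof v\<close>, \<open>h = excess\<close> and \<open>F = tail = - h'\<close>.\<close>

lemma Q_drift:
  obtains c where "0 < c" "\<And>v x l. 0 < x \<Longrightarrow>
    Q v (\<lambda>i. l * p i + x * Sv v i) \<le> - (x / 2) * (\<Sum>i<K. v i)\<^sup>2 / mean + l\<^sup>2 * mean / (2 * x)
      - c * x * Q (\<lambda>i. v i - l / x * load i) (\<lambda>i. v i - l / x * load i)"
proof -
  obtain c where c: "0 < c" "\<And>s. 0 \<le> s \<Longrightarrow> c * excess s \<le> tail s"
    by (rule excess_le_tail) blast
  obtain d C where C: "0 < d" "\<And>v s. 0 \<le> s \<Longrightarrow> \<bar>prof v s\<bar> \<le> (\<Sum>i<K. \<bar>v i\<bar>) * C * exp (- (d * s))"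
    "\<And>v s. 0 \<le> s \<Longrightarrow> \<bar>prof v s\<bar> \<le> (\<Sum>i<K. \<bar>v i\<bar>) * C * excess s"
    by (rule prof_bounds) blast
  have "Q v (\<lambda>i. l * p i + x * Sv v i) \<le> - (x / 2) * (\<Sum>i<K. v i)\<^sup>2 / mean + l\<^sup>2 * mean / (2 * x)
      - c / 2 * x * Q (\<lambda>i. v i - l / x * load i) (\<lambda>i. v i - l / x * load i)" if x: "0 < x" for v x l
  proof -
    define w where "w i = v i - l / x * load i" for i
    have prof_w: "prof w s = prof v s - l / x * excess s" for s
      by (simp add: w_def prof_def left_diff_distrib sum_subtractf sum_distrib_left mult.assoc)
    \<comment> \<open>The derivative of \<phi>^2 / h; the second term is positive because h' = -
      F.\<close>
    define D where "D s = 2 * (prof v s * prof (Sv v) s / excess s)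
      + prof v s * prof v s / excess s * (tail s / excess s)" for s
    have dD: "((\<lambda>s. (prof v s)\<^sup>2 / excess s) has_real_derivative D s) (at s)" if s: "0 \<le> s" for s
    proof -
      have "((\<lambda>s. (prof v s)\<^sup>2 / excess s) has_real_derivative
          ((2 * prof v s * prof (Sv v) s) * excess s - (prof v s)\<^sup>2 * - tail s) / (excess s * excess s)) (at s)"
        by (rule DERIV_divide[OF _ excess_deriv excess_nz[OF s]])
          (auto intro!: derivative_eq_intros prof_deriv)
      also have "((2 * prof v s * prof (Sv v) s) * excess s - (prof v s)\<^sup>2 * - tail s) / (excess s * excess s) = D s"
        using excess_nz[OF s] by (simp add: D_def field_simps power2_eq_square)
      finally show ?thesis .
    qed
    have Dint: "set_integrable lborel {0..} D"
    proof -
      have "set_integrable lborel {0..} (\<lambda>s. prof v s * prof v s / excess s * (tail s / excess s))"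
      proof (rule set_integrable_exp_bound[OF C(1)])
        show "continuous_on {0..} (\<lambda>s. prof v s * prof v s / excess s * (tail s / excess s))"
          by (intro continuous_intros prof_cont_on) (auto simp: excess_nz)
        fix s :: real assume s: "0 \<le> s"
        define V where "V = (\<Sum>i<K. \<bar>v i\<bar>) * C"
        have 1: "\<bar>prof v s\<bar> / excess s \<le> V"
          using C(3)[OF s, of v] excess_pos[OF s] by (simp add: V_def pos_divide_le_eq)
        have 2: "\<bar>tail s\<bar> / excess s \<le> (\<Sum>i<K. \<bar>p i\<bar>) * C"
          using C(3)[OF s, of p] excess_pos[OF s] by (simp add: pos_divide_le_eq)
        have "\<bar>prof v s * prof v s / excess s * (tail s / excess s)\<bar>
            = \<bar>prof v s\<bar> * ((\<bar>prof v s\<bar> / excess s) * (\<bar>tail s\<bar> / excess s))"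
          using excess_pos[OF s] by (simp add: abs_mult)
        also have "\<dots> \<le> (V * exp (- (d * s))) * (V * ((\<Sum>i<K. \<bar>p i\<bar>) * C))"
        proof (intro mult_mono 1 2)
          show "\<bar>prof v s\<bar> \<le> V * exp (- (d * s))" using C(2)[OF s, of v] by (simp add: V_def)
          then show "0 \<le> V * exp (- (d * s))" by linarith
          show "0 \<le> V" using 1 excess_pos[OF s] by (meson abs_ge_zero divide_nonneg_pos order_trans)
        qed (use excess_pos[OF s] in auto)
        finally show "\<bar>prof v s * prof v s / excess s * (tail s / excess s)\<bar>
            \<le> (V * (V * ((\<Sum>i<K. \<bar>p i\<bar>) * C))) * exp (- (d * s))" by (simp add: mult_ac)
      qed
      then show ?thesis
        unfolding D_def[abs_def] by (intro set_integral_add(1) set_integrable_mult_right Q_integrable)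
    qed
    have Dcont: "isCont D s" if "0 \<le> s" for s
      unfolding D_def[abs_def] using excess_nz[OF that] by (intro continuous_intros prof_cont) auto
    \<comment> \<open>No boundary term at infinity: \<phi> / h is bounded and \<phi> tends to
      0.\<close>
    have Dlim: "((\<lambda>s. (prof v s)\<^sup>2 / excess s) \<longlongrightarrow> 0) at_top"
    proof (rule Lim_null_comparison)
      show "eventually (\<lambda>s. norm ((prof v s)\<^sup>2 / excess s) \<le> ((\<Sum>i<K. \<bar>v i\<bar>) * C) * \<bar>prof v s\<bar>) at_top"
        using eventually_ge_at_top[of 0]
      proof eventually_elim
        case (elim s)
        have "norm ((prof v s)\<^sup>2 / excess s) = \<bar>prof v s\<bar> / excess s * \<bar>prof v s\<bar>"
          using excess_pos[OF elim] by (simp add: power2_eq_square abs_mult)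
        also have "\<dots> \<le> ((\<Sum>i<K. \<bar>v i\<bar>) * C) * \<bar>prof v s\<bar>"
          using C(3)[OF elim, of v] excess_pos[OF elim] by (intro mult_right_mono) (auto simp: pos_divide_le_eq)
        finally show ?case .
      qed
      show "((\<lambda>s. ((\<Sum>i<K. \<bar>v i\<bar>) * C) * \<bar>prof v s\<bar>) \<longlongrightarrow> 0) at_top"
        by (intro tendsto_mult_right_zero tendsto_rabs_zero prof_lim)
    qed
    have ID: "(LINT s:{0..}|lborel. D s) = - (\<Sum>i<K. v i)\<^sup>2 / mean"
      using integral_FTC_atLeast[OF dD Dcont Dint Dlim] by (simp add: prof_0[of v] excess_0)
    have "Q v (\<lambda>i. l * p i + x * Sv v i)
        = (LINT s:{0..}|lborel. prof v s * prof (\<lambda>i. l * p i + x * Sv v i) s / excess s)"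
      by (simp add: Q_def)
    also have "\<dots> \<le> (LINT s:{0..}|lborel. x / 2 * D s - c / 2 * x * (prof w s * prof w s / excess s)
        + l\<^sup>2 / (2 * x) * tail s)"
    proof (rule set_integral_mono[OF Q_integrable])
      show "set_integrable lborel {0..} (\<lambda>s. x / 2 * D s - c / 2 * x * (prof w s * prof w s / excess s)
        + l\<^sup>2 / (2 * x) * tail s)"
        by (intro set_integral_add(1) set_integral_diff(1) set_integrable_mult_right Dint Q_integrable prof_integrable)
      fix s :: real assume "s \<in> {0..}"
      then have s: "0 \<le> s" by simp
      define h where "h = excess s"
      have h: "0 < h" using excess_pos[OF s] by (simp add: h_def)
      have pr: "prof (\<lambda>i. l * p i + x * Sv v i) s = l * tail s + x * prof (Sv v) s"
        by (simp add: prof_def distrib_right sum.distrib sum_distrib_left mult.assoc)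
      have "c / 2 * x * (prof w s * prof w s / h) = x / 2 * (c * h) * (prof w s / h)\<^sup>2"
        using h by (simp add: power2_eq_square field_simps)
      \<comment> \<open>The bound of F from below by c h is spent here: it lets the completed
        square, which has weight F, dominate the integrand of the norm of \<open>w\<close>.\<close>
      also have "\<dots> \<le> x / 2 * tail s * (prof w s / h)\<^sup>2"
        using c(2)[OF s] x by (intro mult_right_mono mult_left_mono) (auto simp: h_def)
      also have "\<dots> = x / 2 * D s - prof v s * (l * tail s + x * prof (Sv v) s) / h + l\<^sup>2 / (2 * x) * tail s"
        unfolding D_def prof_w h_def[symmetric] using h x by (simp add: field_simps power2_eq_square)
      finally show "prof v s * prof (\<lambda>i. l * p i + x * Sv v i) s / excess s
        \<le> x / 2 * D s - c / 2 * x * (prof w s * prof w s / excess s) + l\<^sup>2 / (2 * x) * tail s"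
        unfolding pr h_def[symmetric] by linarith
    qed
    also have "\<dots> = x / 2 * (- (\<Sum>i<K. v i)\<^sup>2 / mean) - c / 2 * x * Q w w + l\<^sup>2 / (2 * x) * mean"
    proof -
      note int = set_integrable_mult_right[OF Dint] set_integrable_mult_right[OF Q_integrable[of w w]]
        set_integrable_mult_right[OF prof_integrable[of p]]
      show ?thesis
        unfolding set_integral_add(2)[OF set_integral_diff(1)[OF int(1,2)] int(3)]
          set_integral_diff(2)[OF int(1,2)] set_integral_mult_right ID Q_def integral_tail ..
    qed
    finally show ?thesis by (simp add: w_def[abs_def])
  qed
  moreover have "0 < c / 2" using c by simp
  ultimately show ?thesis using that by blast
qed

end

section \<open>The matrices of the class D\<close>

fun block_cnt :: "(nat \<times> real) list \<Rightarrow> nat \<Rightarrow> nat" where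
  "block_cnt [] i = 0"
| "block_cnt ((m, \<mu>) # bs) i = (if i < m then m - i else block_cnt bs (i - m))"

fun block_rate :: "(nat \<times> real) list \<Rightarrow> nat \<Rightarrow> real" where
  "block_rate [] i = 0"
| "block_rate ((m, \<mu>) # bs) i = (if i < m then \<mu> else block_rate bs (i - m))"

lemma block_basic:
  assumes "\<forall>(m, \<mu>) \<in> set bs. 0 < m \<and> 0 < \<mu>" and "i < sum_list (map fst bs)"
  shows "0 < block_rate bs i" "0 < block_cnt bs i" "i + block_cnt bs i \<le> sum_list (map fst bs)"
    and "1 < block_cnt bs i \<Longrightarrow> block_cnt bs (Suc i) = block_cnt bs i - 1"
    and "1 < block_cnt bs i \<Longrightarrow> block_rate bs (Suc i) = block_rate bs i"
proof -
  have "0 < block_rate bs i \<and> 0 < block_cnt bs i \<and> i + block_cnt bs i \<le> sum_list (map fst bs)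
    \<and> (1 < block_cnt bs i \<longrightarrow> block_cnt bs (Suc i) = block_cnt bs i - 1
        \<and> block_rate bs (Suc i) = block_rate bs i)"
    using assms
  proof (induction bs arbitrary: i)
    case (Cons b bs)
    obtain m \<mu> where b: "b = (m, \<mu>)" by force
    show ?case
    proof (cases "i < m")
      case True
      then show ?thesis using Cons.prems by (auto simp: b)
    next
      case False
      with Cons.IH[of "i - m"] Cons.prems have "0 < block_rate bs (i - m) \<and> 0 < block_cnt bs (i - m)
        \<and> i - m + block_cnt bs (i - m) \<le> sum_list (map fst bs)
        \<and> (1 < block_cnt bs (i - m) \<longrightarrow> block_cnt bs (Suc (i - m)) = block_cnt bs (i - m) - 1
        \<and> block_rate bs (Suc (i - m)) = block_rate bs (i - m))" by (auto simp: b)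
      then show ?thesis using False by (auto simp: b Suc_diff_le; arith)
    qed
  qed simp
  then show "0 < block_rate bs i" "0 < block_cnt bs i" "i + block_cnt bs i \<le> sum_list (map fst bs)"
    and "1 < block_cnt bs i \<Longrightarrow> block_cnt bs (Suc i) = block_cnt bs i - 1"
    and "1 < block_cnt bs i \<Longrightarrow> block_rate bs (Suc i) = block_rate bs i" by auto
qed

text \<open>The witness is the first row of the block that contains \<open>i\<close>: same rate, and
  no row of the block has more phases left. With the positive initial probability there it supplies
  the locale assumption \<open>first\<close>.\<close>

lemma block_first:
  assumes "\<forall>(m, \<mu>) \<in> set bs. 0 < m \<and> 0 < \<mu>" and "i < sum_list (map fst bs)"
  shows "\<exists>b < length bs. sum_list (map fst (take b bs)) < sum_list (map fst bs)
    \<and> block_rate bs (sum_list (map fst (take b bs))) = block_rate bs i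
    \<and> block_cnt bs i \<le> block_cnt bs (sum_list (map fst (take b bs)))"
  using assms
proof (induction bs arbitrary: i)
  case (Cons b bs)
  obtain m \<mu> where b: "b = (m, \<mu>)" by force
  show ?case
  proof (cases "i < m")
    case True
    then show ?thesis using Cons.prems by (intro exI[of _ 0]) (auto simp: b)
  next
    case False
    then have "i - m < sum_list (map fst bs)" using Cons.prems(2) by (auto simp: b)
    with Cons.IH[of "i - m"] Cons.prems(1) obtain c where "c < length bs"
      "sum_list (map fst (take c bs)) < sum_list (map fst bs)"
      "block_rate bs (sum_list (map fst (take c bs))) = block_rate bs (i - m)"
      "block_cnt bs (i - m) \<le> block_cnt bs (sum_list (map fst (take c bs)))" by auto
    then show ?thesis using False by (intro exI[of _ "Suc c"]) (auto simp: b)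
  qed
qed simp

text \<open>The condition on \<open>block_cnt\<close> cuts the superdiagonal at the end of each
  block, where the next row belongs to another block.\<close>

lemma diag_erlang_index:
  assumes "S = diag_block_mat (map (\<lambda>(m, \<mu>). erlang_block m \<mu>) bs)"
  shows "dim_row S = sum_list (map fst bs)" "dim_col S = sum_list (map fst bs)"
    and "i < sum_list (map fst bs) \<Longrightarrow> j < sum_list (map fst bs) \<Longrightarrow> S $$ (i, j) =
      (if i = j then - block_rate bs i else if j = Suc i \<and> 1 < block_cnt bs i then block_rate bs i else 0)"
proof -
  have "dim_row S = sum_list (map fst bs) \<and> dim_col S = sum_list (map fst bs) \<and>
    (\<forall>i j. i < sum_list (map fst bs) \<longrightarrow> j < sum_list (map fst bs) \<longrightarrow> S $$ (i, j) =
      (if i = j then - block_rate bs i else if j = Suc i \<and> 1 < block_cnt bs i then block_rate bs i else 0))"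
    using assms
  proof (induction bs arbitrary: S)
    case (Cons b bs)
    obtain m \<mu> where b: "b = (m, \<mu>)" by force
    define T where "T = diag_block_mat (map (\<lambda>(m, \<mu>). erlang_block m \<mu>) bs)"
    note IH = Cons.IH[OF T_def]
    have S: "S = four_block_mat (erlang_block m \<mu>) (0\<^sub>m m (dim_col T)) (0\<^sub>m (dim_row T) m) T"
      using Cons.prems by (simp add: b T_def Let_def erlang_block_def)
    have dims: "dim_row (erlang_block m \<mu>) = m" "dim_col (erlang_block m \<mu>) = m"
      by (simp_all add: erlang_block_def)
    show ?case
    proof (intro conjI allI impI)
      show "dim_row S = sum_list (map fst (b # bs))" "dim_col S = sum_list (map fst (b # bs))"
        using IH by (simp_all add: S b dims)
      fix i j assume ij: "i < sum_list (map fst (b # bs))" "j < sum_list (map fst (b # bs))"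
      then have "S $$ (i, j) = (if i < m then if j < m then erlang_block m \<mu> $$ (i, j) else 0
          else if j < m then 0 else T $$ (i - m, j - m))"
        using IH by (simp add: S b dims)
      also have "\<dots> = (if i = j then - block_rate (b # bs) i else if j = Suc i \<and> 1 < block_cnt (b # bs) i
          then block_rate (b # bs) i else 0)"
        using ij IH by (auto simp: b erlang_block_def)
      finally show "S $$ (i, j) = (if i = j then - block_rate (b # bs) i
          else if j = Suc i \<and> 1 < block_cnt (b # bs) i then block_rate (b # bs) i else 0)" .
    qed
  qed simp
  then show "dim_row S = sum_list (map fst bs)" "dim_col S = sum_list (map fst bs)"
    "i < sum_list (map fst bs) \<Longrightarrow> j < sum_list (map fst bs) \<Longrightarrow> S $$ (i, j) =
      (if i = j then - block_rate bs i else if j = Suc i \<and> 1 < block_cnt bs i then block_rate bs i else 0)"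
    by auto
qed

lemma class_D_erlang_mixture:
  assumes "class_D p S"
  obtains cnt \<nu> where "erlang_mixture (dim_row S) cnt \<nu> (\<lambda>i. p $ i)"
    and "S \<in> carrier_mat (dim_row S) (dim_row S)" and "p \<in> carrier_vec (dim_row S)"
    and "\<And>i j. i < dim_row S \<Longrightarrow> j < dim_row S \<Longrightarrow> S $$ (i, j) = erlang_mixture.S cnt \<nu> i j"
proof -
  from assms obtain bs where pos: "\<forall>(m, \<mu>) \<in> set bs. 0 < m \<and> 0 < \<mu>"
    and S: "S = diag_block_mat (map (\<lambda>(m, \<mu>). erlang_block m \<mu>) bs)"
    and p: "p \<in> carrier_vec (dim_row S)" "\<forall>k < dim_row S. 0 \<le> p $ k" "(\<Sum>k < dim_row S. p $ k) = 1"
      "\<forall>b < length bs. 0 < p $ (sum_list (map fst (take b bs)))"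
    unfolding class_D_def by blast
  note dim = diag_erlang_index(1,2)[OF S]
  interpret E: erlang_mixture "dim_row S" "block_cnt bs" "block_rate bs" "\<lambda>i. p $ i"
  proof
    fix i assume "i < dim_row S"
    then have i: "i < sum_list (map fst bs)" by (simp add: dim)
    show "0 < block_rate bs i" "0 < block_cnt bs i" "i + block_cnt bs i \<le> dim_row S"
      "1 < block_cnt bs i \<Longrightarrow> block_cnt bs (Suc i) = block_cnt bs i - 1"
      "1 < block_cnt bs i \<Longrightarrow> block_rate bs (Suc i) = block_rate bs i"
      using block_basic[OF pos i] by (simp_all add: dim)
    show "0 \<le> p $ i" using p(2) i by (simp add: dim)
    show "\<exists>f<dim_row S. 0 < p $ f \<and> block_rate bs f = block_rate bs i \<and> block_cnt bs i \<le> block_cnt bs f"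
      using block_first[OF pos i] p(4) by (auto simp: dim)
  qed (use p(3) in simp)
  show ?thesis
  proof (rule that[OF E.erlang_mixture_axioms _ p(1)])
    show "S \<in> carrier_mat (dim_row S) (dim_row S)" using dim by (intro carrier_matI) auto
    show "S $$ (i, j) = erlang_mixture.S (block_cnt bs) (block_rate bs) i j"
      if "i < dim_row S" "j < dim_row S" for i j
      using that diag_erlang_index(3)[OF S, of i j] by (simp add: E.S_def dim(1))
  qed
qed

section \<open>Inverse and exponential of the generator\<close>

lemma minv_eq:
  assumes A: "A \<in> carrier_mat n n" and B: "B \<in> carrier_mat n n" and "A * B = 1\<^sub>m n" "B * A = 1\<^sub>m n"
  shows "minv A = B"
proof -
  have "A \<in> Units (ring_mat TYPE(real) n ())"
    unfolding Units_def using assms by (auto simp: ring_mat_simps)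
  with mat_inverse(1)[OF A, of "()"] obtain C where C: "mat_inverse A = Some C" by (cases "mat_inverse A") auto
  from mat_inverse(2)[OF A C] have "C * A = 1\<^sub>m n" "C \<in> carrier_mat n n" by auto
  then have "C = C * (A * B)" using assms(3) by simp
  also have "\<dots> = (C * A) * B" using A B \<open>C \<in> carrier_mat n n\<close> by (simp add: assoc_mult_mat)
  also have "\<dots> = B" using \<open>C * A = 1\<^sub>m n\<close> B by simp
  finally show ?thesis by (simp add: minv_def C)
qed

lemma pow_mat_Suc_index:
  assumes "A \<in> carrier_mat n n" "i < n" "j < n"
  shows "(A ^\<^sub>m Suc k) $$ (i, j) = (\<Sum>l<n. (A ^\<^sub>m k) $$ (i, l) * A $$ (l, j))"
  using assms by (simp add: scalar_prod_def lessThan_atLeast0)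

text \<open>Powers are built by multiplication from the right, whereas the backward equation and
  transposition need the new factor on the left.\<close>

lemma pow_mat_Suc_index':
  assumes "A \<in> carrier_mat n n" "i < n" "j < n"
  shows "(A ^\<^sub>m Suc k) $$ (i, j) = (\<Sum>l<n. A $$ (i, l) * (A ^\<^sub>m k) $$ (l, j))"
  using assms(2,3)
proof (induction k arbitrary: i j)
  case 0
  then show ?case using assms(1) by (simp add: scalar_prod_def if_distrib sum.delta' cong: if_cong)
next
  case (Suc k)
  have "(A ^\<^sub>m Suc (Suc k)) $$ (i, j) = (\<Sum>l<n. (A ^\<^sub>m Suc k) $$ (i, l) * A $$ (l, j))"
    by (rule pow_mat_Suc_index[OF assms(1) Suc.prems])
  also have "\<dots> = (\<Sum>l<n. (\<Sum>h<n. A $$ (i, h) * (A ^\<^sub>m k) $$ (h, l)) * A $$ (l, j))"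
    using Suc.IH[OF Suc.prems(1)] by (intro sum.cong) auto
  also have "\<dots> = (\<Sum>h<n. \<Sum>l<n. A $$ (i, h) * ((A ^\<^sub>m k) $$ (h, l) * A $$ (l, j)))"
    by (subst sum.swap) (simp add: sum_distrib_right mult.assoc)
  also have "\<dots> = (\<Sum>h<n. A $$ (i, h) * (A ^\<^sub>m Suc k) $$ (h, j))"
    unfolding sum_distrib_left[symmetric] using pow_mat_Suc_index[OF assms(1) _ Suc.prems(2)]
    by (intro sum.cong) auto
  finally show ?case .
qed

lemma pow_smult_index:
  fixes A :: "real mat"
  assumes "A \<in> carrier_mat n n" "i < n" "j < n"
  shows "((s \<cdot>\<^sub>m A) ^\<^sub>m k) $$ (i, j) = s ^ k * (A ^\<^sub>m k) $$ (i, j)"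
  using assms(2,3)
proof (induction k arbitrary: i j)
  case 0
  then show ?case using assms(1) by simp
next
  case (Suc k)
  have "((s \<cdot>\<^sub>m A) ^\<^sub>m Suc k) $$ (i, j) = (\<Sum>l<n. ((s \<cdot>\<^sub>m A) ^\<^sub>m k) $$ (i, l) * (s \<cdot>\<^sub>m A) $$ (l, j))"
    using assms(1) Suc.prems by (intro pow_mat_Suc_index) auto
  also have "\<dots> = (\<Sum>l<n. s ^ Suc k * ((A ^\<^sub>m k) $$ (i, l) * A $$ (l, j)))"
    using assms(1) Suc by (intro sum.cong) auto
  also have "\<dots> = s ^ Suc k * (A ^\<^sub>m Suc k) $$ (i, j)"
    by (simp add: pow_mat_Suc_index[OF assms(1) Suc.prems] sum_distrib_left del: pow_mat.simps)
  finally show ?case .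
qed

lemma pow_transpose_index:
  fixes A :: "real mat"
  assumes "A \<in> carrier_mat n n" "i < n" "j < n"
  shows "(transpose_mat A ^\<^sub>m k) $$ (i, j) = (A ^\<^sub>m k) $$ (j, i)"
  using assms(2,3)
proof (induction k arbitrary: i j)
  case 0
  then show ?case using assms(1) by simp
next
  case (Suc k)
  have "(transpose_mat A ^\<^sub>m Suc k) $$ (i, j) = (\<Sum>l<n. (transpose_mat A ^\<^sub>m k) $$ (i, l) * transpose_mat A $$ (l, j))"
    using assms(1) Suc.prems by (intro pow_mat_Suc_index) auto
  also have "\<dots> = (\<Sum>l<n. A $$ (j, l) * (A ^\<^sub>m k) $$ (l, i))"
    using assms(1) Suc by (intro sum.cong) auto
  also have "\<dots> = (A ^\<^sub>m Suc k) $$ (j, i)"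
    by (rule pow_mat_Suc_index'[OF assms(1) Suc.prems(2,1), symmetric])
  finally show ?case .
qed

text \<open>Geometric growth of the entries makes the entrywise exponential series converge
  everywhere, so that it can be differentiated term by term.\<close>

lemma pow_mat_bound:
  fixes A :: "real mat"
  assumes "A \<in> carrier_mat n n"
  obtains D where "0 \<le> D" "\<And>i j k. i < n \<Longrightarrow> j < n \<Longrightarrow> \<bar>(A ^\<^sub>m k) $$ (i, j)\<bar> \<le> D ^ k"
proof
  define D where "D = 1 + (\<Sum>i<n. \<Sum>j<n. \<bar>A $$ (i, j)\<bar>)"
  show D: "0 \<le> D" by (auto simp: D_def intro!: add_nonneg_nonneg sum_nonneg)
  have col: "(\<Sum>l<n. \<bar>A $$ (l, j)\<bar>) \<le> D" if "j < n" for j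
  proof -
    have "(\<Sum>l<n. \<bar>A $$ (l, j)\<bar>) \<le> (\<Sum>l<n. \<Sum>j<n. \<bar>A $$ (l, j)\<bar>)"
      using that by (intro sum_mono member_le_sum) auto
    then show ?thesis by (simp add: D_def)
  qed
  fix i j k assume "i < n" "j < n"
  then show "\<bar>(A ^\<^sub>m k) $$ (i, j)\<bar> \<le> D ^ k"
  proof (induction k arbitrary: i j)
    case 0
    then show ?case using assms by simp
  next
    case (Suc k)
    have "\<bar>(A ^\<^sub>m Suc k) $$ (i, j)\<bar> \<le> (\<Sum>l<n. \<bar>(A ^\<^sub>m k) $$ (i, l) * A $$ (l, j)\<bar>)"
      unfolding pow_mat_Suc_index[OF assms Suc.prems] by (rule sum_abs)
    also have "\<dots> \<le> (\<Sum>l<n. D ^ k * \<bar>A $$ (l, j)\<bar>)"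
      using Suc by (intro sum_mono) (auto simp: abs_mult intro!: mult_right_mono)
    also have "\<dots> \<le> D ^ k * D" unfolding sum_distrib_left[symmetric]
      using col[OF Suc.prems(2)] D by (intro mult_left_mono) auto
    finally show ?case by (simp add: mult.commute)
  qed
qed

text \<open>Row sums suffice: M and the mean size involve the exponential only through its action on
  the all-ones vector, and that vector function solves a linear equation.\<close>

lemma mexp_row_sums_ODE:
  fixes A :: "real mat"
  assumes A: "A \<in> carrier_mat n n"
  defines "y \<equiv> \<lambda>i s. \<Sum>j<n. mexp (s \<cdot>\<^sub>m A) $$ (i, j)"
  assumes i: "i < n"
  shows "(y i has_real_derivative (\<Sum>l<n. A $$ (i, l) * y l s)) (at s)" and "y i 0 = 1"
proof -
  obtain D where D: "0 \<le> D" "\<And>i j k. i < n \<Longrightarrow> j < n \<Longrightarrow> \<bar>(A ^\<^sub>m k) $$ (i, j)\<bar> \<le> D ^ k"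
    by (rule pow_mat_bound[OF A]) blast
  define c where "c i k = (\<Sum>j<n. (A ^\<^sub>m k) $$ (i, j)) / fact k" for i k
  have sm: "summable (\<lambda>k. ((A ^\<^sub>m k) $$ (i, j)) / fact k * s ^ k)" if "i < n" "j < n" for i j and s :: real
  proof (rule summable_comparison_test')
    show "summable (\<lambda>k. (D * \<bar>s\<bar>) ^ k / fact k)"
      using summable_exp[of "D * \<bar>s\<bar>"] by (simp add: divide_inverse mult.commute)
    show "norm ((A ^\<^sub>m k) $$ (i, j) / fact k * s ^ k) \<le> (D * \<bar>s\<bar>) ^ k / fact k" if "0 \<le> k" for k
      using D(2)[OF \<open>i < n\<close> \<open>j < n\<close>, of k]
      by (simp add: abs_mult power_abs power_mult_distrib divide_right_mono mult_right_mono)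
  qed
  have smc: "summable (\<lambda>k. c i k * s ^ k)" if "i < n" for i and s :: real
  proof -
    have "summable (\<lambda>k. \<Sum>j<n. ((A ^\<^sub>m k) $$ (i, j)) / fact k * s ^ k)"
      using that by (intro summable_sum sm) auto
    then show ?thesis by (simp add: c_def sum_divide_distrib sum_distrib_right)
  qed
  have y: "y i s = (\<Sum>k. c i k * s ^ k)" if "i < n" for i s
  proof -
    have "y i s = (\<Sum>j<n. \<Sum>k. (A ^\<^sub>m k) $$ (i, j) / fact k * s ^ k)"
      unfolding y_def using A that
      by (intro sum.cong) (auto simp: mexp_def pow_smult_index mult_ac)
    also have "\<dots> = (\<Sum>k. \<Sum>j<n. (A ^\<^sub>m k) $$ (i, j) / fact k * s ^ k)"
      using that sm by (intro suminf_sum[symmetric]) auto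
    finally show ?thesis by (simp add: c_def sum_divide_distrib sum_distrib_right)
  qed
  have "diffs (c i) k = (\<Sum>l<n. A $$ (i, l) * c l k)" for k
  proof -
    have "diffs (c i) k = (\<Sum>j<n. (A ^\<^sub>m Suc k) $$ (i, j)) / fact k"
      by (simp add: diffs_def c_def field_simps del: pow_mat.simps of_nat_Suc)
    also have "(\<Sum>j<n. (A ^\<^sub>m Suc k) $$ (i, j)) = (\<Sum>j<n. \<Sum>l<n. A $$ (i, l) * (A ^\<^sub>m k) $$ (l, j))"
      using i by (intro sum.cong pow_mat_Suc_index'[OF A]) auto
    also have "\<dots> = (\<Sum>l<n. A $$ (i, l) * (\<Sum>j<n. (A ^\<^sub>m k) $$ (l, j)))"
      by (subst sum.swap) (simp add: sum_distrib_left)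
    also have "\<dots> / fact k = (\<Sum>l<n. A $$ (i, l) * c l k)"
      unfolding sum_divide_distrib[of _ "{..<n}" "fact k"] by (simp add: c_def)
    finally show ?thesis .
  qed
  then have "(\<Sum>k. diffs (c i) k * s ^ k) = (\<Sum>k. \<Sum>l<n. A $$ (i, l) * (c l k * s ^ k))"
    by (simp add: sum_distrib_right mult.assoc)
  also have "\<dots> = (\<Sum>l<n. \<Sum>k. A $$ (i, l) * (c l k * s ^ k))"
    using smc by (intro suminf_sum summable_mult) auto
  also have "\<dots> = (\<Sum>l<n. A $$ (i, l) * y l s)"
    using smc by (intro sum.cong) (auto simp: y suminf_mult)
  finally have diffs: "(\<Sum>k. diffs (c i) k * s ^ k) = (\<Sum>l<n. A $$ (i, l) * y l s)" .
  have "((\<lambda>s. \<Sum>k. c i k * s ^ k) has_real_derivative (\<Sum>k. diffs (c i) k * s ^ k)) (at s)"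
    using smc[OF i] by (rule termdiffs_strong_converges_everywhere)
  then show "(y i has_real_derivative (\<Sum>l<n. A $$ (i, l) * y l s)) (at s)"
    unfolding diffs using y[OF i] by (simp add: ext[of "y i" "\<lambda>s. \<Sum>k. c i k * s ^ k"])
  have "y i 0 = c i 0" unfolding y[OF i] by (rule powser_zero)
  also have "\<dots> = (\<Sum>j<n. if j = i then 1 else 0)"
    using A i by (auto simp: c_def intro!: sum.cong)
  also have "\<dots> = 1" using i by simp
  finally show "y i 0 = 1" .
qed


lemma mexp_transpose_index:
  fixes A :: "real mat"
  assumes "A \<in> carrier_mat n n" "i < n" "j < n"
  shows "mexp (s \<cdot>\<^sub>m transpose_mat A) $$ (i, j) = mexp (s \<cdot>\<^sub>m A) $$ (j, i)"
  using assms pow_smult_index[of "transpose_mat A" n i j s] pow_smult_index[of A n j i s]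
  by (simp add: mexp_def pow_transpose_index)

context erlang_mixture
begin

context
  fixes A :: "real mat"
  assumes A: "A \<in> carrier_mat K K" and A_S: "\<And>i j. i < K \<Longrightarrow> j < K \<Longrightarrow> A $$ (i, j) = S i j"
begin

text \<open>Both sides solve the same linear system with value 1 at 0. The system is triangular, so
  induction on the number of phases left reduces uniqueness to a scalar equation for the
  difference.\<close>

lemma mexp_row_sum:
  assumes "i < K"
  shows "(\<Sum>j<K. mexp (s \<cdot>\<^sub>m A) $$ (i, j)) = surv i s"
  using assms
proof (induction "cnt i" arbitrary: i s rule: less_induct)
  case less
  define d where "d i s = (\<Sum>j<K. mexp (s \<cdot>\<^sub>m A) $$ (i, j)) - surv i s" for i s
  have d0: "d (Suc i) s = 0" if "1 < cnt i" for s
    using less.hyps[of "Suc i" s] less.prems that Suc_less cnt_Suc[of i] by (simp add: d_def)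
  have "(d i has_real_derivative (\<Sum>l<K. A $$ (i, l) * (\<Sum>j<K. mexp (s \<cdot>\<^sub>m A) $$ (l, j)))
      - (\<Sum>j<K. S i j * surv j s)) (at s)" for s
    unfolding d_def[abs_def] using mexp_row_sums_ODE(1)[OF A less.prems] surv_deriv[OF less.prems]
    by (rule DERIV_diff)
  moreover have "(\<Sum>l<K. A $$ (i, l) * (\<Sum>j<K. mexp (s \<cdot>\<^sub>m A) $$ (l, j))) - (\<Sum>j<K. S i j * surv j s)
      = (\<Sum>j<K. S i j * d j s)" for s
    using less.prems by (simp add: A_S d_def right_diff_distrib sum_subtractf)
  ultimately have "(d i has_real_derivative (- \<nu> i * d i s)) (at s)" for s
    using d0 by (cases "1 < cnt i") (auto simp: sum_S[OF less.prems])
  \<comment> \<open>The integrating factor exp (\<nu> i * s) makes the difference constant in s,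
    hence 0.\<close>
  then have "((\<lambda>s. exp (\<nu> i * s) * d i s) has_real_derivative
      (exp (\<nu> i * s) * \<nu> i) * d i s + (- \<nu> i * d i s) * exp (\<nu> i * s)) (at s)" for s
    by (intro DERIV_mult) (auto intro!: derivative_eq_intros)
  then have "((\<lambda>s. exp (\<nu> i * s) * d i s) has_real_derivative 0) (at s)" for s
    by (simp add: mult_ac)
  then have "exp (\<nu> i * s) * d i s = exp (\<nu> i * 0) * d i 0"
    using DERIV_isconst_all[of "\<lambda>s. exp (\<nu> i * s) * d i s"] by blast
  also have "d i 0 = 0"
    using mexp_row_sums_ODE(2)[OF A less.prems] less.prems by (simp add: d_def surv_0)
  finally show ?case by (simp add: d_def)
qed

lemma minv_index: "minv (- A) = mat K K (\<lambda>(i, j). B i j)"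
proof (rule minv_eq)
  show "- A * mat K K (\<lambda>(i, j). B i j) = 1\<^sub>m K"
  proof (rule eq_matI)
    fix i j assume "i < dim_row (1\<^sub>m K)" "j < dim_col (1\<^sub>m K)"
    then have ij: "i < K" "j < K" by auto
    have "(- A * mat K K (\<lambda>(i, j). B i j)) $$ (i, j) = (\<Sum>k<K. - (S i k * B k j))"
      using A ij by (simp add: scalar_prod_def lessThan_atLeast0 A_S sum_negf)
    then show "(- A * mat K K (\<lambda>(i, j). B i j)) $$ (i, j) = 1\<^sub>m K $$ (i, j)"
      using ij by (simp add: sum_negf S_B)
  qed (use A in auto)
  show "mat K K (\<lambda>(i, j). B i j) * - A = 1\<^sub>m K"
  proof (rule eq_matI)
    fix i j assume "i < dim_row (1\<^sub>m K)" "j < dim_col (1\<^sub>m K)"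
    then have ij: "i < K" "j < K" by auto
    have "(mat K K (\<lambda>(i, j). B i j) * - A) $$ (i, j) = (\<Sum>k<K. - (B i k * S k j))"
      using A ij by (simp add: scalar_prod_def lessThan_atLeast0 A_S sum_negf)
    then show "(mat K K (\<lambda>(i, j). B i j) * - A) $$ (i, j) = 1\<^sub>m K $$ (i, j)"
      using ij by (simp add: sum_negf B_S)
  qed (use A in auto)
qed (use A in auto)

lemma scalar_prod_minv:
  assumes "q \<in> carrier_vec K" "\<And>i. i < K \<Longrightarrow> q $ i = p i" "w \<in> carrier_vec K"
  shows "q \<bullet> (minv (- A) *\<^sub>v w) = (\<Sum>j<K. load j * w $ j)"
proof -
  have "q \<bullet> (minv (- A) *\<^sub>v w) = (\<Sum>i<K. p i * (\<Sum>j<K. B i j * w $ j))"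
    using assms by (simp add: minv_index scalar_prod_def lessThan_atLeast0)
  also have "\<dots> = (\<Sum>j<K. load j * w $ j)"
    by (simp add: sum_distrib_left load_def sum_distrib_right mult.assoc) (rule sum.swap)
  finally show ?thesis .
qed

lemma mean_size_eq:
  assumes "q \<in> carrier_vec K" "\<And>i. i < K \<Longrightarrow> q $ i = p i"
  shows "mean_size q A = mean"
  using assms A by (simp add: mean_size_def scalar_prod_minv ones_def mean_def)

lemma load_index:
  assumes "q \<in> carrier_vec K" "\<And>i. i < K \<Longrightarrow> q $ i = p i" "j < K"
  shows "(transpose_mat (minv (- A)) *\<^sub>v q) $ j = load j"
  using assms by (simp add: minv_index scalar_prod_def lessThan_atLeast0 load_def mult.commute)

text \<open>The matrix of ones between the exponentials makes each entry a product of two row sums,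
  and the scalar denominator pairs \<open>load\<close> with the row sums, which is h.\<close>

lemma M_integrand_index:
  assumes q: "q \<in> carrier_vec K" "\<And>i. i < K \<Longrightarrow> q $ i = p i" and ij: "i < K" "j < K"
  shows "M_integrand q A s $$ (i, j) = surv i s * surv j s / excess s"
proof -
  have mc: "mexp (s \<cdot>\<^sub>m A) \<in> carrier_mat K K" "mexp (s \<cdot>\<^sub>m transpose_mat A) \<in> carrier_mat K K"
    using A by (auto simp: mexp_def)
  have g: "(mexp (s \<cdot>\<^sub>m A) *\<^sub>v ones K) $ i = surv i s" if "i < K" for i
    using that mc mexp_row_sum[OF that, of s] by (simp add: ones_def scalar_prod_def lessThan_atLeast0)
  have "q \<bullet> (minv (- A) *\<^sub>v (mexp (s \<cdot>\<^sub>m A) *\<^sub>v ones K)) = (\<Sum>j<K. load j * (mexp (s \<cdot>\<^sub>m A) *\<^sub>v ones K) $ j)"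
    using mc by (intro scalar_prod_minv q) (auto simp: ones_def)
  also have "\<dots> = excess s" unfolding prof_def by (intro sum.cong) (auto simp: g)
  finally have h: "q \<bullet> (minv (- A) *\<^sub>v (mexp (s \<cdot>\<^sub>m A) *\<^sub>v ones K)) = excess s" .
  have row: "(mexp (s \<cdot>\<^sub>m A) * mat K K (\<lambda>_. 1)) $$ (i, l) = surv i s" if "l < K" for l
    using that ij mc mexp_row_sum[OF ij(1), of s] by (simp add: scalar_prod_def lessThan_atLeast0)
  have "(mexp (s \<cdot>\<^sub>m A) * mat K K (\<lambda>_. 1) * mexp (s \<cdot>\<^sub>m transpose_mat A)) $$ (i, j)
      = (\<Sum>l<K. (mexp (s \<cdot>\<^sub>m A) * mat K K (\<lambda>_. 1)) $$ (i, l) * mexp (s \<cdot>\<^sub>m transpose_mat A) $$ (l, j))"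
    using ij mc by (simp add: scalar_prod_def lessThan_atLeast0 del: index_mult_mat(1))
      (simp add: index_mult_mat(1)[of i _ j] scalar_prod_def)
  also have "\<dots> = surv i s * surv j s"
    using row ij mexp_row_sum[OF ij(2), of s]
    by (simp add: mexp_transpose_index[OF A] sum_distrib_left[symmetric])
  finally show ?thesis
    using ij A mc by (simp add: M_integrand_def h del: index_mult_mat(1))
qed

text \<open>Up to the factor weight / arrival this is the block of M for one route, so that all
  properties of the norm can be read off the integral form \<open>Q\<close>. Expansion in unit
  vectors reduces the claim to single entries.\<close>

lemma Q_matrix:
  assumes q: "q \<in> carrier_vec K" "\<And>i. i < K \<Longrightarrow> q $ i = p i"
  shows "(\<Sum>i<K. \<Sum>j<K. u i * (LINT s:{0..}|lborel. M_integrand q A s $$ (i, j)) * v j) = Q u v"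
proof -
  define e where "e i k = (of_bool (k = i) :: real)" for i k :: nat
  have pe: "prof (e i) s = surv i s" if "i < K" for i s
  proof -
    have "prof (e i) s = (\<Sum>k<K. if k = i then surv i s else 0)"
      unfolding prof_def by (intro sum.cong) (auto simp: e_def)
    then show ?thesis using that by simp
  qed
  have Q_cong: "Q a b = Q a b'" if "\<And>i. i < K \<Longrightarrow> b i = b' i" for a b b'
    unfolding Q_def using prof_cong[OF that] by simp
  have exp: "Q a b = (\<Sum>j<K. b j * Q a (e j))" for a b
  proof -
    have "Q a b = Q a (\<lambda>i. \<Sum>j<K. b j * e j i)"
      by (intro Q_cong) (simp add: e_def of_bool_def if_distrib[of "\<lambda>x. _ * x"] cong: if_cong)
    also have "\<dots> = (\<Sum>j<K. b j * Q a (e j))" by (subst Q_sum) (auto simp: Q_scale)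
    finally show ?thesis .
  qed
  have "Q u v = (\<Sum>j<K. v j * (\<Sum>i<K. u i * Q (e j) (e i)))"
    by (subst exp, subst Q_commute, subst exp) simp
  also have "\<dots> = (\<Sum>i<K. \<Sum>j<K. u i * Q (e i) (e j) * v j)"
    by (subst sum.swap) (auto simp: sum_distrib_left Q_commute mult_ac intro!: sum.cong)
  also have "\<dots> = (\<Sum>i<K. \<Sum>j<K. u i * (LINT s:{0..}|lborel. M_integrand q A s $$ (i, j)) * v j)"
    using M_integrand_index[OF q] by (auto simp: Q_def pe intro!: sum.cong)
  finally show ?thesis ..
qed

end

end


text \<open>The form \<open>Q\<close> expressed through \<open>p\<close> and \<open>S\<close> alone.
  Block sizes and rates are bound inside \<open>class_D\<close> and cannot be mentioned at the level
  of the network.\<close>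

definition phase_form :: "real Matrix.vec \<Rightarrow> real mat \<Rightarrow> (nat \<Rightarrow> real) \<Rightarrow> (nat \<Rightarrow> real) \<Rightarrow> real" where
  "phase_form p S u v = (\<Sum>i<dim_row S. \<Sum>j<dim_row S.
     u i * (LINT s:{0..}|lborel. M_integrand p S s $$ (i, j)) * v j)"

definition load0 :: "real Matrix.vec \<Rightarrow> real mat \<Rightarrow> nat \<Rightarrow> real" where
  "load0 p S j = (transpose_mat (minv (- S)) *\<^sub>v p) $ j"

text \<open>Mean velocity of the phase counts \<open>v\<close> of one route with arrival rate
  \<open>l\<close> when every flow is served at rate \<open>x\<close>.\<close>

definition phase_drift :: "real Matrix.vec \<Rightarrow> real mat \<Rightarrow> real \<Rightarrow> real \<Rightarrow> (nat \<Rightarrow> real) \<Rightarrow> nat \<Rightarrow> real" where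
  "phase_drift p S l x v i = l * p $ i + x * (\<Sum>j<dim_row S. v j * S $$ (j, i))"

lemma phase_form_cong:
  assumes "\<And>i. i < dim_row S \<Longrightarrow> u i = u' i" "\<And>i. i < dim_row S \<Longrightarrow> v i = v' i"
  shows "phase_form p S u v = phase_form p S u' v'"
  using assms by (auto simp: phase_form_def intro!: sum.cong)

text \<open>The interface between the analysis of one route and the network: the Erlang parameters
  are eliminated here.\<close>

lemma class_D_phase_form:
  assumes D: "class_D p S"
  shows phase_form_commute: "phase_form p S u v = phase_form p S v u"
    and phase_form_nonneg: "0 \<le> phase_form p S v v"
    and phase_form_lower: "\<exists>c>0. \<forall>v. (\<forall>i<dim_row S. 0 \<le> v i) \<longrightarrow> c * (\<Sum>i<dim_row S. v i)\<^sup>2 \<le> phase_form p S v v"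
    and phase_form_load: "phase_form p S (load0 p S) (phase_drift p S l x v)
      = l * mean_size p S - x * (\<Sum>i<dim_row S. v i)"
    and phase_form_drift: "\<exists>c>0. \<forall>l x v. 0 < x \<longrightarrow> phase_form p S v (phase_drift p S l x v)
      \<le> - (x / 2) * (\<Sum>i<dim_row S. v i)\<^sup>2 / mean_size p S + l\<^sup>2 * mean_size p S / (2 * x)
        - c * x * phase_form p S (\<lambda>i. v i - l / x * load0 p S i) (\<lambda>i. v i - l / x * load0 p S i)"
    and load0_nonneg: "j < dim_row S \<Longrightarrow> 0 \<le> load0 p S j"
    and load0_sum: "(\<Sum>j<dim_row S. load0 p S j) = mean_size p S"
    and mean_size_pos: "0 < mean_size p S"
    and gen_off_diag_nonneg: "i < dim_row S \<Longrightarrow> j < dim_row S \<Longrightarrow> i \<noteq> j \<Longrightarrow> 0 \<le> S $$ (i, j)"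
    and gen_exit_nonneg: "i < dim_row S \<Longrightarrow> 0 \<le> (\<Sum>j<dim_row S. (- S) $$ (i, j))"
proof -
  define K where "K = dim_row S"
  obtain cnt \<nu> where E: "erlang_mixture K cnt \<nu> (\<lambda>i. p $ i)"
    and S: "S \<in> carrier_mat K K" and p: "p \<in> carrier_vec K"
    and S_eq: "\<And>i j. i < K \<Longrightarrow> j < K \<Longrightarrow> S $$ (i, j) = erlang_mixture.S cnt \<nu> i j"
    unfolding K_def by (rule class_D_erlang_mixture[OF D]) blast
  interpret E: erlang_mixture K cnt \<nu> "\<lambda>i. p $ i" by (rule E)
  have form: "phase_form p S u v = E.Q u v" for u v
    unfolding phase_form_def K_def[symmetric] by (rule E.Q_matrix[OF S S_eq p refl])
  have load: "load0 p S j = E.load j" if "j < K" for j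
    unfolding load0_def by (rule E.load_index[OF S S_eq p refl that])
  have mean: "mean_size p S = E.mean" by (rule E.mean_size_eq[OF S S_eq p refl])
  have Q_cong: "E.Q a b = E.Q a' b'" if "\<And>i. i < K \<Longrightarrow> a i = a' i" "\<And>i. i < K \<Longrightarrow> b i = b' i" for a a' b b'
    unfolding E.Q_def using E.prof_cong[OF that(1)] E.prof_cong[OF that(2)] by simp
  have drift: "phase_drift p S l x v i = l * p $ i + x * E.Sv v i" if "i < K" for l x v i
    using that by (simp add: phase_drift_def E.Sv_def K_def[symmetric] S_eq)
  have sw: "phase_form p S (\<lambda>i. v i - c * load0 p S i) (\<lambda>i. v i - c * load0 p S i)
      = E.Q (\<lambda>i. v i - c * E.load i) (\<lambda>i. v i - c * E.load i)" for v c
    unfolding form by (rule Q_cong) (simp_all add: load)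
  have dr: "phase_form p S u (phase_drift p S l x v) = E.Q u (\<lambda>i. l * p $ i + x * E.Sv v i)" for u l x v
    unfolding form by (rule Q_cong) (simp_all add: drift)
  show "phase_form p S u v = phase_form p S v u" unfolding form by (rule E.Q_commute)
  show "0 \<le> phase_form p S v v" unfolding form by (rule E.Q_sq_nonneg)
  show "\<exists>c>0. \<forall>v. (\<forall>i<dim_row S. 0 \<le> v i) \<longrightarrow> c * (\<Sum>i<dim_row S. v i)\<^sup>2 \<le> phase_form p S v v"
    unfolding form K_def[symmetric] using E.Q_lower by metis
  show "phase_form p S (load0 p S) (phase_drift p S l x v) = l * mean_size p S - x * (\<Sum>i<dim_row S. v i)"
  proof -
    have "phase_form p S (load0 p S) (phase_drift p S l x v) = E.Q E.load (\<lambda>i. l * p $ i + x * E.Sv v i)"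
      unfolding dr by (rule Q_cong) (simp_all add: load)
    then show ?thesis
      by (simp add: E.Q_add E.Q_scale E.Q_load_p E.Q_load_Sv mean K_def[symmetric])
  qed
  show "\<exists>c>0. \<forall>l x v. 0 < x \<longrightarrow> phase_form p S v (phase_drift p S l x v)
      \<le> - (x / 2) * (\<Sum>i<dim_row S. v i)\<^sup>2 / mean_size p S + l\<^sup>2 * mean_size p S / (2 * x)
        - c * x * phase_form p S (\<lambda>i. v i - l / x * load0 p S i) (\<lambda>i. v i - l / x * load0 p S i)"
  proof -
    obtain c where "0 < c" "\<And>v x l. 0 < x \<Longrightarrow>
      E.Q v (\<lambda>i. l * p $ i + x * E.Sv v i) \<le> - (x / 2) * (\<Sum>i<K. v i)\<^sup>2 / E.mean + l\<^sup>2 * E.mean / (2 * x)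
      - c * x * E.Q (\<lambda>i. v i - l / x * E.load i) (\<lambda>i. v i - l / x * E.load i)"
      by (rule E.Q_drift) blast
    then show ?thesis unfolding dr sw mean K_def[symmetric] by blast
  qed
  show "j < dim_row S \<Longrightarrow> 0 \<le> load0 p S j" using load E.load_nonneg by (simp add: K_def)
  show "(\<Sum>j<dim_row S. load0 p S j) = mean_size p S"
    unfolding mean E.mean_def K_def[symmetric] by (intro sum.cong) (auto simp: load)
  show "0 < mean_size p S" unfolding mean by (rule E.mean_pos)
  show "i < dim_row S \<Longrightarrow> j < dim_row S \<Longrightarrow> i \<noteq> j \<Longrightarrow> 0 \<le> S $$ (i, j)"
    using S_eq[of i j] E.\<nu>_pos[of i] by (auto simp: E.S_def K_def)
  show "i < dim_row S \<Longrightarrow> 0 \<le> (\<Sum>j<dim_row S. (- S) $$ (i, j))"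
  proof -
    assume "i < dim_row S"
    then have i: "i < K" by (simp add: K_def)
    have "(\<Sum>j<K. (- S) $$ (i, j)) = - (\<Sum>j<K. E.S i j * 1)"
      using S i by (simp add: S_eq sum_negf)
    also have "\<dots> \<ge> 0" using E.\<nu>_pos[OF i] by (subst E.sum_S[OF i]) auto
    finally show ?thesis by (simp add: K_def)
  qed
qed

lemma class_D_carrier:
  assumes "class_D p S"
  shows "S \<in> carrier_mat (dim_row S) (dim_row S)" "p \<in> carrier_vec (dim_row S)"
    "i < dim_row S \<Longrightarrow> 0 \<le> p $ i" "(\<Sum>i<dim_row S. p $ i) = 1"
  using class_D_erlang_mixture[OF assms] assms unfolding class_D_def by blast+

section \<open>Proportionally fair allocations and link prices\<close>

text \<open>A finitely generated cone is polyhedral, hence closed, so a point outside it is strictly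
  separated from it.\<close>

lemma farkas:
  fixes g :: "'i \<Rightarrow> 'a::euclidean_space"
  assumes "finite I"
  shows "(\<exists>c. (\<forall>i\<in>I. 0 \<le> c i) \<and> w = (\<Sum>i\<in>I. c i *\<^sub>R g i))
    \<or> (\<exists>d. (\<forall>i\<in>I. inner d (g i) \<le> 0) \<and> 0 < inner d w)"
proof (cases "w \<in> convex_cone hull (g ` I)")
  case True
  have "convex_cone hull (g ` I) \<subseteq> {y. \<exists>c. (\<forall>i\<in>I. 0 \<le> c i) \<and> y = (\<Sum>i\<in>I. c i *\<^sub>R g i)}"
  proof (rule hull_minimal)
    show "g ` I \<subseteq> {y. \<exists>c. (\<forall>i\<in>I. 0 \<le> c i) \<and> y = (\<Sum>i\<in>I. c i *\<^sub>R g i)}"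
    proof clarify
      fix i assume i: "i \<in> I"
      have "(\<Sum>j\<in>I. of_bool (j = i) *\<^sub>R g j) = (\<Sum>j\<in>I. if j = i then g i else 0)"
        by (intro sum.cong) auto
      then show "\<exists>c. (\<forall>i\<in>I. 0 \<le> c i) \<and> g i = (\<Sum>i\<in>I. c i *\<^sub>R g i)"
        using i assms by (intro exI[of _ "\<lambda>j. of_bool (j = i)"]) auto
    qed
    show "convex_cone {y. \<exists>c. (\<forall>i\<in>I. 0 \<le> c i) \<and> y = (\<Sum>i\<in>I. c i *\<^sub>R g i)}"
      unfolding convex_cone_iff
    proof safe
      show "\<exists>c. (\<forall>i\<in>I. 0 \<le> c i) \<and> 0 = (\<Sum>i\<in>I. c i *\<^sub>R g i)"
        by (intro exI[of _ "\<lambda>_. 0"]) auto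
      fix c c' :: "'i \<Rightarrow> real"
      assume "\<forall>i\<in>I. 0 \<le> c i" "\<forall>i\<in>I. 0 \<le> c' i"
      then show "\<exists>ca. (\<forall>i\<in>I. 0 \<le> ca i) \<and>
          (\<Sum>i\<in>I. c i *\<^sub>R g i) + (\<Sum>i\<in>I. c' i *\<^sub>R g i) = (\<Sum>i\<in>I. ca i *\<^sub>R g i)"
        by (intro exI[of _ "\<lambda>i. c i + c' i"]) (auto simp: scaleR_left_distrib sum.distrib)
    next
      fix t :: real and c :: "'i \<Rightarrow> real"
      assume "\<forall>i\<in>I. 0 \<le> c i" "0 \<le> t"
      then show "\<exists>ca. (\<forall>i\<in>I. 0 \<le> ca i) \<and> t *\<^sub>R (\<Sum>i\<in>I. c i *\<^sub>R g i) = (\<Sum>i\<in>I. ca i *\<^sub>R g i)"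
        by (intro exI[of _ "\<lambda>i. t * c i"]) (auto simp: scaleR_sum_right)
    qed
  qed
  with True show ?thesis by blast
next
  case False
  have "closed (convex_cone hull (g ` I))"
    using assms by (intro polyhedron_imp_closed polyhedron_convex_cone_hull) auto
  then obtain a b where ab: "inner a w < b" "\<And>y. y \<in> convex_cone hull (g ` I) \<Longrightarrow> b < inner a y"
    using separating_hyperplane_closed_point[OF convex_convex_cone_hull _ False] by blast
  have b0: "b < 0" using ab(2)[OF convex_cone_hull_contains_0] by simp
  have "0 \<le> inner a (g i)" if i: "i \<in> I" for i
  proof (rule ccontr)
    assume neg: "\<not> 0 \<le> inner a (g i)"
    \<comment> \<open>Rescaled by this positive factor the generator stays in the cone and has inner
      product exactly \<open>b\<close> with \<open>a\<close>, against strict separation.\<close>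
    have "(b / inner a (g i)) *\<^sub>R g i \<in> convex_cone hull (g ` I)"
      using neg b0 i by (intro convex_cone_scaleR convex_cone_convex_cone_hull hull_inc)
        (auto simp: divide_nonpos_neg)
    from ab(2)[OF this] show False using neg by simp
  qed
  then show ?thesis using ab(1) b0 by (intro disjI2 exI[of _ "- a"]) auto
qed

context
  fixes net :: "('l::finite, 'r::finite) network" and x :: "('r \<Rightarrow> nat Matrix.vec) \<Rightarrow> 'r \<Rightarrow> real"
    and n :: "'r \<Rightarrow> nat Matrix.vec"
  assumes net: "bandwidth_sharing_network net" and wpf: "weighted_proportionally_fair net x"
    and n: "n \<in> states net"
begin

lemma cap_pos: "0 < capacity net l"
  using net by (auto simp: bandwidth_sharing_network_def)

lemma wt_pos: "0 < weight net r"
  using net by (auto simp: bandwidth_sharing_network_def)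

lemma alloc_feasible: "feasible net n (x n)"
  using wpf n by (auto simp: weighted_proportionally_fair_def)

lemma alloc_nonneg: "0 \<le> x n r"
  using alloc_feasible by (auto simp: feasible_def)

lemma alloc_inactive: "flows (n r) = 0 \<Longrightarrow> x n r = 0"
  using alloc_feasible by (auto simp: feasible_def)

lemma alloc_capacity: "(\<Sum>r | l \<in> route net r. real (flows (n r)) * x n r) \<le> capacity net l"
  using alloc_feasible by (auto simp: feasible_def)

text \<open>Inactive routes contribute 0 times -\<infinity>, which is 0, so the objective is a real
  number as soon as all active rates are positive.\<close>

lemma utility_eq:
  assumes "\<And>r. 0 < flows (n r) \<Longrightarrow> 0 < y r"
  shows "utility net n y = ereal (\<Sum>r | 0 < flows (n r). weight net r * real (flows (n r)) * ln (y r))"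
proof -
  have "utility net n y = (\<Sum>r\<in>UNIV. ereal (if 0 < flows (n r) then weight net r * real (flows (n r)) * ln (y r) else 0))"
    unfolding utility_def using assms by (intro sum.cong) (auto simp: elog_def)
  also have "\<dots> = ereal (\<Sum>r\<in>UNIV. if 0 < flows (n r) then weight net r * real (flows (n r)) * ln (y r) else 0)"
    by simp
  finally show ?thesis by (simp add: sum.If_cases)
qed

lemma exists_positive_feasible:
  obtains y where "feasible net n y" "\<And>r. 0 < flows (n r) \<Longrightarrow> 0 < y r"
proof -
  define N where "N = (\<Sum>r\<in>UNIV. real (flows (n r)))"
  \<comment> \<open>One rate for all active flows, small enough even if all of them shared the link
    of smallest capacity.\<close>
  define \<delta> where "\<delta> = Min (range (capacity net)) / (1 + N)"
  have N0: "0 \<le> N" unfolding N_def by (intro sum_nonneg) auto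
  have M0: "0 < Min (range (capacity net))" using cap_pos by (subst Min_gr_iff) auto
  have \<delta>0: "0 < \<delta>" using N0 M0 by (simp add: \<delta>_def)
  define y where "y r = (if 0 < flows (n r) then \<delta> else 0)" for r
  have "(\<Sum>r | l \<in> route net r. real (flows (n r)) * y r) \<le> capacity net l" for l
  proof -
    have "(\<Sum>r | l \<in> route net r. real (flows (n r)) * y r) \<le> (\<Sum>r\<in>UNIV. real (flows (n r)) * y r)"
      using \<delta>0 by (intro sum_mono2) (auto simp: y_def)
    also have "\<dots> \<le> (\<Sum>r\<in>UNIV. real (flows (n r)) * \<delta>)"
      using \<delta>0 by (intro sum_mono) (auto simp: y_def)
    also have "\<dots> = N * \<delta>" by (simp add: N_def sum_distrib_right)
    also have "\<dots> \<le> (1 + N) * \<delta>" using \<delta>0 by (simp add: distrib_right)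
    also have "\<dots> = Min (range (capacity net))" using N0 by (simp add: \<delta>_def)
    also have "\<dots> \<le> capacity net l" by (intro Min_le) auto
    finally show ?thesis .
  qed
  then have "feasible net n y" using \<delta>0 by (auto simp: feasible_def y_def)
  then show ?thesis using that[of y] \<delta>0 by (auto simp: y_def)
qed

text \<open>A vanishing rate on an active route would make the utility -\<infinity>, while some
  feasible allocation has finite utility.\<close>

lemma alloc_pos:
  assumes "0 < flows (n r)"
  shows "0 < x n r"
proof (rule ccontr)
  assume "\<not> 0 < x n r"
  then have "ereal (weight net r * real (flows (n r))) * elog (x n r) = - \<infinity>"
    using wt_pos[of r] assms by (simp add: elog_def)
  moreover have "ereal (weight net r' * real (flows (n r'))) * elog (x n r') \<noteq> \<infinity>" for r'
  proof (cases "flows (n r') = 0")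
    case False
    then have "0 < weight net r' * real (flows (n r'))" using wt_pos[of r'] by simp
    then show ?thesis by (auto simp: elog_def)
  qed auto
  ultimately have "utility net n (x n) = - \<infinity>"
  proof -
    let ?f = "\<lambda>r. ereal (weight net r * real (flows (n r))) * elog (x n r)"
    assume "?f r = - \<infinity>" and fin: "\<And>r'. ?f r' \<noteq> \<infinity>"
    moreover have "sum ?f (UNIV - {r}) \<noteq> \<infinity>" using fin by (simp add: sum_Pinfty)
    moreover have "utility net n (x n) = ?f r + sum ?f (UNIV - {r})"
      unfolding utility_def by (intro sum.remove) auto
    ultimately show ?thesis by (simp add: plus_ereal.simps(3))
  qed
  moreover obtain y where y: "feasible net n y" "\<And>r. 0 < flows (n r) \<Longrightarrow> 0 < y r"
    by (rule exists_positive_feasible) blast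
  moreover have "utility net n y \<le> utility net n (x n)"
    using wpf n y(1) by (auto simp: weighted_proportionally_fair_def)
  ultimately show False using utility_eq[OF y(2)] by auto
qed

text \<open>First-order optimality, stated in throughputs instead of rates per flow so that the
  constraints do not depend on the state. \<open>weight net r / x n r\<close> is the slope of the
  objective in the throughput of \<open>r\<close>, and the slope along the segment towards
  \<open>Y\<close> cannot be positive.\<close>

lemma alloc_variational:
  assumes Y0: "\<And>r. 0 \<le> Y r" and Y: "\<And>l. (\<Sum>r | l \<in> route net r. Y r) \<le> capacity net l"
  shows "(\<Sum>r | 0 < flows (n r). weight net r / x n r * (Y r - real (flows (n r)) * x n r)) \<le> 0"
proof (rule ccontr)
  define d where "d r = (if 0 < flows (n r) then Y r / real (flows (n r)) - x n r else 0)" for r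
  define U where "U t = (\<Sum>r | 0 < flows (n r). weight net r * real (flows (n r)) * ln (x n r + t * d r))" for t
  assume "\<not> ?thesis"
  then have A: "0 < (\<Sum>r | 0 < flows (n r). weight net r / x n r * (Y r - real (flows (n r)) * x n r))"
    by simp
  have "(U has_real_derivative (\<Sum>r | 0 < flows (n r). weight net r * real (flows (n r)) * (d r / (x n r + 0 * d r)))) (at 0)"
    unfolding U_def[abs_def]
  proof (intro DERIV_sum DERIV_cmult)
    fix r assume "r \<in> {r. 0 < flows (n r)}"
    then have "0 < x n r" using alloc_pos by simp
    then show "((\<lambda>t. ln (x n r + t * d r)) has_real_derivative d r / (x n r + 0 * d r)) (at 0)"
      by (auto intro!: derivative_eq_intros)
  qed
  also have "(\<Sum>r | 0 < flows (n r). weight net r * real (flows (n r)) * (d r / (x n r + 0 * d r)))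
      = (\<Sum>r | 0 < flows (n r). weight net r / x n r * (Y r - real (flows (n r)) * x n r))"
  proof (intro sum.cong refl)
    fix r assume "r \<in> {r. 0 < flows (n r)}"
    then have "real (flows (n r)) * d r = Y r - real (flows (n r)) * x n r"
      by (simp add: d_def right_diff_distrib)
    then have "weight net r / x n r * (real (flows (n r)) * d r)
        = weight net r / x n r * (Y r - real (flows (n r)) * x n r)" by simp
    then show "weight net r * real (flows (n r)) * (d r / (x n r + 0 * d r))
        = weight net r / x n r * (Y r - real (flows (n r)) * x n r)"
      by (simp add: mult_ac)
  qed
  finally obtain e where e: "0 < e" "\<And>h. 0 < h \<Longrightarrow> h < e \<Longrightarrow> U 0 < U (0 + h)"
    using DERIV_pos_inc_right[OF _ A] by blast
  \<comment> \<open>At most 1/2, so that the point on the segment keeps a positive share of the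
    current rates.\<close>
  define t where "t = min (e / 2) (1 / 2)"
  have t: "0 < t" "t < e" "t \<le> 1 / 2" using e(1) by (auto simp: t_def)
  define z where "z r = x n r + t * d r" for r
  \<comment> \<open>In throughputs the new point is a convex combination. Cutting \<open>Y\<close>
    to the active routes can only lower link loads.\<close>
  have z_eq: "real (flows (n r)) * z r = (1 - t) * (real (flows (n r)) * x n r) + t * (if 0 < flows (n r) then Y r else 0)" for r
    by (auto simp: z_def d_def field_simps)
  have zpos: "0 < z r" if "0 < flows (n r)" for r
  proof -
    have "z r = (1 - t) * x n r + t * (Y r / real (flows (n r)))"
      using that by (simp add: z_def d_def algebra_simps)
    moreover have "0 < (1 - t) * x n r" using t alloc_pos[OF that] by simp
    moreover have "0 \<le> t * (Y r / real (flows (n r)))" using t Y0 by simp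
    ultimately show ?thesis by linarith
  qed
  have zero: "z r = 0" if "flows (n r) = 0" for r
    using that alloc_inactive[OF that] by (simp add: z_def d_def)
  have "(\<Sum>r | l \<in> route net r. real (flows (n r)) * z r) \<le> capacity net l" for l
  proof -
    have "(\<Sum>r | l \<in> route net r. real (flows (n r)) * z r)
        = (1 - t) * (\<Sum>r | l \<in> route net r. real (flows (n r)) * x n r)
          + t * (\<Sum>r | l \<in> route net r. if 0 < flows (n r) then Y r else 0)"
      by (simp only: z_eq sum.distrib sum_distrib_left)
    also have "\<dots> \<le> (1 - t) * capacity net l + t * capacity net l"
    proof (intro add_mono mult_left_mono alloc_capacity)
      have "(\<Sum>r | l \<in> route net r. if 0 < flows (n r) then Y r else 0) \<le> (\<Sum>r | l \<in> route net r. Y r)"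
        using Y0 by (intro sum_mono) auto
      then show "(\<Sum>r | l \<in> route net r. if 0 < flows (n r) then Y r else 0) \<le> capacity net l"
        using Y[of l] by linarith
    qed (use t in auto)
    finally show ?thesis by (simp add: algebra_simps)
  qed
  moreover have "0 \<le> z r" for r using zpos[of r] zero[of r] by (cases "flows (n r) = 0") (auto simp: less_imp_le)
  ultimately have "feasible net n z" using zero by (auto simp: feasible_def)
  then have "utility net n z \<le> utility net n (x n)"
    using wpf n by (auto simp: weighted_proportionally_fair_def)
  then have "U t \<le> U 0" using utility_eq[of z] utility_eq[of "x n"] zpos alloc_pos by (simp add: U_def z_def)
  with e(2)[of t] t show False by simp
qed

text \<open>The Karush-Kuhn-Tucker conditions. If the gradient \<open>w\<close> were outside the
  cone of active constraints, Farkas' lemma would give a feasible direction of ascent, against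
  \<open>alloc_variational\<close>.\<close>

lemma prices_exist:
  obtains \<pi> :: "'l \<Rightarrow> real" where "\<And>l. 0 \<le> \<pi> l"
    and "\<And>r. 0 < flows (n r) \<Longrightarrow> weight net r / x n r = (\<Sum>l \<in> route net r. \<pi> l)"
    and "\<And>l. \<pi> l * (\<Sum>r | l \<in> route net r. real (flows (n r)) * x n r) = \<pi> l * capacity net l"
proof -
  define y where "y r = real (flows (n r)) * x n r" for r
  define tight where "tight = {l. (\<Sum>r | l \<in> route net r. y r) = capacity net l}"
  \<comment> \<open>The generators of the second kind stand for the sign constraints on inactive
    routes: \<open>w\<close> is 0 there although the prices along the route may have a positive
    sum.\<close>
  define g :: "'l + 'r \<Rightarrow> real ^ 'r" where
    "g i = (case i of Inl l \<Rightarrow> (\<chi> r. of_bool (l \<in> route net r)) | Inr r \<Rightarrow> - axis r 1)" for i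
  define I where "I = Inl ` tight \<union> Inr ` {r. flows (n r) = 0}"
  define w :: "real ^ 'r" where "w = (\<chi> r. if 0 < flows (n r) then weight net r / x n r else 0)"
  have finI: "finite I" by (simp add: I_def)
  have y0: "0 \<le> y r" for r using alloc_nonneg by (simp add: y_def)
  have inner_sum: "inner d v = (\<Sum>r\<in>UNIV. vec_nth d r * vec_nth v r)" for d v :: "real ^ 'r"
    by (simp add: inner_vec_def)
  have inner_Inl: "inner d (g (Inl l)) = (\<Sum>r | l \<in> route net r. vec_nth d r)" for d l
    by (simp add: inner_sum g_def of_bool_def if_distrib[of "\<lambda>x. _ * x"] sum.If_cases cong: if_cong)
  have inner_Inr: "inner d (g (Inr r)) = - vec_nth d r" for d r
    by (simp add: g_def inner_axis)
  show ?thesis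
  proof (rule disjE[OF farkas[OF finI, of w g]])
    assume "\<exists>d. (\<forall>i\<in>I. inner d (g i) \<le> 0) \<and> 0 < inner d w"
    then obtain d where d: "\<And>i. i \<in> I \<Longrightarrow> inner d (g i) \<le> 0" "0 < inner d w" by blast
    define D where "D r = vec_nth d r" for r
    define M where "M = 1 + (\<Sum>r\<in>UNIV. \<bar>D r\<bar>)"
    have M: "0 < M" by (auto simp: M_def intro!: add_pos_nonneg sum_nonneg)
    have D_le: "\<bar>D r\<bar> \<le> M" for r
      using member_le_sum[of r UNIV "\<lambda>r. \<bar>D r\<bar>"] by (simp add: M_def)
    \<comment> \<open>\<open>slack\<close> and \<open>room\<close> limit the step by the links that
      are not tight and by the active routes. The value 1 elsewhere keeps the minima
      positive.\<close>
    define slack where "slack l = (if l \<in> tight then 1 else capacity net l - (\<Sum>r | l \<in> route net r. y r))" for l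
    have slack: "0 < slack l" for l
      using alloc_capacity[of l] by (auto simp: slack_def tight_def y_def less_le)
    define room where "room r = (if 0 < flows (n r) then y r else 1)" for r
    have room: "0 < room r" for r using alloc_pos[of r] by (simp add: room_def y_def)
    define t where "t = min (Min (range slack)) (Min (range room)) / M"
    have t: "0 < t" using M slack room by (auto simp: t_def Min_gr_iff)
    have tM1: "t * M \<le> slack l" for l
      using M by (auto simp: t_def intro: min.coboundedI1)
    have tM2: "t * M \<le> room r" for r
      using M by (auto simp: t_def intro: min.coboundedI2)
    \<comment> \<open>Inactive routes keep throughput 0. The direction is nonnegative on them, so
      dropping their components cannot overload a link.\<close>
    define Y where "Y r = (if 0 < flows (n r) then y r + t * D r else 0)" for r
    have Y0: "0 \<le> Y r" for r
    proof -
      have "t * \<bar>D r\<bar> \<le> t * M" using D_le t by simp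
      then have "- (t * D r) \<le> room r" using tM2[of r] t by (smt (verit) mult_minus_right mult_left_mono)
      then show ?thesis by (auto simp: Y_def room_def split: if_splits)
    qed
    have D_inact: "0 \<le> D r" if "flows (n r) = 0" for r
      using d(1)[of "Inr r"] that by (simp add: I_def inner_Inr D_def)
    have "(\<Sum>r | l \<in> route net r. Y r) \<le> capacity net l" for l
    proof -
      have "(\<Sum>r | l \<in> route net r. Y r) \<le> (\<Sum>r | l \<in> route net r. y r + t * D r)"
        using y0 D_inact t by (intro sum_mono) (auto simp: Y_def)
      also have "\<dots> = (\<Sum>r | l \<in> route net r. y r) + t * (\<Sum>r | l \<in> route net r. D r)"
        by (simp add: sum.distrib sum_distrib_left)
      also have "\<dots> \<le> capacity net l"
      proof (cases "l \<in> tight")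
        case True
        then have "(\<Sum>r | l \<in> route net r. D r) \<le> 0"
          using d(1)[of "Inl l"] by (simp add: I_def inner_Inl D_def)
        then have "t * (\<Sum>r | l \<in> route net r. D r) \<le> 0" using t by (simp add: mult_le_0_iff)
        with True show ?thesis by (simp add: tight_def)
      next
        case False
        have "(\<Sum>r | l \<in> route net r. D r) \<le> (\<Sum>r | l \<in> route net r. \<bar>D r\<bar>)"
          by (intro sum_mono) auto
        also have "\<dots> \<le> (\<Sum>r\<in>UNIV. \<bar>D r\<bar>)" by (intro sum_mono2) auto
        also have "\<dots> \<le> M" by (simp add: M_def)
        finally have "t * (\<Sum>r | l \<in> route net r. D r) \<le> t * M" using t by simp
        with tM1[of l] False show ?thesis by (simp add: slack_def)
      qed
      finally show ?thesis .
    qed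
    from alloc_variational[OF Y0 this]
    have "(\<Sum>r | 0 < flows (n r). weight net r / x n r * (Y r - y r)) \<le> 0" by (simp add: y_def)
    moreover have "(\<Sum>r | 0 < flows (n r). weight net r / x n r * (Y r - y r)) = t * inner d w"
    proof -
      have "t * inner d w = (\<Sum>r\<in>UNIV. if 0 < flows (n r) then weight net r / x n r * (Y r - y r) else 0)"
        unfolding inner_sum sum_distrib_left by (intro sum.cong) (auto simp: w_def Y_def D_def)
      then show ?thesis by (simp add: sum.If_cases)
    qed
    ultimately have False using t d(2) by (simp add: mult_le_0_iff)
    then show ?thesis ..
  next
    assume "\<exists>c. (\<forall>i\<in>I. 0 \<le> c i) \<and> w = (\<Sum>i\<in>I. c i *\<^sub>R g i)"
    then obtain c where c: "\<And>i. i \<in> I \<Longrightarrow> 0 \<le> c i" "w = (\<Sum>i\<in>I. c i *\<^sub>R g i)" by blast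
    \<comment> \<open>Prices vanish off the tight links, which is complementary slackness.\<close>
    define \<pi> where "\<pi> l = (if l \<in> tight then c (Inl l) else 0)" for l
    have "weight net r / x n r = (\<Sum>l \<in> route net r. \<pi> l)" if r: "0 < flows (n r)" for r
    proof -
      have "weight net r / x n r = vec_nth w r" using r by (simp add: w_def)
      also have "\<dots> = (\<Sum>i\<in>I. c i * vec_nth (g i) r)" unfolding c(2) by simp
      also have "\<dots> = (\<Sum>l\<in>tight. c (Inl l) * vec_nth (g (Inl l)) r)
          + (\<Sum>r'\<in>{r. flows (n r) = 0}. c (Inr r') * vec_nth (g (Inr r')) r)"
        unfolding I_def by (subst sum.union_disjoint) (auto simp: sum.reindex)
      also have "(\<Sum>r'\<in>{r. flows (n r) = 0}. c (Inr r') * vec_nth (g (Inr r')) r) = 0"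
        using r by (intro sum.neutral) (auto simp: g_def axis_def)
      also have "(\<Sum>l\<in>tight. c (Inl l) * vec_nth (g (Inl l)) r) = (\<Sum>l\<in>UNIV. if l \<in> route net r then \<pi> l else 0)"
        by (intro sum.mono_neutral_cong_left) (auto simp: g_def \<pi>_def)
      finally show ?thesis by (simp add: sum.If_cases)
    qed
    then show ?thesis
      by (intro that[of \<pi>]) (use c(1) in \<open>auto simp: \<pi>_def tight_def I_def y_def\<close>)
  qed
qed

end

section \<open>Drift of the quadratic form\<close>

lemma finite_positive_lower_bound:
  fixes f :: "'a \<Rightarrow> real"
  assumes "finite A" "\<And>a. a \<in> A \<Longrightarrow> 0 < f a"
  obtains c where "0 < c" "\<And>a. a \<in> A \<Longrightarrow> c \<le> f a"
proof (cases "A = {}")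
  case False
  then show ?thesis using assms by (intro that[of "Min (f ` A)"]) (auto simp: Min_gr_iff)
qed (use that[of 1] in auto)

lemma finite_positive_upper_bound:
  fixes f :: "'a \<Rightarrow> real"
  assumes "finite A"
  obtains C where "0 < C" "\<And>a. a \<in> A \<Longrightarrow> f a \<le> C"
proof -
  have "f a \<le> 1 + (\<Sum>a\<in>A. \<bar>f a\<bar>)" if "a \<in> A" for a
    using member_le_sum[OF that, of "\<lambda>a. \<bar>f a\<bar>"] assms by auto
  moreover have "0 < 1 + (\<Sum>a\<in>A. \<bar>f a\<bar>)" by (intro add_pos_nonneg sum_nonneg) auto
  ultimately show ?thesis using that by blast
qed

lemma phase_form_add: "phase_form p S u (\<lambda>i. v i + w i) = phase_form p S u v + phase_form p S u w"
  by (simp add: phase_form_def distrib_left sum.distrib)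

lemma phase_form_scale: "phase_form p S u (\<lambda>i. c * v i) = c * phase_form p S u v"
  by (simp add: phase_form_def sum_distrib_left mult_ac)

lemma phase_form_diff_scaled:
  assumes "class_D p S"
  shows "phase_form p S (\<lambda>i. u i - c * v i) (\<lambda>i. u i - c * v i)
    = phase_form p S u u - 2 * c * phase_form p S u v + c\<^sup>2 * phase_form p S v v"
proof -
  have *: "phase_form p S w (\<lambda>i. u i - c * v i) = phase_form p S w u - c * phase_form p S w v" for w
    using phase_form_add[of p S w u "\<lambda>i. - c * v i"] phase_form_scale[of p S w "- c" v] by simp
  have **: "phase_form p S (\<lambda>i. u i - c * v i) w = phase_form p S u w - c * phase_form p S v w" for w
    using *[of w] phase_form_commute[OF assms] by simp
  show ?thesis
    unfolding *[of "\<lambda>i. u i - c * v i"] **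
    by (simp add: phase_form_commute[OF assms, of v u] power2_eq_square algebra_simps)
qed

locale heavy_traffic =
  fixes net :: "('l::finite, 'r::finite) network" and Ls :: "'l set"
    and x :: "('r \<Rightarrow> nat Matrix.vec) \<Rightarrow> 'r \<Rightarrow> real"
  assumes net: "bandwidth_sharing_network net"
    and crit: "critically_loaded net Ls"
    and wpf: "weighted_proportionally_fair net x"
begin

abbreviation "K r \<equiv> dim_row (gen net r)"
abbreviation "\<kappa> r \<equiv> weight net r"
abbreviation "lam r \<equiv> arrival net r"
abbreviation "PF r \<equiv> phase_form (init net r) (gen net r)"
abbreviation "ld r \<equiv> load0 (init net r) (gen net r)"
abbreviation "ms r \<equiv> mean_size (init net r) (gen net r)"
abbreviation "\<rho> r \<equiv> lam r * ms r"
abbreviation "fl n r \<equiv> real (flows (n r))"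
abbreviation "thr n r \<equiv> fl n r * x n r"
abbreviation "vals n r i \<equiv> real ((n :: 'r \<Rightarrow> nat Matrix.vec) r $ i)"
abbreviation "PFsq r u \<equiv> PF r u u"
text \<open>The displacement that occurs in the completed square of \<open>Q_drift\<close>, for
  arrival rate \<open>\<theta> * lam r\<close>.\<close>

abbreviation "resid n \<theta> r \<equiv> \<lambda>i. vals n r i - \<theta> * lam r / x n r * ld r i"

text \<open>Vectors indexed by routes and phases are functions here: \<open>form\<close> is the inner product \<open>M_inner\<close>,
  \<open>cvec \<alpha>\<close> the point of the cone with coefficients \<open>\<alpha>\<close>, and \<open>vals n\<close> the state \<open>n\<close>.\<close>

definition form :: "('r \<Rightarrow> nat \<Rightarrow> real) \<Rightarrow> ('r \<Rightarrow> nat \<Rightarrow> real) \<Rightarrow> real" where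
  "form y z = (\<Sum>r\<in>UNIV. \<kappa> r / lam r * PF r (y r) (z r))"

definition cvec :: "('l \<Rightarrow> real) \<Rightarrow> 'r \<Rightarrow> nat \<Rightarrow> real" where
  "cvec \<alpha> r i = lam r / \<kappa> r * (\<Sum>l\<in>route net r \<inter> Ls. \<alpha> l) * ld r i"

abbreviation "sq y \<equiv> form y y"
abbreviation "dev n \<alpha> \<equiv> \<lambda>r i. vals n r i - cvec \<alpha> r i"

definition total :: "('r \<Rightarrow> nat Matrix.vec) \<Rightarrow> real" where
  "total n = (\<Sum>r\<in>UNIV. fl n r)"

text \<open>Mean velocity of the state when the arrival rates are \<theta> times the critical ones;
  \<open>sum_erate_inc\<close> derives it from the jumps.\<close>

definition drift :: "real \<Rightarrow> ('r \<Rightarrow> nat Matrix.vec) \<Rightarrow> 'r \<Rightarrow> nat \<Rightarrow> real" where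
  "drift \<theta> n r = phase_drift (init net r) (gen net r) (\<theta> * lam r) (x n r) (vals n r)"

lemma class_D_net: "class_D (init net r) (gen net r)"
  and \<kappa>_pos: "0 < \<kappa> r" and lam_pos: "0 < lam r" and C_pos: "0 < capacity net l"
  and route_ne: "route net r \<noteq> {}"
  using net by (auto simp: bandwidth_sharing_network_def)

lemma ms_pos: "0 < ms r"
  by (rule mean_size_pos[OF class_D_net])

lemma \<rho>_pos: "0 < \<rho> r"
  using lam_pos ms_pos by simp

lemma Ls_load: "l \<in> Ls \<Longrightarrow> (\<Sum>r | l \<in> route net r. \<rho> r) = capacity net l"
  and nonLs_load: "l \<notin> Ls \<Longrightarrow> (\<Sum>r | l \<in> route net r. \<rho> r) < capacity net l"
  using crit by (auto simp: critically_loaded_def link_load_def)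

lemma load_le: "(\<Sum>r | l \<in> route net r. \<rho> r) \<le> capacity net l"
  using Ls_load[of l] nonLs_load[of l] by (cases "l \<in> Ls") auto

lemma dim_state: "n \<in> states net \<Longrightarrow> dim_vec (n r) = K r"
  by (auto simp: states_def phases_def)

lemma vals_sum:
  assumes "n \<in> states net"
  shows "(\<Sum>i<K r. vals n r i) = fl n r"
  by (simp add: flows_def dim_state[OF assms])

lemma total_nonneg: "0 \<le> total n"
  unfolding total_def by (intro sum_nonneg) auto

lemma fl_le_total: "fl n r \<le> total n"
  unfolding total_def by (intro member_le_sum) auto

lemma kl_pos: "0 < \<kappa> r / lam r"
  using \<kappa>_pos lam_pos by simp

lemma form_commute: "form y z = form z y"
  unfolding form_def by (simp add: phase_form_commute[OF class_D_net])

lemma form_nonneg: "0 \<le> form y y"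
  unfolding form_def using kl_pos
  by (intro sum_nonneg mult_nonneg_nonneg phase_form_nonneg[OF class_D_net]) (auto simp: less_imp_le)

lemma form_add: "form y (\<lambda>r i. z r i + w r i) = form y z + form y w"
  by (simp add: form_def phase_form_add distrib_left sum.distrib)

lemma form_scale: "form y (\<lambda>r i. c * z r i) = c * form y z"
  by (simp add: form_def phase_form_scale sum_distrib_left mult_ac)

lemma form_sum: "finite A \<Longrightarrow> form y (\<lambda>r i. \<Sum>a\<in>A. f a r i) = (\<Sum>a\<in>A. form y (f a))"
proof (induction A rule: finite_induct)
  case empty
  then show ?case using form_scale[of y 0 "\<lambda>_ _. 0"] by simp
next
  case (insert a A)
  then show ?case by (simp add: form_add)
qed

lemma form_diff: "form y (\<lambda>r i. z r i - w r i) = form y z - form y w"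
  using form_add[of y z "\<lambda>r i. - 1 * w r i"] form_scale[of y "- 1" w] by simp

lemma form_cong:
  assumes "\<And>r i. i < K r \<Longrightarrow> y r i = y' r i" "\<And>r i. i < K r \<Longrightarrow> z r i = z' r i"
  shows "form y z = form y' z'"
  unfolding form_def using assms by (intro sum.cong arg_cong2[of _ _ _ _ "(*)"] phase_form_cong) auto

lemma form_add_sq:
  "form (\<lambda>r i. y r i + z r i) (\<lambda>r i. y r i + z r i) = form y y + 2 * form y z + form z z"
  using form_commute[of "\<lambda>r i. y r i + z r i"] by (simp add: form_add form_commute[of z y])

text \<open>The case \<open>form z z = 0\<close> is treated separately: \<open>form\<close> ignores
  values outside the phases, so on these functions it is only semidefinite.\<close>

lemma form_Cauchy_Schwarz: "(form y z)\<^sup>2 \<le> form y y * form z z"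
proof -
  have q: "0 \<le> form y y + 2 * t * form y z + t\<^sup>2 * form z z" for t
    using form_nonneg[of "\<lambda>r i. y r i + t * z r i"] form_commute[of "\<lambda>r i. t * z r i"]
    by (simp add: form_add_sq form_scale power2_eq_square mult_ac)
  show ?thesis
  proof (cases "form z z = 0")
    case True
    have "form y z = 0"
    proof (rule ccontr)
      assume nz: "form y z \<noteq> 0"
      show False using q[of "- (form y y + 1) / (2 * form y z)"] nz True by (simp add: field_simps)
    qed
    then show ?thesis using True by simp
  next
    case False
    then have pos: "0 < form z z" using form_nonneg[of z] by simp
    have "0 \<le> form y y - (form y z)\<^sup>2 / form z z"
      using q[of "- form y z / form z z"] pos by (simp add: power2_eq_square field_simps)
    then show ?thesis using pos by (simp add: field_simps)
  qed
qed

text \<open>Together with \<open>form_upper\<close> this makes the norm of a state equivalent to its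
  number of flows, so that powers of one can be exchanged for powers of the other.\<close>

lemma form_lower:
  obtains c where "0 < c" "\<And>n. n \<in> states net \<Longrightarrow> c * (total n)\<^sup>2 \<le> sq (vals n)"
proof -
  have "\<forall>r. \<exists>c>0. \<forall>v. (\<forall>i<K r. 0 \<le> v i) \<longrightarrow> c * (\<Sum>i<K r. v i)\<^sup>2 \<le> PF r v v"
    using phase_form_lower[OF class_D_net] by blast
  then obtain c where c: "\<And>r. 0 < c r" "\<And>r v. (\<forall>i<K r. 0 \<le> v i) \<Longrightarrow> c r * (\<Sum>i<K r. v i)\<^sup>2 \<le> PF r v v"
    by metis
  obtain d where d: "0 < d" "\<And>r. d \<le> \<kappa> r / lam r * c r"
    using finite_positive_lower_bound[of UNIV "\<lambda>r. \<kappa> r / lam r * c r"] c(1) kl_pos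
    by (metis UNIV_I finite mult_pos_pos)
  have "d / CARD('r) * (total n)\<^sup>2 \<le> sq (vals n)" if n: "n \<in> states net" for n
  proof -
    have "(total n)\<^sup>2 \<le> (\<Sum>r\<in>UNIV. (fl n r)\<^sup>2) * CARD('r)"
      unfolding total_def by (rule sum_squared_le_sum_of_squares)
    then have "d / CARD('r) * (total n)\<^sup>2 \<le> d / CARD('r) * ((\<Sum>r\<in>UNIV. (fl n r)\<^sup>2) * CARD('r))"
      using d(1) by (intro mult_left_mono) auto
    also have "\<dots> = (\<Sum>r\<in>UNIV. d * (fl n r)\<^sup>2)" by (simp add: sum_distrib_left)
    also have "\<dots> \<le> sq (vals n)"
      unfolding form_def
    proof (rule sum_mono)
      fix r
      have "d * (fl n r)\<^sup>2 \<le> (\<kappa> r / lam r * c r) * (fl n r)\<^sup>2" using d(2) by (intro mult_right_mono) auto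
      also have "\<dots> = \<kappa> r / lam r * (c r * (\<Sum>i<K r. vals n r i)\<^sup>2)" by (simp add: vals_sum[OF n])
      also have "\<dots> \<le> \<kappa> r / lam r * PF r (vals n r) (vals n r)"
        using kl_pos[of r] by (intro mult_left_mono c(2)) auto
      finally show "d * (fl n r)\<^sup>2 \<le> \<kappa> r / lam r * PF r (vals n r) (vals n r)" .
    qed
    finally show ?thesis .
  qed
  moreover have "0 < d / CARD('r)" using d by simp
  ultimately show ?thesis using that by blast
qed

lemma form_upper:
  obtains C where "0 < C" "\<And>n. n \<in> states net \<Longrightarrow> sq (vals n) \<le> C * (total n)\<^sup>2"
proof -
  define W where "W r i j = (LINT s:{0..}|lborel. M_integrand (init net r) (gen net r) s $$ (i, j))" for r i j
  define C where "C = (\<Sum>r\<in>UNIV. \<kappa> r / lam r * (\<Sum>i<K r. \<Sum>j<K r. \<bar>W r i j\<bar>))"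
  have "sq (vals n) \<le> (1 + C) * (total n)\<^sup>2" if n: "n \<in> states net" for n
  proof -
    have v: "vals n r i \<le> total n" if "i < K r" for r i
    proof -
      have "vals n r i \<le> (\<Sum>i<K r. vals n r i)" using that by (intro member_le_sum) auto
      with vals_sum[OF n, of r] fl_le_total[of n r] show ?thesis by simp
    qed
    have "sq (vals n) \<le> (\<Sum>r\<in>UNIV. \<kappa> r / lam r * (\<Sum>i<K r. \<Sum>j<K r. \<bar>W r i j\<bar> * (total n)\<^sup>2))"
      unfolding form_def phase_form_def W_def[symmetric]
    proof (intro sum_mono mult_left_mono)
      fix r i j assume ij: "i \<in> {..<K r}" "j \<in> {..<K r}"
      have "vals n r i * W r i j * vals n r j \<le> \<bar>W r i j\<bar> * (vals n r i * vals n r j)"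
        using mult_left_mono[of "W r i j" "\<bar>W r i j\<bar>" "vals n r i * vals n r j"] by (simp add: mult_ac)
      also have "\<dots> \<le> \<bar>W r i j\<bar> * (total n * total n)"
        using ij v total_nonneg by (intro mult_left_mono mult_mono) auto
      finally show "vals n r i * W r i j * vals n r j \<le> \<bar>W r i j\<bar> * (total n)\<^sup>2"
        by (simp add: power2_eq_square)
    qed (use kl_pos in \<open>auto simp: less_imp_le\<close>)
    also have "\<dots> = C * (total n)\<^sup>2" by (simp add: C_def sum_distrib_right mult.assoc)
    also have "\<dots> \<le> (1 + C) * (total n)\<^sup>2" by (simp add: distrib_right)
    finally show ?thesis .
  qed
  moreover have "0 < 1 + C"
    unfolding C_def using kl_pos by (intro add_pos_nonneg sum_nonneg mult_nonneg_nonneg) (auto simp: less_imp_le)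
  ultimately show ?thesis using that by blast
qed

lemma PF_ld_pos: "0 < PF r (ld r) (ld r)"
proof -
  obtain c where c: "0 < c" "\<And>v. (\<forall>i<K r. 0 \<le> v i) \<Longrightarrow> c * (\<Sum>i<K r. v i)\<^sup>2 \<le> PF r v v"
    using phase_form_lower[OF class_D_net] by blast
  have "c * (\<Sum>i<K r. ld r i)\<^sup>2 \<le> PF r (ld r) (ld r)" using load0_nonneg[OF class_D_net] by (intro c(2)) auto
  moreover have "0 < c * (\<Sum>i<K r. ld r i)\<^sup>2" using c(1) ms_pos[of r] by (simp add: load0_sum[OF class_D_net])
  ultimately show ?thesis by linarith
qed

text \<open>Pairing with the load vector of a route measures residual work, whose velocity is
  arriving minus served work. Regrouped by links this is the work balance of each critical
  link.\<close>

lemma form_cvec_drift: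
  assumes n: "n \<in> states net"
  shows "form (cvec \<alpha>) (drift \<theta> n) = (\<Sum>l\<in>Ls. \<alpha> l * (\<Sum>r | l \<in> route net r. \<theta> * \<rho> r - thr n r))"
proof -
  have "form (cvec \<alpha>) (drift \<theta> n) = (\<Sum>r\<in>UNIV. (\<Sum>l\<in>route net r \<inter> Ls. \<alpha> l) * (\<theta> * \<rho> r - thr n r))"
    unfolding form_def
  proof (intro sum.cong refl)
    fix r
    have "PF r (cvec \<alpha> r) (drift \<theta> n r) = lam r / \<kappa> r * (\<Sum>l\<in>route net r \<inter> Ls. \<alpha> l) * PF r (ld r) (drift \<theta> n r)"
      unfolding cvec_def by (subst (1 2) phase_form_commute[OF class_D_net]) (rule phase_form_scale)
    also have "PF r (ld r) (drift \<theta> n r) = \<theta> * \<rho> r - thr n r"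
      unfolding drift_def phase_form_load[OF class_D_net] vals_sum[OF n] by simp
    finally show "\<kappa> r / lam r * PF r (cvec \<alpha> r) (drift \<theta> n r)
        = (\<Sum>l\<in>route net r \<inter> Ls. \<alpha> l) * (\<theta> * \<rho> r - thr n r)"
      using \<kappa>_pos[of r] lam_pos[of r] by simp
  qed
  also have "\<dots> = (\<Sum>r\<in>UNIV. \<Sum>l\<in>Ls. if l \<in> route net r then \<alpha> l * (\<theta> * \<rho> r - thr n r) else 0)"
    by (simp add: sum_distrib_right sum.inter_restrict[symmetric] Int_commute)
  also have "\<dots> = (\<Sum>l\<in>Ls. \<Sum>r\<in>UNIV. if l \<in> route net r then \<alpha> l * (\<theta> * \<rho> r - thr n r) else 0)"
    by (rule sum.swap)
  finally show ?thesis by (simp add: sum.If_cases sum_distrib_left)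
qed

text \<open>A critical link receives work at rate 1 - \<epsilon> times its capacity and serves at
  most its capacity.\<close>

lemma form_cvec_drift_ge:
  assumes n: "n \<in> states net" and \<alpha>: "\<And>l. l \<in> Ls \<Longrightarrow> 0 \<le> \<alpha> l"
  shows "- \<epsilon> * (\<Sum>l\<in>Ls. \<alpha> l * capacity net l) \<le> form (cvec \<alpha>) (drift (1 - \<epsilon>) n)"
proof -
  have "- \<epsilon> * (\<Sum>l\<in>Ls. \<alpha> l * capacity net l) = (\<Sum>l\<in>Ls. \<alpha> l * (- \<epsilon> * capacity net l))"
    by (simp add: sum_distrib_left mult_ac sum_negf)
  also have "\<dots> \<le> form (cvec \<alpha>) (drift (1 - \<epsilon>) n)"
    unfolding form_cvec_drift[OF n]
  proof (intro sum_mono mult_left_mono \<alpha>)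
    fix l assume l: "l \<in> Ls"
    have "(\<Sum>r | l \<in> route net r. (1 - \<epsilon>) * \<rho> r - thr n r)
        = (1 - \<epsilon>) * capacity net l - (\<Sum>r | l \<in> route net r. thr n r)"
      using Ls_load[OF l] by (simp add: sum_subtractf sum_distrib_left[symmetric])
    then show "- \<epsilon> * capacity net l \<le> (\<Sum>r | l \<in> route net r. (1 - \<epsilon>) * \<rho> r - thr n r)"
      using alloc_capacity[OF net wpf n, of l] by (simp add: algebra_simps)
  qed
  finally show ?thesis .
qed

lemma PF_zero_left: "(\<And>i. i < K r \<Longrightarrow> v i = 0) \<Longrightarrow> PF r v w = 0"
  by (simp add: phase_form_def)

lemma inactive_vals:
  assumes "n \<in> states net" "flows (n r) = 0" "i < K r"
  shows "vals n r i = 0"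
  using assms by (simp add: flows_def dim_state[OF assms(1)])

text \<open>Idle routes have zero counts and drop out of the pairing. The first part of the bound is
  made linear in the throughputs, the form to which the optimality of the allocation
  applies.\<close>

lemma form_drift_le:
  obtains c where "0 < c" "\<And>n \<theta>. n \<in> states net \<Longrightarrow>
    form (vals n) (drift \<theta> n) \<le> (\<Sum>r | 0 < flows (n r). \<kappa> r / x n r * (\<theta> * (\<theta> * \<rho> r - thr n r))
      - c * (\<kappa> r / lam r * x n r * PFsq r (resid n \<theta> r)))"
proof -
  define good where "good r c \<longleftrightarrow> (\<forall>l x v. 0 < x \<longrightarrow> PF r v (phase_drift (init net r) (gen net r) l x v)
      \<le> - (x / 2) * (\<Sum>i<K r. v i)\<^sup>2 / ms r + l\<^sup>2 * ms r / (2 * x)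
        - c * x * PF r (\<lambda>i. v i - l / x * ld r i) (\<lambda>i. v i - l / x * ld r i))" for r c
  have "\<exists>c>0. good r c" for r
    unfolding good_def by (rule phase_form_drift[OF class_D_net])
  then obtain c where c: "\<And>r. 0 < c r" "\<And>r. good r (c r)" by metis
  obtain d where d: "0 < d" "\<And>r. d \<le> c r"
    using finite_positive_lower_bound[of UNIV c] c(1) by (metis UNIV_I finite)
  have "form (vals n) (drift \<theta> n) \<le> (\<Sum>r | 0 < flows (n r). \<kappa> r / x n r * (\<theta> * (\<theta> * \<rho> r - thr n r))
      - d * (\<kappa> r / lam r * x n r * PFsq r (resid n \<theta> r)))"
    if n: "n \<in> states net" for n \<theta>
  proof -
    have "form (vals n) (drift \<theta> n) = (\<Sum>r\<in>UNIV. if 0 < flows (n r) then \<kappa> r / lam r * PF r (vals n r) (drift \<theta> n r) else 0)"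
      unfolding form_def using PF_zero_left inactive_vals[OF n] by (intro sum.cong) auto
    also have "\<dots> = (\<Sum>r | 0 < flows (n r). \<kappa> r / lam r * PF r (vals n r) (drift \<theta> n r))"
      by (simp add: sum.If_cases)
    also have "\<dots> \<le> (\<Sum>r | 0 < flows (n r). \<kappa> r / x n r * (\<theta> * (\<theta> * \<rho> r - thr n r))
      - d * (\<kappa> r / lam r * x n r * PFsq r (resid n \<theta> r)))"
    proof (rule sum_mono)
      fix r assume "r \<in> {r. 0 < flows (n r)}"
      then have X: "0 < x n r" using alloc_pos[OF net wpf n] by simp
      define q where "q = PFsq r (resid n \<theta> r)"
      define y where "y = thr n r"
      have q0: "0 \<le> q" unfolding q_def by (rule phase_form_nonneg[OF class_D_net])
      have "PF r (vals n r) (drift \<theta> n r) \<le> - (x n r / 2) * (fl n r)\<^sup>2 / ms r + (\<theta> * lam r)\<^sup>2 * ms r / (2 * x n r)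
          - c r * x n r * q"
        using c(2)[of r, unfolded good_def, rule_format, OF X, of "vals n r" "\<theta> * lam r"]
        unfolding drift_def vals_sum[OF n] q_def .
      also have "\<dots> \<le> - (x n r / 2) * (fl n r)\<^sup>2 / ms r + (\<theta> * lam r)\<^sup>2 * ms r / (2 * x n r) - d * x n r * q"
        using d(2)[of r] X q0 by (simp add: mult_right_mono)
      finally have "\<kappa> r / lam r * PF r (vals n r) (drift \<theta> n r) \<le> \<kappa> r / lam r *
          (- (x n r / 2) * (fl n r)\<^sup>2 / ms r + (\<theta> * lam r)\<^sup>2 * ms r / (2 * x n r) - d * x n r * q)"
        using kl_pos[of r] by (intro mult_left_mono) auto
      also have "\<dots> = \<kappa> r / x n r * (((\<theta> * \<rho> r)\<^sup>2 - y\<^sup>2) / (2 * \<rho> r)) - d * (\<kappa> r / lam r * x n r * q)"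
        using X lam_pos[of r] ms_pos[of r] by (simp add: y_def field_simps power2_eq_square)
      \<comment> \<open>With a = \<theta> * \<rho> r this is the tangent bound a^2 - y^2 \<le> 2a(a
        - y).\<close>
      also have "\<kappa> r / x n r * (((\<theta> * \<rho> r)\<^sup>2 - y\<^sup>2) / (2 * \<rho> r)) \<le> \<kappa> r / x n r * (\<theta> * (\<theta> * \<rho> r - y))"
      proof (intro mult_left_mono)
        have "(\<theta> * \<rho> r)\<^sup>2 - y\<^sup>2 \<le> \<theta> * (\<theta> * \<rho> r - y) * (2 * \<rho> r)"
          using zero_le_power2[of "\<theta> * \<rho> r - y"] by (simp add: power2_eq_square algebra_simps)
        then show "((\<theta> * \<rho> r)\<^sup>2 - y\<^sup>2) / (2 * \<rho> r) \<le> \<theta> * (\<theta> * \<rho> r - y)"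
          using \<rho>_pos[of r] by (subst pos_divide_le_eq) auto
      qed (use X \<kappa>_pos[of r] in auto)
      finally show "\<kappa> r / lam r * PF r (vals n r) (drift \<theta> n r)
        \<le> \<kappa> r / x n r * (\<theta> * (\<theta> * \<rho> r - thr n r))
      - d * (\<kappa> r / lam r * x n r * PFsq r (resid n \<theta> r))"
        by (simp add: q_def y_def)
    qed
    finally show ?thesis .
  qed
  with d(1) show ?thesis using that by blast
qed

lemma throughput_bound:
  obtains C where "0 < C" "\<And>n r. n \<in> states net \<Longrightarrow> thr n r \<le> C"
proof -
  define C where "C = (\<Sum>l\<in>UNIV. capacity net l)"
  have "thr n r \<le> C" if n: "n \<in> states net" for n r
  proof -
    obtain l where l: "l \<in> route net r" using route_ne[of r] by blast
    have "thr n r \<le> (\<Sum>r | l \<in> route net r. thr n r)"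
      using l alloc_nonneg[OF net wpf n] by (intro member_le_sum) auto
    also have "\<dots> \<le> capacity net l" by (rule alloc_capacity[OF net wpf n])
    also have "\<dots> \<le> C" unfolding C_def using C_pos by (intro member_le_sum) (auto simp: less_imp_le)
    finally show ?thesis .
  qed
  moreover have "0 < C" unfolding C_def using C_pos by (intro sum_pos) auto
  ultimately show ?thesis using that by blast
qed

text \<open>The critical loads are themselves feasible throughputs, so optimality makes the critical
  part nonpositive and leaves the term of the missing fraction \<epsilon> of arrivals. Since
  throughputs are bounded, 1 / x is at least proportional to the flows on the route.\<close>

lemma form_drift_linear:
  obtains c where "0 < c" "\<And>n \<epsilon>. n \<in> states net \<Longrightarrow> 0 < \<epsilon> \<Longrightarrow> \<epsilon> \<le> 1 / 2 \<Longrightarrow>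
    form (vals n) (drift (1 - \<epsilon>) n) \<le> - c * \<epsilon> * total n"
proof -
  obtain c0 where c0: "0 < c0" "\<And>n \<theta>. n \<in> states net \<Longrightarrow>
    form (vals n) (drift \<theta> n) \<le> (\<Sum>r | 0 < flows (n r). \<kappa> r / x n r * (\<theta> * (\<theta> * \<rho> r - thr n r))
      - c0 * (\<kappa> r / lam r * x n r * PFsq r (resid n \<theta> r)))"
    by (rule form_drift_le) blast
  obtain Y where Y: "0 < Y" "\<And>n r. n \<in> states net \<Longrightarrow> thr n r \<le> Y" by (rule throughput_bound) blast
  obtain d where d: "0 < d" "\<And>r. d \<le> \<kappa> r * \<rho> r / Y"
  proof -
    have "0 < \<kappa> r * \<rho> r / Y" for r by (simp add: \<kappa>_pos lam_pos ms_pos Y(1))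
    then show ?thesis using finite_positive_lower_bound[of UNIV "\<lambda>r. \<kappa> r * \<rho> r / Y"] that by (metis UNIV_I finite)
  qed
  have "form (vals n) (drift (1 - \<epsilon>) n) \<le> - (d / 2) * \<epsilon> * total n"
    if n: "n \<in> states net" and \<epsilon>: "0 < \<epsilon>" "\<epsilon> \<le> 1 / 2" for n \<epsilon>
  proof -
    have "form (vals n) (drift (1 - \<epsilon>) n)
        \<le> (\<Sum>r | 0 < flows (n r). \<kappa> r / x n r * ((1 - \<epsilon>) * ((1 - \<epsilon>) * \<rho> r - thr n r)))"
    proof (rule order_trans[OF c0(2)[OF n]], rule sum_mono)
      fix r assume "r \<in> {r. 0 < flows (n r)}"
      have "0 \<le> c0 * (\<kappa> r / lam r * x n r * PFsq r (resid n (1 - \<epsilon>) r))"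
        using c0(1) kl_pos[of r] alloc_nonneg[OF net wpf n, of r]
        by (intro mult_nonneg_nonneg phase_form_nonneg[OF class_D_net]) auto
      then show "\<kappa> r / x n r * ((1 - \<epsilon>) * ((1 - \<epsilon>) * \<rho> r - thr n r))
          - c0 * (\<kappa> r / lam r * x n r * PFsq r (resid n (1 - \<epsilon>) r))
          \<le> \<kappa> r / x n r * ((1 - \<epsilon>) * ((1 - \<epsilon>) * \<rho> r - thr n r))" by linarith
    qed
    also have "\<dots> = (1 - \<epsilon>) * (\<Sum>r | 0 < flows (n r). \<kappa> r / x n r * (\<rho> r - thr n r))
        - (1 - \<epsilon>) * \<epsilon> * (\<Sum>r | 0 < flows (n r). \<kappa> r / x n r * \<rho> r)"
    proof -
      have "a * ((1 - \<epsilon>) * ((1 - \<epsilon>) * b - y)) = (1 - \<epsilon>) * (a * (b - y)) - (1 - \<epsilon>) * \<epsilon> * (a * b)" for a b y :: real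
        by (simp add: algebra_simps)
      then show ?thesis unfolding sum_distrib_left sum_subtractf[symmetric] by simp
    qed
    also have "\<dots> \<le> - ((1 - \<epsilon>) * \<epsilon> * (\<Sum>r | 0 < flows (n r). \<kappa> r / x n r * \<rho> r))"
    proof -
      have "(\<Sum>r | 0 < flows (n r). \<kappa> r / x n r * (\<rho> r - thr n r)) \<le> 0"
        using \<rho>_pos load_le by (intro alloc_variational[OF net wpf n]) (auto simp: less_imp_le)
      then have "(1 - \<epsilon>) * (\<Sum>r | 0 < flows (n r). \<kappa> r / x n r * (\<rho> r - thr n r)) \<le> 0"
        using \<epsilon> by (simp add: mult_le_0_iff)
      then show ?thesis by linarith
    qed
    also have "\<dots> \<le> - (1 / 2) * \<epsilon> * (d * total n)"
    proof -
      have "d * total n = (\<Sum>r | 0 < flows (n r). d * fl n r)"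
        unfolding total_def sum_distrib_left by (intro sum.mono_neutral_cong_right) auto
      also have "\<dots> \<le> (\<Sum>r | 0 < flows (n r). \<kappa> r / x n r * \<rho> r)"
      proof (rule sum_mono)
        fix r assume "r \<in> {r. 0 < flows (n r)}"
        then have X: "0 < x n r" using alloc_pos[OF net wpf n] by simp
        have "d * fl n r \<le> \<kappa> r * \<rho> r / Y * fl n r" using d(2) by (intro mult_right_mono) auto
        also have "\<dots> = \<kappa> r * \<rho> r / x n r * ((thr n r) / Y)" using X by simp
        also have "\<dots> \<le> \<kappa> r * \<rho> r / x n r * 1"
          using Y(1) Y(2)[OF n, of r] X \<kappa>_pos[of r] \<rho>_pos[of r] by (intro mult_left_mono) auto
        finally show "d * fl n r \<le> \<kappa> r / x n r * \<rho> r" by simp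
      qed
      finally have S: "d * total n \<le> (\<Sum>r | 0 < flows (n r). \<kappa> r / x n r * \<rho> r)" .
      have "(1 / 2) * \<epsilon> * (d * total n) \<le> (1 - \<epsilon>) * \<epsilon> * (\<Sum>r | 0 < flows (n r). \<kappa> r / x n r * \<rho> r)"
        using \<epsilon> d(1) total_nonneg[of n] by (intro mult_mono S) auto
      then show ?thesis by simp
    qed
    finally show ?thesis by (simp add: mult_ac)
  qed
  moreover have "0 < d / 2" using d(1) by simp
  ultimately show ?thesis using that by blast
qed

end

lemma phase_form_add_le:
  assumes "class_D p S"
  shows "phase_form p S (\<lambda>i. u i + c * v i) (\<lambda>i. u i + c * v i)
    \<le> 2 * phase_form p S u u + 2 * c\<^sup>2 * phase_form p S v v"
proof -
  have "phase_form p S (\<lambda>i. u i + c * v i) (\<lambda>i. u i + c * v i)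
    = phase_form p S u u + 2 * c * phase_form p S u v + c\<^sup>2 * phase_form p S v v"
    using phase_form_diff_scaled[OF assms, of u "- c" v] by simp
  moreover have "0 \<le> phase_form p S u u - 2 * c * phase_form p S u v + c\<^sup>2 * phase_form p S v v"
    using phase_form_nonneg[OF assms, of "\<lambda>i. u i - c * v i"]
    unfolding phase_form_diff_scaled[OF assms] .
  ultimately show ?thesis by linarith
qed

section \<open>Link prices and the distance to the cone\<close>

context heavy_traffic
begin

definition is_price :: "('r \<Rightarrow> nat Matrix.vec) \<Rightarrow> ('l \<Rightarrow> real) \<Rightarrow> bool" where
  "is_price n \<pi> \<longleftrightarrow> (\<forall>l. 0 \<le> \<pi> l) \<and>
     (\<forall>r. 0 < flows (n r) \<longrightarrow> \<kappa> r / x n r = (\<Sum>l \<in> route net r. \<pi> l)) \<and>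
     (\<forall>l. \<pi> l * (\<Sum>r | l \<in> route net r. thr n r) = \<pi> l * capacity net l)"

lemma price_exists:
  assumes "n \<in> states net"
  obtains \<pi> where "is_price n \<pi>"
  using prices_exist[OF net wpf assms] unfolding is_price_def by metis

lemma sum_route_swap:
  fixes \<pi> :: "'l \<Rightarrow> real" and z :: "'r \<Rightarrow> real"
  shows "(\<Sum>r\<in>UNIV. (\<Sum>l\<in>route net r. \<pi> l) * z r) = (\<Sum>l\<in>UNIV. \<pi> l * (\<Sum>r | l \<in> route net r. z r))"
proof -
  have "(\<Sum>r\<in>UNIV. (\<Sum>l\<in>route net r. \<pi> l) * z r) = (\<Sum>r\<in>UNIV. \<Sum>l\<in>UNIV. if l \<in> route net r then \<pi> l * z r else 0)"
  proof (intro sum.cong refl)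
    fix r
    show "(\<Sum>l\<in>route net r. \<pi> l) * z r = (\<Sum>l\<in>UNIV. if l \<in> route net r then \<pi> l * z r else 0)"
      unfolding sum_distrib_right by (intro sum.mono_neutral_cong_left) auto
  qed
  also have "\<dots> = (\<Sum>l\<in>UNIV. \<Sum>r\<in>UNIV. if l \<in> route net r then \<pi> l * z r else 0)" by (rule sum.swap)
  also have "\<dots> = (\<Sum>l\<in>UNIV. \<pi> l * (\<Sum>r | l \<in> route net r. z r))"
    by (simp add: sum_distrib_left sum.If_cases)
  finally show ?thesis .
qed

text \<open>By complementary slackness the capacities valued at their prices equal the sum of weight
  times flows over all routes. So prices grow at most linearly in the number of flows.\<close>

lemma price_bound:
  obtains P where "0 < P"
    "\<And>n \<pi> r. n \<in> states net \<Longrightarrow> is_price n \<pi> \<Longrightarrow> (\<Sum>l\<in>route net r. \<pi> l) \<le> P * total n"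
proof -
  obtain c where c: "0 < c" "\<And>l. c \<le> capacity net l"
    using finite_positive_lower_bound[of UNIV "capacity net"] C_pos by (metis UNIV_I finite)
  obtain k where k: "0 < k" "\<And>r. \<kappa> r \<le> k"
    using finite_positive_upper_bound[of UNIV "weight net"] by (metis UNIV_I finite)
  have "(\<Sum>l\<in>route net r. \<pi> l) \<le> k / c * total n" if n: "n \<in> states net" and \<pi>: "is_price n \<pi>" for n \<pi> r
  proof -
    have \<pi>0: "0 \<le> \<pi> l" for l using \<pi> by (simp add: is_price_def)
    have "c * (\<Sum>l\<in>route net r. \<pi> l) \<le> c * (\<Sum>l\<in>UNIV. \<pi> l)"
      using c(1) \<pi>0 by (intro mult_left_mono sum_mono2) auto
    also have "\<dots> \<le> (\<Sum>l\<in>UNIV. \<pi> l * capacity net l)"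
      unfolding sum_distrib_left using c(2) \<pi>0 by (intro sum_mono, subst mult.commute, intro mult_left_mono) auto
    also have "\<dots> = (\<Sum>l\<in>UNIV. \<pi> l * (\<Sum>r | l \<in> route net r. thr n r))"
      using \<pi> by (intro sum.cong) (auto simp: is_price_def)
    also have "\<dots> = (\<Sum>r\<in>UNIV. (\<Sum>l\<in>route net r. \<pi> l) * (thr n r))"
      by (rule sum_route_swap[symmetric])
    also have "\<dots> \<le> (\<Sum>r\<in>UNIV. k * fl n r)"
    proof (rule sum_mono)
      fix r
      show "(\<Sum>l\<in>route net r. \<pi> l) * (thr n r) \<le> k * fl n r"
      proof (cases "0 < flows (n r)")
        case True
        then have "(\<Sum>l\<in>route net r. \<pi> l) = \<kappa> r / x n r" using \<pi> by (simp add: is_price_def)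
        then have eq: "(\<Sum>l\<in>route net r. \<pi> l) * (thr n r) = \<kappa> r * fl n r"
          using alloc_pos[OF net wpf n True] by simp
        show ?thesis unfolding eq using k(2)[of r] by (intro mult_right_mono) auto
      qed simp
    qed
    also have "\<dots> = k * total n" by (simp add: total_def sum_distrib_left)
    finally show ?thesis using c(1) by (simp add: field_simps)
  qed
  moreover have "0 < k / c" using c k by simp
  ultimately show ?thesis using that by blast
qed

text \<open>The point of the cone is built from the prices of the critical links. Where it does not match the
  state, on noncritical links with a price and on routes without flows, the drift is linear in the prices,
  which dominates their squares divided by the number of flows.\<close>

lemma form_drift_quadratic:
  obtains C where "0 < C" "\<And>n \<epsilon>. n \<in> states net \<Longrightarrow> 0 < \<epsilon> \<Longrightarrow> \<epsilon> \<le> 1 / 2 \<Longrightarrow>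
    \<exists>\<alpha>. (\<forall>l. 0 \<le> \<alpha> l) \<and>
      sq (dev n \<alpha>)
        \<le> C * total n * - form (vals n) (drift (1 - \<epsilon>) n)"
proof -
  obtain c0 where c0: "0 < c0" "\<And>n \<theta>. n \<in> states net \<Longrightarrow>
    form (vals n) (drift \<theta> n) \<le> (\<Sum>r | 0 < flows (n r). \<kappa> r / x n r * (\<theta> * (\<theta> * \<rho> r - thr n r))
      - c0 * (\<kappa> r / lam r * x n r * PFsq r (resid n \<theta> r)))"
    by (rule form_drift_le) blast
  obtain P where P: "0 < P"
    "\<And>n \<pi> r. n \<in> states net \<Longrightarrow> is_price n \<pi> \<Longrightarrow> (\<Sum>l\<in>route net r. \<pi> l) \<le> P * total n"
    by (rule price_bound) blast
  define gap where "gap l = capacity net l - (\<Sum>r | l \<in> route net r. \<rho> r)" for l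
  have "0 < gap l" if "l \<in> - Ls" for l using nonLs_load[of l] that by (simp add: gap_def)
  then obtain g where g: "0 < g" "\<And>l. l \<in> - Ls \<Longrightarrow> g \<le> gap l"
    using finite_positive_lower_bound[of "- Ls" gap] by (metis finite)
  obtain m where m: "0 < m" "\<And>r. m \<le> \<rho> r"
    using finite_positive_lower_bound[of UNIV \<rho>] \<rho>_pos by (metis UNIV_I finite)
  obtain k where k: "0 < k" "\<And>r. k \<le> \<kappa> r"
    using finite_positive_lower_bound[of UNIV "weight net"] \<kappa>_pos by (metis UNIV_I finite)
  obtain G where G: "0 < G" "\<And>r. lam r / \<kappa> r * PF r (ld r) (ld r) \<le> G"
    using finite_positive_upper_bound[of UNIV "\<lambda>r. lam r / \<kappa> r * PF r (ld r) (ld r)"] by (metis UNIV_I finite)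
  \<comment> \<open>Each constant pays for one source of distance in terms of one part of the
    dissipation: \<open>C1\<close> for prices of noncritical links, \<open>C2\<close> for prices
    along idle routes, \<open>C3\<close> for the completed squares.\<close>
  define C1 C2 C3 where "C1 = 2 * G * P * CARD('r) / g" and "C2 = G * P / m" and "C3 = 2 * P / k"
  have C123: "0 < C1" "0 < C2" "0 < C3"
    using G P g m k by (simp_all add: C1_def C2_def C3_def)
  define C where "C = 2 * C1 + 2 * C2 + C3 / c0"
  have C0: "0 < C" using C123 c0(1) by (simp add: C_def add_pos_pos)
  have "\<exists>\<alpha>. (\<forall>l. 0 \<le> \<alpha> l) \<and>
      sq (dev n \<alpha>)
        \<le> C * total n * - form (vals n) (drift (1 - \<epsilon>) n)"
    if n: "n \<in> states net" and \<epsilon>: "0 < \<epsilon>" "\<epsilon> \<le> 1 / 2" for n \<epsilon>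
  proof -
    define \<theta> where "\<theta> = 1 - \<epsilon>"
    have \<theta>: "1 / 2 \<le> \<theta>" "\<theta> \<le> 1" using \<epsilon> by (auto simp: \<theta>_def)
    obtain \<pi> where \<pi>: "is_price n \<pi>" by (rule price_exists[OF n])
    have \<pi>0: "0 \<le> \<pi> l" for l using \<pi> by (simp add: is_price_def)
    define W where "W r = (\<Sum>l\<in>route net r. \<pi> l)" for r
    define T where "T = total n"
    have T0: "0 \<le> T" by (simp add: T_def total_nonneg)
    have W: "0 \<le> W r" "W r \<le> P * T" for r
      using P(2)[OF n \<pi>, of r] \<pi>0 by (auto simp: W_def T_def intro: sum_nonneg)
    have Wact: "\<kappa> r / x n r = W r" if "0 < flows (n r)" for r
      using \<pi> that by (simp add: is_price_def W_def)
    define a where "a r = (\<Sum>l\<in>route net r \<inter> Ls. \<pi> l)" for r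
    define b where "b r = (\<Sum>l\<in>route net r - Ls. \<pi> l)" for r
    define Z where "Z = (\<Sum>l\<in>- Ls. \<pi> l)"
    have a0: "0 \<le> a r" and b0: "0 \<le> b r" for r unfolding a_def b_def using \<pi>0 by (auto intro: sum_nonneg)
    have ab: "W r = a r + b r" for r
      unfolding W_def a_def b_def by (rule sum.Int_Diff) simp
    have bZ: "b r \<le> Z" for r unfolding b_def Z_def using \<pi>0 by (intro sum_mono2) auto
    define q where "q r = PFsq r (resid n \<theta> r)" for r
    have q0: "0 \<le> q r" for r unfolding q_def by (rule phase_form_nonneg[OF class_D_net])
    define A1 A2 A3 where "A1 = (\<Sum>l\<in>- Ls. \<pi> l * gap l)"
      and "A2 = (\<Sum>r | flows (n r) = 0. W r * \<rho> r)"
      and "A3 = (\<Sum>r | 0 < flows (n r). \<kappa> r / lam r * x n r * q r)"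
    have A1Z: "g * Z \<le> A1"
      unfolding A1_def Z_def sum_distrib_left using g(2) \<pi>0
      by (intro sum_mono, subst mult.commute, intro mult_left_mono) auto
    have A1: "0 \<le> A1"
    proof -
      have "0 \<le> Z" unfolding Z_def using \<pi>0 by (intro sum_nonneg) auto
      then have "0 \<le> g * Z" using g(1) by simp
      with A1Z show ?thesis by linarith
    qed
    have A2W: "m * (\<Sum>r | flows (n r) = 0. W r) \<le> A2"
      unfolding A2_def sum_distrib_left using m(2) W(1) by (intro sum_mono, subst mult.commute, intro mult_left_mono) auto
    have A2: "0 \<le> A2" unfolding A2_def using W(1) lam_pos ms_pos by (intro sum_nonneg mult_nonneg_nonneg) (auto simp: less_imp_le)
    have A3: "0 \<le> A3" unfolding A3_def
      using kl_pos q0 alloc_nonneg[OF net wpf n] by (intro sum_nonneg mult_nonneg_nonneg) (auto simp: less_imp_le)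
    have split: "(\<Sum>r\<in>UNIV. f r) = (\<Sum>r | 0 < flows (n r). f r) + (\<Sum>r | flows (n r) = 0. f r)" for f :: "'r \<Rightarrow> real"
    proof -
      have U: "{r. 0 < flows (n r)} \<union> {r. flows (n r) = 0} = UNIV"
        and disj: "{r. 0 < flows (n r)} \<inter> {r. flows (n r) = 0} = {}" by auto
      show ?thesis using sum.union_disjoint[OF finite finite disj, of f] unfolding U .
    qed
    \<comment> \<open>Summed by links instead of routes, critical links cancel by complementary
      slackness and the others leave minus their gap. Idle routes belong to the link sums but not to
      the left side, hence the further \<open>A2\<close>.\<close>
    have main: "(\<Sum>r | 0 < flows (n r). \<kappa> r / x n r * (\<rho> r - thr n r)) = - A1 - A2"
    proof -
      have "(\<Sum>r | 0 < flows (n r). \<kappa> r / x n r * (\<rho> r - thr n r))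
          = (\<Sum>r | 0 < flows (n r). W r * (\<rho> r - thr n r))"
        by (intro sum.cong refl arg_cong2[of _ _ _ _ "(*)"] Wact) auto
      moreover have "(\<Sum>r\<in>UNIV. W r * (\<rho> r - thr n r))
          = (\<Sum>r | 0 < flows (n r). W r * (\<rho> r - thr n r)) + (\<Sum>r | flows (n r) = 0. W r * (\<rho> r - thr n r))"
        by (rule split)
      moreover have "(\<Sum>r | flows (n r) = 0. W r * (\<rho> r - thr n r)) = A2"
        unfolding A2_def by (intro sum.cong) auto
      moreover have "(\<Sum>r\<in>UNIV. W r * (\<rho> r - thr n r)) = - A1"
      proof -
        have "(\<Sum>r\<in>UNIV. W r * (\<rho> r - thr n r))
            = (\<Sum>l\<in>UNIV. \<pi> l * (\<Sum>r | l \<in> route net r. \<rho> r - thr n r))"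
          unfolding W_def by (rule sum_route_swap)
        also have "\<dots> = (\<Sum>l\<in>UNIV. if l \<in> - Ls then - (\<pi> l * gap l) else 0)"
        proof (intro sum.cong refl)
          fix l
          have "\<pi> l * (\<Sum>r | l \<in> route net r. \<rho> r - thr n r)
              = \<pi> l * (\<Sum>r | l \<in> route net r. \<rho> r) - \<pi> l * (\<Sum>r | l \<in> route net r. thr n r)"
            by (simp only: sum_subtractf right_diff_distrib)
          also have "\<pi> l * (\<Sum>r | l \<in> route net r. thr n r) = \<pi> l * capacity net l"
            using \<pi> by (simp add: is_price_def)
          finally show "\<pi> l * (\<Sum>r | l \<in> route net r. \<rho> r - thr n r)
              = (if l \<in> - Ls then - (\<pi> l * gap l) else 0)"
            using Ls_load[of l] by (auto simp: gap_def right_diff_distrib)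
        qed
        also have "\<dots> = - A1" unfolding A1_def by (simp only: sum.inter_restrict[symmetric] finite sum_negf) simp
        finally show ?thesis .
      qed
      ultimately show ?thesis by linarith
    qed
    \<comment> \<open>Since \<theta> is at least 1/2, half of the linear dissipation
      survives.\<close>
    have N: "(A1 + A2) / 2 + c0 * A3 \<le> - form (vals n) (drift \<theta> n)"
    proof -
      have "form (vals n) (drift \<theta> n) \<le> (\<Sum>r | 0 < flows (n r). \<theta> * (\<kappa> r / x n r * (\<rho> r - thr n r))
          - c0 * (\<kappa> r / lam r * x n r * q r))"
      proof (rule order_trans[OF c0(2)[OF n]], intro sum_mono)
        fix r assume "r \<in> {r. 0 < flows (n r)}"
        then have X: "0 < x n r" using alloc_pos[OF net wpf n] by simp
        have "\<theta> * \<rho> r \<le> 1 * \<rho> r" using \<theta> \<rho>_pos[of r] by (intro mult_right_mono) auto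
        then have "\<kappa> r / x n r * (\<theta> * (\<theta> * \<rho> r - thr n r)) \<le> \<kappa> r / x n r * (\<theta> * (\<rho> r - thr n r))"
          using X \<kappa>_pos[of r] \<theta> by (intro mult_left_mono) auto
        then show "\<kappa> r / x n r * (\<theta> * (\<theta> * \<rho> r - thr n r))
          - c0 * (\<kappa> r / lam r * x n r * PFsq r (resid n \<theta> r))
          \<le> \<theta> * (\<kappa> r / x n r * (\<rho> r - thr n r)) - c0 * (\<kappa> r / lam r * x n r * q r)"
          unfolding q_def by (simp only: mult.left_commute[of "\<kappa> r / x n r" \<theta>])
      qed
      also have "\<dots> = \<theta> * (\<Sum>r | 0 < flows (n r). \<kappa> r / x n r * (\<rho> r - thr n r)) - c0 * A3"
        unfolding A3_def by (simp only: sum_subtractf sum_distrib_left)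
      also have "\<dots> = \<theta> * (- A1 - A2) - c0 * A3" by (simp only: main)
      also have "\<dots> \<le> - ((A1 + A2) / 2) - c0 * A3"
        using mult_right_mono[OF \<theta>(1), of "A1 + A2"] A1 A2 by (simp add: algebra_simps)
      finally show ?thesis by linarith
    qed
    \<comment> \<open>With the factor \<theta>, an active route that has no priced noncritical link
      gets the cone point \<theta> lam / x times its load vector, exactly the centre of its
      completed square.\<close>
    define \<alpha> where "\<alpha> l = \<theta> * \<pi> l" for l
    define E where "E r = \<kappa> r / lam r * PF r (\<lambda>i. vals n r i - cvec \<alpha> r i) (\<lambda>i. vals n r i - cvec \<alpha> r i)" for r
    have cv: "cvec \<alpha> r i = \<theta> * lam r / \<kappa> r * a r * ld r i" for r i
      by (simp add: cvec_def \<alpha>_def a_def sum_distrib_left[symmetric])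
    \<comment> \<open>One price factor is kept and the other bounded by \<open>P * T\<close>:
      squares of prices become a linear cost times the number of flows.\<close>
    have Gs: "\<kappa> r / lam r * ((\<theta> * lam r / \<kappa> r * s)\<^sup>2 * PF r (ld r) (ld r)) \<le> G * (s * (P * T))"
      if s: "0 \<le> s" "s \<le> W r" for r s
    proof -
      have "\<kappa> r / lam r * ((\<theta> * lam r / \<kappa> r * s)\<^sup>2 * PF r (ld r) (ld r))
          = \<theta>\<^sup>2 * ((lam r / \<kappa> r * PF r (ld r) (ld r)) * (s * s))"
        using \<kappa>_pos[of r] lam_pos[of r] by (simp add: power2_eq_square field_simps)
      also have "\<dots> \<le> 1 * (G * (s * (P * T)))"
      proof (intro mult_mono)
        show "\<theta>\<^sup>2 \<le> 1" using \<theta> by (simp add: power_le_one)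
        show "lam r / \<kappa> r * PF r (ld r) (ld r) \<le> G" by (rule G)
        show "s \<le> P * T" using s W(2)[of r] by linarith
      qed (use s G(1) PF_ld_pos[of r] lam_pos[of r] \<kappa>_pos[of r] in \<open>auto simp: less_imp_le\<close>)
      finally show ?thesis by simp
    qed
    have Eact: "E r \<le> C3 * T * (\<kappa> r / lam r * x n r * q r) + 2 * G * P * T * Z" if act: "0 < flows (n r)" for r
    proof -
      have X: "0 < x n r" using alloc_pos[OF net wpf n act] .
      have Wr: "W r = \<kappa> r / x n r" using Wact[OF act] by simp
      \<comment> \<open>The mismatch \<open>b r\<close> is the price of the noncritical links of the
        route, because \<open>W r = a r + b r\<close>.\<close>
      have eq: "vals n r i - cvec \<alpha> r i = (vals n r i - \<theta> * lam r / x n r * ld r i) + (\<theta> * lam r / \<kappa> r * b r) * ld r i" for i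
      proof -
        have "\<theta> * lam r / x n r = \<theta> * lam r / \<kappa> r * W r" unfolding Wr using \<kappa>_pos[of r] by simp
        then have "\<theta> * lam r / x n r = \<theta> * lam r / \<kappa> r * (a r + b r)" by (simp only: ab)
        then show ?thesis unfolding cv by (simp only: distrib_left distrib_right)
      qed
      have "E r \<le> \<kappa> r / lam r * (2 * q r + 2 * (\<theta> * lam r / \<kappa> r * b r)\<^sup>2 * PF r (ld r) (ld r))"
        unfolding E_def eq q_def
        by (rule mult_left_mono[OF phase_form_add_le[OF class_D_net[of r], of "\<lambda>i. vals n r i - \<theta> * lam r / x n r * ld r i"
          "\<theta> * lam r / \<kappa> r * b r" "ld r"] less_imp_le[OF kl_pos]])
      also have "\<dots> = 2 * (1 / x n r) * (\<kappa> r / lam r * x n r * q r)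
          + 2 * (\<kappa> r / lam r * ((\<theta> * lam r / \<kappa> r * b r)\<^sup>2 * PF r (ld r) (ld r)))"
      proof -
        have alg: "k * (2 * q + 2 * s * p) = 2 * (1 / y) * (k * y * q) + 2 * (k * (s * p))" if "y \<noteq> 0" for k q s p y :: real
          using that by (simp add: algebra_simps)
        show ?thesis by (rule alg) (use X in simp)
      qed
      also have "\<dots> \<le> C3 * T * (\<kappa> r / lam r * x n r * q r) + 2 * (G * (Z * (P * T)))"
      proof (intro add_mono)
        have "1 / x n r = W r / \<kappa> r" unfolding Wr using \<kappa>_pos[of r] by simp
        also have "\<dots> \<le> P * T / k" using W[of r] k(1) k(2)[of r] by (intro frac_le) auto
        finally have "2 * (1 / x n r) \<le> C3 * T" by (simp add: C3_def)
        then show "2 * (1 / x n r) * (\<kappa> r / lam r * x n r * q r) \<le> C3 * T * (\<kappa> r / lam r * x n r * q r)"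
          by (intro mult_right_mono mult_nonneg_nonneg) (use kl_pos[of r] X q0[of r] in \<open>auto simp: less_imp_le\<close>)
        have "\<kappa> r / lam r * ((\<theta> * lam r / \<kappa> r * b r)\<^sup>2 * PF r (ld r) (ld r)) \<le> G * (b r * (P * T))"
          by (rule Gs[OF b0]) (use ab[of r] a0[of r] in simp)
        also have "\<dots> \<le> G * (Z * (P * T))"
          using bZ[of r] G(1) P(1) T0 by (intro mult_left_mono mult_right_mono) auto
        finally show "2 * (\<kappa> r / lam r * ((\<theta> * lam r / \<kappa> r * b r)\<^sup>2 * PF r (ld r) (ld r))) \<le> 2 * (G * (Z * (P * T)))"
          by simp
      qed
      finally show ?thesis by (simp add: mult_ac)
    qed
    have Einact: "E r \<le> G * P * T * W r" if inact: "flows (n r) = 0" for r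
    proof -
      have "E r = \<kappa> r / lam r * PF r (\<lambda>i. 0 - (\<theta> * lam r / \<kappa> r * a r) * ld r i) (\<lambda>i. 0 - (\<theta> * lam r / \<kappa> r * a r) * ld r i)"
        unfolding E_def cv using inactive_vals[OF n inact]
        by (intro arg_cong2[of _ _ _ _ "(*)"] phase_form_cong refl) auto
      also have "\<dots> = \<kappa> r / lam r * ((\<theta> * lam r / \<kappa> r * a r)\<^sup>2 * PF r (ld r) (ld r))"
        unfolding phase_form_diff_scaled[OF class_D_net] by (simp add: PF_zero_left)
      also have "\<dots> \<le> G * (a r * (P * T))" by (rule Gs[OF a0]) (use ab[of r] b0[of r] in simp)
      also have "\<dots> \<le> G * (W r * (P * T))"
        using ab[of r] b0[of r] G(1) P(1) T0 by (intro mult_left_mono mult_right_mono) auto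
      finally show ?thesis by (simp add: mult_ac)
    qed
    have "sq (dev n \<alpha>) = (\<Sum>r\<in>UNIV. E r)"
      by (simp add: form_def E_def)
    also have "\<dots> = (\<Sum>r | 0 < flows (n r). E r) + (\<Sum>r | flows (n r) = 0. E r)"
      by (rule split)
    also have "\<dots> \<le> (\<Sum>r | 0 < flows (n r). C3 * T * (\<kappa> r / lam r * x n r * q r) + 2 * G * P * T * Z)
        + (\<Sum>r | flows (n r) = 0. G * P * T * W r)"
      by (intro add_mono sum_mono Eact Einact) auto
    also have "\<dots> = C3 * T * A3 + card {r. 0 < flows (n r)} * (2 * G * P * T * Z)
        + G * P * T * (\<Sum>r | flows (n r) = 0. W r)"
      by (simp add: A3_def sum.distrib sum_distrib_left)
    also have "\<dots> \<le> C3 * T * A3 + C1 * T * A1 + C2 * T * A2"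
    proof (intro add_mono order_refl)
      have Z0: "0 \<le> Z" unfolding Z_def using \<pi>0 by (intro sum_nonneg) auto
      have "real (card {r. 0 < flows (n r)}) * (2 * G * P * T * Z) \<le> real (CARD('r)) * (2 * G * P * T * (A1 / g))"
        using A1Z g(1) G(1) P(1) T0 Z0
        by (intro mult_mono mult_left_mono) (auto simp: card_mono field_simps)
      then show "real (card {r. 0 < flows (n r)}) * (2 * G * P * T * Z) \<le> C1 * T * A1"
        by (simp add: C1_def mult_ac)
      have "G * P * T * (\<Sum>r | flows (n r) = 0. W r) \<le> G * P * T * (A2 / m)"
        using A2W m(1) G(1) P(1) T0 by (intro mult_left_mono) (auto simp: field_simps)
      then show "G * P * T * (\<Sum>r | flows (n r) = 0. W r) \<le> C2 * T * A2"
        by (simp add: C2_def mult_ac)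
    qed
    also have "\<dots> = T * (C1 * A1 + C2 * A2 + C3 * A3)" by (simp add: algebra_simps)
    also have "\<dots> \<le> T * (C * ((A1 + A2) / 2 + c0 * A3))"
    proof (intro mult_left_mono T0)
      have "C * ((A1 + A2) / 2 + c0 * A3) = (C1 + C2 + C3 / (2 * c0)) * (A1 + A2) + (2 * c0 * C1 + 2 * c0 * C2 + C3) * A3"
        using c0(1) by (simp add: C_def field_simps)
      moreover have "(C1 + C2 + C3 / (2 * c0)) * (A1 + A2) \<ge> (C1 + C2) * (A1 + A2)"
        using A1 A2 C123 c0(1) by (intro mult_right_mono) auto
      moreover have "(2 * c0 * C1 + 2 * c0 * C2 + C3) * A3 \<ge> C3 * A3"
        using A3 C123 c0(1) by (intro mult_right_mono) auto
      moreover have "(C1 + C2) * (A1 + A2) = C1 * A1 + C2 * A2 + (C1 * A2 + C2 * A1)"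
        by (simp add: algebra_simps)
      moreover have "0 \<le> C1 * A2 + C2 * A1" using A1 A2 C123 by simp
      ultimately show "C1 * A1 + C2 * A2 + C3 * A3 \<le> C * ((A1 + A2) / 2 + c0 * A3)" by linarith
    qed
    also have "\<dots> \<le> T * (C * - form (vals n) (drift \<theta> n))"
      using N C0 T0 by (intro mult_left_mono) auto
    finally have "sq (dev n \<alpha>)
        \<le> C * total n * - form (vals n) (drift (1 - \<epsilon>) n)" by (simp add: T_def \<theta>_def mult_ac)
    moreover have "\<forall>l. 0 \<le> \<alpha> l" using \<pi>0 \<theta> by (simp add: \<alpha>_def)
    ultimately show ?thesis by blast
  qed
  with C0 show ?thesis using that by blast
qed

end

section \<open>Projection onto the cone\<close>

lemma minv_carrier:
  assumes "class_D p S"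
  shows "minv (- S) \<in> carrier_mat (dim_row S) (dim_row S)"
proof -
  obtain cnt \<nu> where E: "erlang_mixture (dim_row S) cnt \<nu> (\<lambda>i. p $ i)"
    and S: "S \<in> carrier_mat (dim_row S) (dim_row S)"
    and S_eq: "\<And>i j. i < dim_row S \<Longrightarrow> j < dim_row S \<Longrightarrow> S $$ (i, j) = erlang_mixture.S cnt \<nu> i j"
    by (rule class_D_erlang_mixture[OF assms]) blast
  show ?thesis by (simp add: erlang_mixture.minv_index[OF E S S_eq])
qed

context heavy_traffic
begin

lemma form_diff_le:
  "form (\<lambda>r i. y r i - z r i) (\<lambda>r i. y r i - z r i) \<le> 2 * form y y + 2 * form z z"
proof -
  have "form (\<lambda>r i. - 1 * z r i) (\<lambda>r i. - 1 * z r i) = form z z"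
    using form_scale[of "\<lambda>r i. - 1 * z r i" "- 1" z] form_scale[of z "- 1" z]
      form_commute[of "\<lambda>r i. - 1 * z r i" z] by simp
  then have "form (\<lambda>r i. y r i - z r i) (\<lambda>r i. y r i - z r i) = form y y - 2 * form y z + form z z"
    using form_add_sq[of y "\<lambda>r i. - 1 * z r i"] form_scale[of y "- 1" z] by simp
  moreover have "0 \<le> form y y + 2 * form y z + form z z"
    using form_nonneg[of "\<lambda>r i. y r i + z r i"] by (simp add: form_add_sq)
  ultimately show ?thesis by linarith
qed

text \<open>Nonnegative coefficients cannot cancel, and every critical link lies on some route
  because its load equals a positive capacity. So bounded cone points have bounded
  coefficients.\<close>

lemma cvec_lower:
  obtains G where "0 < G" "\<And>\<alpha> l. (\<And>l. l \<in> Ls \<Longrightarrow> 0 \<le> \<alpha> l) \<Longrightarrow> l \<in> Ls \<Longrightarrow> G * (\<alpha> l)\<^sup>2 \<le> sq (cvec \<alpha>)"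
proof -
  have "0 < lam r / \<kappa> r * PF r (ld r) (ld r)" for r
    using lam_pos[of r] \<kappa>_pos[of r] PF_ld_pos[of r] by simp
  then obtain G where G: "0 < G" "\<And>r. G \<le> lam r / \<kappa> r * PF r (ld r) (ld r)"
    using finite_positive_lower_bound[of UNIV "\<lambda>r. lam r / \<kappa> r * PF r (ld r) (ld r)"] by (metis UNIV_I finite)
  have "G * (\<alpha> l)\<^sup>2 \<le> sq (cvec \<alpha>)"
    if \<alpha>: "\<And>l. l \<in> Ls \<Longrightarrow> 0 \<le> \<alpha> l" and l: "l \<in> Ls" for \<alpha> l
  proof -
    define s where "s r = (\<Sum>l\<in>route net r \<inter> Ls. \<alpha> l)" for r
    have "{r. l \<in> route net r} \<noteq> {}"
    proof
      assume "{r. l \<in> route net r} = {}"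
      then have "(\<Sum>r | l \<in> route net r. \<rho> r) = 0" by (simp only: sum.empty)
      with Ls_load[OF l] C_pos[of l] show False by linarith
    qed
    then obtain r where r: "l \<in> route net r" by blast
    have PFc: "\<kappa> r / lam r * PF r (cvec \<alpha> r) (cvec \<alpha> r) = (lam r / \<kappa> r * PF r (ld r) (ld r)) * (s r)\<^sup>2" for r
    proof -
      have "PF r (cvec \<alpha> r) (cvec \<alpha> r) = PF r (\<lambda>i. 0 - (- (lam r / \<kappa> r * s r)) * ld r i) (\<lambda>i. 0 - (- (lam r / \<kappa> r * s r)) * ld r i)"
        by (rule phase_form_cong) (simp_all add: cvec_def s_def)
      also have "\<dots> = (lam r / \<kappa> r * s r)\<^sup>2 * PF r (ld r) (ld r)"
        unfolding phase_form_diff_scaled[OF class_D_net] by (simp add: PF_zero_left)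
      finally show ?thesis using \<kappa>_pos[of r] lam_pos[of r] by (simp add: power2_eq_square field_simps)
    qed
    have "\<alpha> l \<le> s r" unfolding s_def using r l \<alpha> by (intro member_le_sum) auto
    then have "(\<alpha> l)\<^sup>2 \<le> (s r)\<^sup>2" using \<alpha>[OF l] by (intro power_mono)
    then have "G * (\<alpha> l)\<^sup>2 \<le> (lam r / \<kappa> r * PF r (ld r) (ld r)) * (s r)\<^sup>2"
      by (intro mult_mono G(2) order_trans[OF less_imp_le[OF G(1)] G(2)] zero_le_power2)
    also have "\<dots> \<le> (\<Sum>r\<in>UNIV. \<kappa> r / lam r * PF r (cvec \<alpha> r) (cvec \<alpha> r))"
      unfolding PFc[of r, symmetric]
      by (rule member_le_sum[of r UNIV "\<lambda>r. \<kappa> r / lam r * PF r (cvec \<alpha> r) (cvec \<alpha> r)"])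
        (auto intro!: mult_nonneg_nonneg phase_form_nonneg[OF class_D_net] less_imp_le[OF kl_pos] simp del: times_divide_eq_left)
    finally show ?thesis by (simp add: form_def)
  qed
  with G(1) show ?thesis using that by blast
qed

lemma cvec_0: "cvec (\<lambda>_. 0) r i = 0"
  by (simp add: cvec_def)

lemma cvec_continuous:
  "continuous_on X (\<lambda>v. form (\<lambda>r i. y r i - cvec (vec_nth v) r i) (\<lambda>r i. y r i - cvec (vec_nth v) r i))"
proof -
  have "form (\<lambda>r i. y r i - cvec (vec_nth v) r i) (\<lambda>r i. y r i - cvec (vec_nth v) r i)
      = (\<Sum>r\<in>UNIV. \<kappa> r / lam r * (PF r (y r) (y r)
        - 2 * (lam r / \<kappa> r * (\<Sum>l\<in>route net r \<inter> Ls. vec_nth v l)) * PF r (y r) (ld r)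
        + (lam r / \<kappa> r * (\<Sum>l\<in>route net r \<inter> Ls. vec_nth v l))\<^sup>2 * PF r (ld r) (ld r)))" for v
    by (simp only: form_def cvec_def phase_form_diff_scaled[OF class_D_net])
  then show ?thesis by (simp only:) (intro continuous_intros)
qed

text \<open>The minimum is taken over coefficients. A cone point at least as close to y as the apex
  has norm at most twice that of y, so by \<open>cvec_lower\<close> its coefficients lie in a
  compact box.\<close>

lemma nearest_exists:
  obtains \<alpha> where "\<And>l. 0 \<le> \<alpha> l"
    "\<And>\<beta>. (\<And>l. l \<in> Ls \<Longrightarrow> 0 \<le> \<beta> l) \<Longrightarrow> form (\<lambda>r i. y r i - cvec \<alpha> r i) (\<lambda>r i. y r i - cvec \<alpha> r i)
      \<le> form (\<lambda>r i. y r i - cvec \<beta> r i) (\<lambda>r i. y r i - cvec \<beta> r i)"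
proof -
  define \<Phi> where "\<Phi> \<beta> = form (\<lambda>r i. y r i - cvec \<beta> r i) (\<lambda>r i. y r i - cvec \<beta> r i)" for \<beta>
  obtain G where G: "0 < G" "\<And>\<alpha> l. (\<And>l. l \<in> Ls \<Longrightarrow> 0 \<le> \<alpha> l) \<Longrightarrow> l \<in> Ls \<Longrightarrow> G * (\<alpha> l)\<^sup>2 \<le> sq (cvec \<alpha>)"
    by (rule cvec_lower) blast
  define B where "B = sqrt (4 * form y y / G)"
  have B0: "0 \<le> B" using G(1) form_nonneg[of y] by (simp add: B_def)
  have \<Phi>0: "\<Phi> (\<lambda>_. 0) = form y y" by (simp add: \<Phi>_def cvec_0)
  define X :: "(real ^ 'l) set" where "X = cbox 0 (\<chi> l. B)"
  have zX: "0 \<in> X" using B0 by (simp add: X_def mem_box_cart)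
  have "compact X" by (simp add: X_def)
  moreover have "continuous_on X (\<lambda>v. \<Phi> (vec_nth v))" unfolding \<Phi>_def by (rule cvec_continuous)
  ultimately obtain v where v: "v \<in> X" "\<And>u. u \<in> X \<Longrightarrow> \<Phi> (vec_nth v) \<le> \<Phi> (vec_nth u)"
    using continuous_attains_inf[of X] zX by blast
  have "\<Phi> (vec_nth v) \<le> \<Phi> \<beta>" if \<beta>: "\<And>l. l \<in> Ls \<Longrightarrow> 0 \<le> \<beta> l" for \<beta>
  proof (cases "\<Phi> \<beta> \<le> form y y")
    case True
    \<comment> \<open>\<open>cvec\<close> ignores coefficients outside \<open>Ls\<close>; setting
      them to 0 places the point in the box.\<close>
    define u :: "real ^ 'l" where "u = (\<chi> l. if l \<in> Ls then \<beta> l else 0)"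
    have cu: "cvec (vec_nth u) = cvec \<beta>" by (auto simp: cvec_def u_def fun_eq_iff intro!: sum.cong)
    have "\<beta> l \<le> B" if l: "l \<in> Ls" for l
    proof -
      have "G * (\<beta> l)\<^sup>2 \<le> sq (cvec \<beta>)" by (rule G(2)[OF \<beta> l])
      also have "\<dots> = form (\<lambda>r i. y r i - (y r i - cvec \<beta> r i)) (\<lambda>r i. y r i - (y r i - cvec \<beta> r i))" by simp
      also have "\<dots> \<le> 2 * form y y + 2 * \<Phi> \<beta>" unfolding \<Phi>_def by (rule form_diff_le)
      also have "\<dots> \<le> 4 * form y y" using True by simp
      finally have "(\<beta> l)\<^sup>2 \<le> 4 * form y y / G" using G(1) by (simp add: field_simps)
      then show ?thesis unfolding B_def by (rule real_le_rsqrt)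
    qed
    then have "u \<in> X" using \<beta> B0 by (auto simp: X_def mem_box_cart u_def)
    from v(2)[OF this] show ?thesis by (simp add: \<Phi>_def cu)
  next
    case False
    have "\<Phi> (vec_nth v) \<le> \<Phi> (vec_nth 0)" by (rule v(2)[OF zX])
    also have "\<Phi> (vec_nth 0) = form y y" unfolding \<Phi>0[symmetric] by (rule arg_cong[of _ _ \<Phi>]) auto
    finally show ?thesis using False by simp
  qed
  moreover have "0 \<le> vec_nth v l" for l using v(1) by (simp add: X_def mem_box_cart)
  ultimately show ?thesis using that[of "vec_nth v"] by (simp add: \<Phi>_def)
qed

definition cone_pt :: "('l \<Rightarrow> real) \<Rightarrow> 'r \<Rightarrow> real Matrix.vec" where
  "cone_pt \<alpha> = (\<lambda>r. Matrix.vec (phases net r) (\<lambda>k. \<Sum>l \<in> Ls. \<alpha> l * cone_gen net l r $ k))"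

lemma cone_pt_index:
  assumes "k < K r"
  shows "cone_pt \<alpha> r $ k = cvec \<alpha> r k"
proof -
  have "dim_vec (transpose_mat (minv (- gen net r)) *\<^sub>v init net r) = K r"
    using minv_carrier[OF class_D_net[of r]] by simp
  then have cg: "cone_gen net l r $ k = of_bool (l \<in> route net r) / \<kappa> r * (lam r * ld r k)" for l
    using assms by (simp add: cone_gen_def load_vec_def load0_def del: index_mult_mat_vec dim_mult_mat_vec)
  have "cone_pt \<alpha> r $ k = (\<Sum>l\<in>Ls. if l \<in> route net r then lam r / \<kappa> r * \<alpha> l * ld r k else 0)"
    using assms by (simp add: cone_pt_def phases_def cg) (intro sum.cong, auto)
  also have "\<dots> = (\<Sum>l\<in>Ls \<inter> route net r. lam r / \<kappa> r * \<alpha> l * ld r k)"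
    by (rule sum.inter_restrict[symmetric]) simp
  finally show ?thesis by (simp add: cvec_def sum_distrib_left sum_distrib_right Int_commute)
qed

lemma M_inner_form:
  assumes "\<And>r. Y r \<in> carrier_vec (K r)" "\<And>r. Z r \<in> carrier_vec (K r)"
  shows "M_inner net Y Z = form (\<lambda>r i. Y r $ i) (\<lambda>r i. Z r $ i)"
  unfolding M_inner_def form_def
proof (intro sum.cong refl)
  fix r
  have dims: "dim_vec (Y r) = K r" "dim_vec (Z r) = K r" using assms by auto
  have "Y r \<bullet> (M_mat net r *\<^sub>v Z r) = (\<Sum>i<K r. Y r $ i * (\<Sum>j<K r. \<kappa> r / lam r *
      (LINT s:{0..}|lborel. M_integrand (init net r) (gen net r) s $$ (i, j)) * Z r $ j))"
    using dims by (simp add: scalar_prod_def M_mat_def phases_def lessThan_atLeast0)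
  also have "\<dots> = \<kappa> r / lam r * PF r (\<lambda>i. Y r $ i) (\<lambda>i. Z r $ i)"
    by (simp add: phase_form_def sum_distrib_left mult_ac)
  finally show "Y r \<bullet> (M_mat net r *\<^sub>v Z r) = \<kappa> r / lam r * PF r (\<lambda>i. Y r $ i) (\<lambda>i. Z r $ i)" .
qed

lemma M_norm_cone_pt:
  assumes n: "n \<in> states net"
  shows "M_norm net (\<lambda>r. real_state n r - cone_pt \<alpha> r)
    = sqrt (sq (dev n \<alpha>))"
proof -
  have c: "real_state n r - cone_pt \<alpha> r \<in> carrier_vec (K r)" for r
    by (intro carrier_vecI) (simp add: cone_pt_def phases_def)
  have "(real_state n r - cone_pt \<alpha> r) $ i = vals n r i - cvec \<alpha> r i" if "i < K r" for r i
    using that dim_state[OF n, of r] cone_pt_index[OF that]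
    by (simp add: real_state_def cone_pt_def phases_def del: index_minus_vec) (simp add: cone_pt_def phases_def)
  then have "form (\<lambda>r i. (real_state n r - cone_pt \<alpha> r) $ i) (\<lambda>r i. (real_state n r - cone_pt \<alpha> r) $ i)
    = sq (dev n \<alpha>)"
    by (intro form_cong) auto
  then show ?thesis unfolding M_norm_def M_inner_form[OF c c] by simp
qed

text \<open>\<open>ARG_MIN\<close> returns a minimizer once one exists, which
  \<open>nearest_exists\<close> provides. From here on the distance is used only through some
  optimal coefficients and its minimality.\<close>

lemma perp_norm:
  assumes n: "n \<in> states net"
  obtains \<alpha> where "0 \<le> M_norm net (perp net Ls (real_state n))" "\<And>l. l \<in> Ls \<Longrightarrow> 0 \<le> \<alpha> l"
    "(M_norm net (perp net Ls (real_state n)))\<^sup>2 = sq (dev n \<alpha>)"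
    "\<And>\<beta>. (\<And>l. l \<in> Ls \<Longrightarrow> 0 \<le> \<beta> l) \<Longrightarrow> (M_norm net (perp net Ls (real_state n)))\<^sup>2
      \<le> sq (dev n \<beta>)"
proof -
  define \<Phi> where "\<Phi> \<beta> = sq (dev n \<beta>)" for \<beta>
  define f where "f z = M_norm net (\<lambda>r. real_state n r - z r)" for z
  have cone: "z \<in> cone_of net Ls \<longleftrightarrow> (\<exists>\<beta>. (\<forall>l\<in>Ls. 0 \<le> \<beta> l) \<and> z = cone_pt \<beta>)" for z
    by (auto simp: cone_of_def cone_pt_def)
  have f: "f (cone_pt \<beta>) = sqrt (\<Phi> \<beta>)" for \<beta> unfolding f_def \<Phi>_def by (rule M_norm_cone_pt[OF n])
  obtain a where a: "\<And>l. 0 \<le> a l" "\<And>\<beta>. (\<And>l. l \<in> Ls \<Longrightarrow> 0 \<le> \<beta> l) \<Longrightarrow> \<Phi> a \<le> \<Phi> \<beta>"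
    unfolding \<Phi>_def by (rule nearest_exists[of "vals n"]) blast
  have "is_arg_min f (\<lambda>z. z \<in> cone_of net Ls) (cone_pt a)"
  proof -
    have "cone_pt a \<in> cone_of net Ls" unfolding cone by (intro exI[of _ a] conjI ballI a(1) refl)
    moreover have "\<not> f z < f (cone_pt a)" if z: "z \<in> cone_of net Ls" for z
    proof -
      obtain \<beta> where "\<forall>l\<in>Ls. 0 \<le> \<beta> l" "z = cone_pt \<beta>" using z unfolding cone by (elim exE conjE)
      then show ?thesis using a(2)[of \<beta>] by (simp add: f not_less)
    qed
    ultimately show ?thesis unfolding is_arg_min_def by (intro conjI notI; (elim exE conjE)?) simp_all
  qed
  then have "is_arg_min f (\<lambda>z. z \<in> cone_of net Ls) (par net Ls (real_state n))"
    unfolding par_def arg_min_def f_def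
    by (rule someI[of "is_arg_min (\<lambda>z. M_norm net (\<lambda>r. real_state n r - z r)) (\<lambda>z. z \<in> cone_of net Ls)" "cone_pt a"])
  then have "par net Ls (real_state n) \<in> cone_of net Ls"
    and min: "\<And>z. z \<in> cone_of net Ls \<Longrightarrow> \<not> f z < f (par net Ls (real_state n))"
    by (simp_all add: is_arg_min_def)
  then obtain \<alpha> where \<alpha>: "\<forall>l\<in>Ls. 0 \<le> \<alpha> l" "par net Ls (real_state n) = cone_pt \<alpha>"
    unfolding cone by (elim exE conjE)
  have eq: "M_norm net (perp net Ls (real_state n)) = sqrt (\<Phi> \<alpha>)"
    using f[of \<alpha>] by (simp add: perp_def f_def \<alpha>(2))
  have sq: "(M_norm net (perp net Ls (real_state n)))\<^sup>2 = \<Phi> \<alpha>"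
    unfolding eq by (simp add: \<Phi>_def form_nonneg)
  show ?thesis
  proof (rule that[of \<alpha>])
    show "0 \<le> M_norm net (perp net Ls (real_state n))" unfolding eq by (simp add: \<Phi>_def form_nonneg)
    fix \<beta> :: "'l \<Rightarrow> real" assume "\<And>l. l \<in> Ls \<Longrightarrow> 0 \<le> \<beta> l"
    then have "cone_pt \<beta> \<in> cone_of net Ls" unfolding cone by (intro exI[of _ \<beta>] conjI ballI refl)
    from min[OF this] have "\<Phi> \<alpha> \<le> \<Phi> \<beta>" by (simp add: \<alpha>(2) f)
    then show "(M_norm net (perp net Ls (real_state n)))\<^sup>2
      \<le> sq (dev n \<beta>)" unfolding sq by (simp add: \<Phi>_def)
  qed (use \<alpha>(1) sq in \<open>auto simp: \<Phi>_def\<close>)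
qed

section \<open>Jumps of the flow count process\<close>

text \<open>A transition \<open>(r, k1, k2)\<close> moves a flow on route \<open>r\<close> from phase \<open>k1\<close> to phase \<open>k2\<close>, where
  the number of phases stands for the outside of the network.\<close>

definition events :: "('r \<times> nat \<times> nat) set" where
  "events = (SIGMA r:UNIV. {..<Suc (K r)} \<times> {..<Suc (K r)})"

fun erate :: "real \<Rightarrow> 'r \<times> nat \<times> nat \<Rightarrow> ('r \<Rightarrow> nat Matrix.vec) \<Rightarrow> real" where
  "erate \<theta> (r, k1, k2) n =
    (if k1 = K r then (if k2 = K r then 0 else \<theta> * lam r * init net r $ k2)
     else if k2 = K r then vals n r k1 * x n r * (\<Sum>k'<K r. (- gen net r) $$ (k1, k'))
     else if k1 = k2 then 0 else vals n r k1 * x n r * gen net r $$ (k1, k2))"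

fun etgt :: "'r \<times> nat \<times> nat \<Rightarrow> ('r \<Rightarrow> nat Matrix.vec) \<Rightarrow> 'r \<Rightarrow> nat Matrix.vec" where
  "etgt (r, k1, k2) n =
    (if k1 = K r then add_flow n r k2 else if k2 = K r then remove_flow n r k1
     else add_flow (remove_flow n r k1) r k2)"

text \<open>At a phase \<open>i < K r\<close> the outside index \<open>K r\<close> never matches, so
  arrivals and departures change one entry only.\<close>

fun inc :: "'r \<times> nat \<times> nat \<Rightarrow> 'r \<Rightarrow> nat \<Rightarrow> real" where
  "inc (r, k1, k2) r' i = (if r' = r then of_bool (i = k2) - of_bool (i = k1) else 0)"

lemma finite_events: "finite events"
  by (simp add: events_def)

lemma sum_events:
  fixes f :: "'r \<times> nat \<times> nat \<Rightarrow> real"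
  shows "sum f events = (\<Sum>r\<in>UNIV. (\<Sum>k1<K r. (\<Sum>k2<K r. f (r, k1, k2)) + f (r, k1, K r))
    + (\<Sum>k2<K r. f (r, K r, k2)) + f (r, K r, K r))"
proof -
  have "sum f events = (\<Sum>r\<in>UNIV. \<Sum>k1<Suc (K r). \<Sum>k2<Suc (K r). f (r, k1, k2))"
    unfolding events_def sum.cartesian_product
    using sum.Sigma[of UNIV "\<lambda>r. {..<Suc (K r)} \<times> {..<Suc (K r)}" "\<lambda>r y. f (r, y)"]
    by (simp add: case_prod_beta' del: sum.lessThan_Suc)
  then show ?thesis by (simp add: add.assoc)
qed

lemma flow_rate_eq:
  assumes n: "n \<in> states net"
  shows "flow_rate net x \<epsilon> n n' = (\<Sum>j\<in>events. erate (1 - \<epsilon>) j n * of_bool (n' = etgt j n))"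
  unfolding flow_rate_def sum_events
proof (intro sum.cong refl)
  fix r
  have move: "(\<Sum>k2\<in>{..<K r} - {k1}. real (n r $ k1) * x n r * gen net r $$ (k1, k2)
         * of_bool (n' = add_flow (remove_flow n r k1) r k2))
      = (\<Sum>k2<K r. erate (1 - \<epsilon>) (r, k1, k2) n * of_bool (n' = etgt (r, k1, k2) n))" if "k1 < K r" for k1
    using that by (intro sum.mono_neutral_cong_left) auto
  show "(\<Sum>k<phases net r. (1 - \<epsilon>) * lam r * init net r $ k * of_bool (n' = add_flow n r k)) +
     (\<Sum>k1<phases net r. \<Sum>k2\<in>{..<phases net r} - {k1}. real (n r $ k1) * x n r * gen net r $$ (k1, k2)
         * of_bool (n' = add_flow (remove_flow n r k1) r k2)) +
     (\<Sum>k<phases net r. real (n r $ k) * x n r * (\<Sum>k'<phases net r. (- gen net r) $$ (k, k')) * of_bool (n' = remove_flow n r k))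
    = (\<Sum>k1<K r. (\<Sum>k2<K r. erate (1 - \<epsilon>) (r, k1, k2) n * of_bool (n' = etgt (r, k1, k2) n))
        + erate (1 - \<epsilon>) (r, k1, K r) n * of_bool (n' = etgt (r, k1, K r) n))
      + (\<Sum>k2<K r. erate (1 - \<epsilon>) (r, K r, k2) n * of_bool (n' = etgt (r, K r, k2) n))
      + erate (1 - \<epsilon>) (r, K r, K r) n * of_bool (n' = etgt (r, K r, K r) n)"
  proof -
    have 1: "(\<Sum>k<K r. (1 - \<epsilon>) * lam r * init net r $ k * of_bool (n' = add_flow n r k))
        = (\<Sum>k2<K r. erate (1 - \<epsilon>) (r, K r, k2) n * of_bool (n' = etgt (r, K r, k2) n))"
      by (intro sum.cong) auto
    have 2: "(\<Sum>k<K r. real (n r $ k) * x n r * (\<Sum>k'<K r. (- gen net r) $$ (k, k')) * of_bool (n' = remove_flow n r k))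
        = (\<Sum>k1<K r. erate (1 - \<epsilon>) (r, k1, K r) n * of_bool (n' = etgt (r, k1, K r) n))"
      by (intro sum.cong) auto
    have 3: "(\<Sum>k1<K r. \<Sum>k2\<in>{..<K r} - {k1}. real (n r $ k1) * x n r * gen net r $$ (k1, k2)
         * of_bool (n' = add_flow (remove_flow n r k1) r k2))
        = (\<Sum>k1<K r. \<Sum>k2<K r. erate (1 - \<epsilon>) (r, k1, k2) n * of_bool (n' = etgt (r, k1, k2) n))"
      by (rule sum.cong[OF refl], rule move) simp
    have 4: "erate (1 - \<epsilon>) (r, K r, K r) n = 0" by simp
    show ?thesis unfolding phases_def 1 2 3 4 by (simp only: sum.distrib)
  qed
qed

lemma erate_nonneg:
  assumes n: "n \<in> states net" and j: "j \<in> events" and \<theta>: "0 \<le> \<theta>"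
  shows "0 \<le> erate \<theta> j n"
proof -
  obtain r k1 k2 where j': "j = (r, k1, k2)" "k1 \<le> K r" "k2 \<le> K r" using j by (auto simp: events_def less_Suc_eq_le)
  have "0 \<le> x n r" by (rule alloc_nonneg[OF net wpf n])
  then show ?thesis
    using j'(2,3) \<theta> lam_pos[of r] class_D_carrier(3)[OF class_D_net[of r], of k2]
      gen_off_diag_nonneg[OF class_D_net[of r], of k1 k2] gen_exit_nonneg[OF class_D_net[of r], of k1]
    by (auto simp: j'(1) intro!: mult_nonneg_nonneg)
qed

lemma add_flow_states:
  assumes "n \<in> states net"
  shows "add_flow n r k \<in> states net"
  unfolding states_def add_flow_def using dim_state[OF assms]
  by (intro CollectI allI carrier_vecI) (simp add: phases_def)

lemma remove_flow_states:
  assumes "n \<in> states net"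
  shows "remove_flow n r k \<in> states net"
  unfolding states_def remove_flow_def using dim_state[OF assms]
  by (intro CollectI allI carrier_vecI) (simp add: phases_def)

lemma etgt_states:
  assumes "n \<in> states net"
  shows "etgt j n \<in> states net"
  by (cases j) (simp add: assms add_flow_states remove_flow_states)

text \<open>A nonzero rate out of phase \<open>k1\<close> forces a flow to be there, so the
  truncated subtraction in \<open>remove_flow\<close> is exact.\<close>

lemma vals_etgt:
  assumes n: "n \<in> states net" and j: "j \<in> events" and nz: "erate \<theta> j n \<noteq> 0" and i: "i < K r"
  shows "vals (etgt j n) r i = vals n r i + inc j r i"
proof -
  obtain r' k1 k2 where j': "j = (r', k1, k2)" "k1 \<le> K r'" "k2 \<le> K r'" using j by (auto simp: events_def less_Suc_eq_le)
  have pos: "0 < n r' $ k1" if "k1 \<noteq> K r'" using nz that by (auto simp: j'(1) split: if_splits)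
  show ?thesis
    using nz pos i j'(2,3) dim_state[OF n, of r']
    by (auto simp: j'(1) add_flow_def remove_flow_def of_nat_diff split: if_splits)
qed

lemma sum_erate_inc:
  assumes i: "i < K r"
  shows "(\<Sum>j\<in>events. erate \<theta> j n * inc j r i) = drift \<theta> n r i"
proof -
  define S where "S k k' = gen net r $$ (k, k')" for k k'
  define w where "w k = vals n r k * x n r" for k
  have dims: "dim_col (gen net r) = K r"
    by (rule carrier_matD(2)[OF class_D_carrier(1)[OF class_D_net]])
  have out: "(\<Sum>k'<K r. (- gen net r) $$ (k, k')) = - (\<Sum>k'<K r. S k k')" if "k < K r" for k
    using that dims by (simp add: S_def sum_negf)
  have delta: "(\<Sum>k<K r. f k * of_bool (i = k)) = f i" for f :: "nat \<Rightarrow> real"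
  proof -
    have "(\<Sum>k<K r. f k * of_bool (i = k)) = (\<Sum>k<K r. if i = k then f k else 0)"
      by (intro sum.cong) auto
    then show ?thesis using i by simp
  qed
  have "(\<Sum>j\<in>events. erate \<theta> j n * inc j r i)
      = (\<Sum>r'\<in>UNIV. if r' = r then (\<Sum>k1<K r. (\<Sum>k2<K r. erate \<theta> (r, k1, k2) n * inc (r, k1, k2) r i)
          + erate \<theta> (r, k1, K r) n * inc (r, k1, K r) r i)
        + (\<Sum>k2<K r. erate \<theta> (r, K r, k2) n * inc (r, K r, k2) r i) else 0)"
    unfolding sum_events by (intro sum.cong) (auto simp del: erate.simps)
  also have "\<dots> = (\<Sum>k1<K r. (\<Sum>k2<K r. erate \<theta> (r, k1, k2) n * inc (r, k1, k2) r i)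
          + erate \<theta> (r, k1, K r) n * inc (r, k1, K r) r i)
        + (\<Sum>k2<K r. erate \<theta> (r, K r, k2) n * inc (r, K r, k2) r i)"
    by simp
  also have "(\<Sum>k2<K r. erate \<theta> (r, K r, k2) n * inc (r, K r, k2) r i)
      = (\<Sum>k2<K r. \<theta> * lam r * init net r $ k2 * of_bool (i = k2))"
    using i by (intro sum.cong) auto
  also have "\<dots> = \<theta> * lam r * init net r $ i" by (rule delta)
  also have "(\<Sum>k1<K r. (\<Sum>k2<K r. erate \<theta> (r, k1, k2) n * inc (r, k1, k2) r i)
          + erate \<theta> (r, k1, K r) n * inc (r, k1, K r) r i) = (\<Sum>k1<K r. w k1 * S k1 i)"
  proof (rule sum.cong[OF refl])
    fix k1 assume "k1 \<in> {..<K r}"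
    then have k1: "k1 < K r" by simp
    \<comment> \<open>The loss terms of the moves add up to a row sum of S; the departures cancel
      it, because exit rates are minus the row sums.\<close>
    have "(\<Sum>k2<K r. erate \<theta> (r, k1, k2) n * inc (r, k1, k2) r i)
        = (\<Sum>k2<K r. w k1 * S k1 k2 * of_bool (i = k2) - w k1 * of_bool (i = k1) * S k1 k2)"
      using k1 by (intro sum.cong) (auto simp: w_def S_def)
    also have "\<dots> = w k1 * S k1 i - w k1 * of_bool (i = k1) * (\<Sum>k2<K r. S k1 k2)"
      unfolding sum_subtractf delta sum_distrib_left ..
    finally show "(\<Sum>k2<K r. erate \<theta> (r, k1, k2) n * inc (r, k1, k2) r i)
          + erate \<theta> (r, k1, K r) n * inc (r, k1, K r) r i = w k1 * S k1 i"
      using k1 i by (simp add: out w_def)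
  qed
  finally show ?thesis
    by (simp add: drift_def phase_drift_def w_def S_def sum_distrib_left mult_ac)
qed

lemma sum_erate_form:
  "(\<Sum>j\<in>events. erate \<theta> j n * form z (inc j)) = form z (drift \<theta> n)"
proof -
  have "(\<Sum>j\<in>events. erate \<theta> j n * form z (inc j)) = form z (\<lambda>r i. \<Sum>j\<in>events. erate \<theta> j n * inc j r i)"
    by (subst form_sum[OF finite_events]) (simp add: form_scale)
  also have "\<dots> = form z (drift \<theta> n)" by (intro form_cong refl sum_erate_inc)
  finally show ?thesis .
qed

text \<open>A rate out of a phase is at most the throughput of its route times a matrix entry or a
  row sum, and throughputs are bounded by capacities.\<close>

lemma erate_bounded:
  obtains \<Lambda> where "0 < \<Lambda>" "\<And>n \<theta>. n \<in> states net \<Longrightarrow> 0 \<le> \<theta> \<Longrightarrow> \<theta> \<le> 1 \<Longrightarrow> (\<Sum>j\<in>events. erate \<theta> j n) \<le> \<Lambda>"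
proof -
  obtain Y where Y: "0 < Y" "\<And>n r. n \<in> states net \<Longrightarrow> thr n r \<le> Y" by (rule throughput_bound) blast
  define A where "A = (\<lambda>(r, k1, k2). lam r * \<bar>init net r $ k2\<bar>
    + Y * (\<bar>\<Sum>k'<K r. (- gen net r) $$ (k1, k')\<bar> + \<bar>gen net r $$ (k1, k2)\<bar>))"
  have A0: "0 \<le> A j" for j using lam_pos Y(1) by (cases j) (auto simp: A_def less_imp_le intro!: add_nonneg_nonneg)
  have "erate \<theta> j n \<le> A j" if n: "n \<in> states net" and \<theta>: "0 \<le> \<theta>" "\<theta> \<le> 1" and j: "j \<in> events" for n \<theta> j
  proof -
    obtain r k1 k2 where j': "j = (r, k1, k2)" "k1 \<le> K r" "k2 \<le> K r" using j by (auto simp: events_def less_Suc_eq_le)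
    have X: "0 \<le> x n r" by (rule alloc_nonneg[OF net wpf n])
    have w: "0 \<le> vals n r k1 * x n r \<and> vals n r k1 * x n r \<le> Y" if "k1 < K r"
    proof -
      have "vals n r k1 \<le> (\<Sum>i<K r. vals n r i)" using that by (intro member_le_sum) auto
      then have "vals n r k1 * x n r \<le> thr n r" using X vals_sum[OF n, of r] by (intro mult_right_mono) auto
      with Y(2)[OF n, of r] X show ?thesis by auto
    qed
    have le: "a * c \<le> Y * \<bar>c\<bar>" if "0 \<le> a \<and> a \<le> Y" for a c
    proof -
      have "a * c \<le> a * \<bar>c\<bar>" using that by (intro mult_left_mono) auto
      also have "\<dots> \<le> Y * \<bar>c\<bar>" using that by (intro mult_right_mono) auto
      finally show ?thesis .
    qed
    have t: "\<theta> * lam r * init net r $ k2 \<le> lam r * \<bar>init net r $ k2\<bar>"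
    proof -
      have "\<theta> * (lam r * init net r $ k2) \<le> \<theta> * (lam r * \<bar>init net r $ k2\<bar>)"
        using \<theta> lam_pos[of r] by (intro mult_left_mono) auto
      also have "\<dots> \<le> 1 * (lam r * \<bar>init net r $ k2\<bar>)"
        using \<theta> lam_pos[of r] by (intro mult_right_mono) auto
      finally show ?thesis by (simp add: mult_ac)
    qed
    have nn: "0 \<le> lam r * \<bar>init net r $ k2\<bar>" "0 \<le> Y * \<bar>\<Sum>k'<K r. (- gen net r) $$ (k1, k')\<bar>" "0 \<le> Y * \<bar>gen net r $$ (k1, k2)\<bar>"
      using lam_pos[of r] Y(1) by auto
    consider "k1 = K r" "k2 = K r" | "k1 = K r" "k2 \<noteq> K r" | "k1 \<noteq> K r" "k2 = K r"
      | "k1 \<noteq> K r" "k2 \<noteq> K r" "k1 = k2" | "k1 \<noteq> K r" "k2 \<noteq> K r" "k1 \<noteq> k2" by blast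
    then show ?thesis
    proof cases
      case 2
      have "erate \<theta> j n = \<theta> * lam r * init net r $ k2" using 2 by (simp add: j'(1))
      then show ?thesis using t nn by (simp add: j'(1) A_def distrib_left)
    next
      case 3
      have "erate \<theta> j n = vals n r k1 * x n r * (\<Sum>k'<K r. (- gen net r) $$ (k1, k'))" using 3 by (simp add: j'(1))
      also have "\<dots> \<le> Y * \<bar>\<Sum>k'<K r. (- gen net r) $$ (k1, k')\<bar>" using 3 j'(2) by (intro le w) simp
      finally show ?thesis using nn unfolding j'(1) A_def distrib_left prod.case by linarith
    next
      case 5
      have "erate \<theta> j n = vals n r k1 * x n r * gen net r $$ (k1, k2)" using 5 by (simp add: j'(1))
      also have "\<dots> \<le> Y * \<bar>gen net r $$ (k1, k2)\<bar>" using 5 j'(2) by (intro le w) simp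
      finally show ?thesis using nn unfolding j'(1) A_def distrib_left prod.case by linarith
    qed (use A0[of j] in \<open>simp_all add: j'(1)\<close>)
  qed
  then have "(\<Sum>j\<in>events. erate \<theta> j n) \<le> 1 + sum A events" if "n \<in> states net" "0 \<le> \<theta>" "\<theta> \<le> 1" for n \<theta>
    using that sum_mono[of events "\<lambda>j. erate \<theta> j n" A] by fastforce
  moreover have "0 < 1 + sum A events" by (intro add_pos_nonneg sum_nonneg A0) simp
  ultimately show ?thesis using that by blast
qed

lemma countable_states: "countable (states net)"
proof (rule countable_image_inj_on)
  show "countable ((\<lambda>n r. list_of_vec (n r)) ` states net)" by simp
  show "inj_on (\<lambda>n r. list_of_vec (n r)) (states net)"
    by (intro inj_onI ext) (metis vec_list)
qed

end

section \<open>Moments in equilibrium\<close>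

text \<open>The split is at t = M / \<epsilon>: beyond it the higher power wins in spite of its
  factor \<epsilon>, below it 1 + t is at most 2 M / \<epsilon>.\<close>

lemma poly_absorb:
  fixes A c \<epsilon> t :: real
  assumes c: "0 < c" and A: "0 \<le> A"
  obtains B where "0 \<le> B"
    "\<And>\<epsilon> t. 0 < \<epsilon> \<Longrightarrow> \<epsilon> \<le> 1 \<Longrightarrow> 0 \<le> t \<Longrightarrow> A * (1 + t) ^ j \<le> c * \<epsilon> * t ^ Suc j + B * (1 / \<epsilon>) ^ j"
proof
  define M where "M = max 1 (A * 2 ^ j / c)"
  have M: "1 \<le> M" "A * 2 ^ j \<le> c * M" using c by (auto simp: M_def field_simps max_def)
  show "0 \<le> A * (2 * M) ^ j" using A M by simp
  fix \<epsilon> t :: real assume \<epsilon>: "0 < \<epsilon>" "\<epsilon> \<le> 1" and t: "0 \<le> t"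
  show "A * (1 + t) ^ j \<le> c * \<epsilon> * t ^ Suc j + A * (2 * M) ^ j * (1 / \<epsilon>) ^ j"
  proof (cases "M / \<epsilon> \<le> t")
    case True
    have "1 \<le> M / \<epsilon>" using M(1) \<epsilon> by (simp add: field_simps)
    then have t1: "1 \<le> t" using True by linarith
    have "A * (1 + t) ^ j \<le> A * (2 * t) ^ j" using A t1 by (intro mult_left_mono power_mono) auto
    also have "\<dots> = (A * 2 ^ j) * t ^ j" by (simp add: power_mult_distrib)
    also have "\<dots> \<le> (c * M) * t ^ j" using M(2) t by (intro mult_right_mono) auto
    also have "\<dots> \<le> (c * (\<epsilon> * t)) * t ^ j"
      using True \<epsilon> c t by (intro mult_right_mono mult_left_mono) (auto simp: field_simps)
    also have "\<dots> = c * \<epsilon> * t ^ Suc j" by simp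
    also have "\<dots> \<le> \<dots> + A * (2 * M) ^ j * (1 / \<epsilon>) ^ j" using A M(1) \<epsilon> by simp
    finally show ?thesis .
  next
    case False
    have "1 \<le> M / \<epsilon>" using M(1) \<epsilon> by (simp add: field_simps)
    then have "1 + t \<le> 2 * M * (1 / \<epsilon>)" using False by simp
    then have "A * (1 + t) ^ j \<le> A * (2 * M * (1 / \<epsilon>)) ^ j" using A t by (intro mult_left_mono power_mono) auto
    also have "\<dots> = A * (2 * M) ^ j * (1 / \<epsilon>) ^ j" by (simp only: power_mult_distrib mult.assoc)
    also have "\<dots> \<le> c * \<epsilon> * t ^ Suc j + \<dots>" using c \<epsilon> t by simp
    finally show ?thesis .
  qed
qed

text \<open>The analogue for dissipation divided by v. The split is at u of order v (1 + v); below
  it 1 + u is at most a multiple of (1 + v)^2, whence the exponent 2k + 1.\<close>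

lemma ratio_absorb:
  fixes A c :: real
  assumes c: "0 < c" and A: "0 \<le> A"
  obtains B where "0 \<le> B"
    "\<And>u v. 0 \<le> u \<Longrightarrow> 0 < v \<Longrightarrow> A * (1 + u) ^ k * (1 + v) \<le> c * u ^ Suc k / v + B * (1 + v) ^ (2 * k + 1)"
proof
  define M where "M = 2 ^ k * A / c"
  have M: "0 \<le> M" "2 ^ k * A = c * M" using c A by (auto simp: M_def)
  show "0 \<le> A * (2 + M) ^ k" using A M by simp
  fix u v :: real assume u: "0 \<le> u" and v: "0 < v"
  show "A * (1 + u) ^ k * (1 + v) \<le> c * u ^ Suc k / v + A * (2 + M) ^ k * (1 + v) ^ (2 * k + 1)"
  proof (cases "1 \<le> u \<and> M * (v * (1 + v)) \<le> u")
    case True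
    have "A * (1 + u) ^ k * (1 + v) \<le> A * (2 * u) ^ k * (1 + v)"
      using True A v by (intro mult_right_mono mult_left_mono power_mono) auto
    also have "\<dots> = (2 ^ k * A) * (u ^ k * (1 + v))" by (simp add: power_mult_distrib mult_ac)
    also have "\<dots> = c * u ^ k * (M * (v * (1 + v))) / v" unfolding M(2) using v by simp
    also have "\<dots> \<le> c * u ^ k * u / v" using True c u v by (intro divide_right_mono mult_left_mono) auto
    also have "\<dots> \<le> c * u ^ Suc k / v + A * (2 + M) ^ k * (1 + v) ^ (2 * k + 1)"
    proof -
      have "0 \<le> A * (2 + M) ^ k * (1 + v) ^ (2 * k + 1)" using A M(1) v by simp
      moreover have "c * u ^ k * u / v = c * u ^ Suc k / v" by (simp add: mult_ac)
      ultimately show ?thesis by linarith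
    qed
    finally show ?thesis .
  next
    case False
    have v2: "v * (1 + v) \<le> (1 + v)\<^sup>2" "1 \<le> (1 + v)\<^sup>2" using v by (auto simp: power2_eq_square algebra_simps)
    have "u \<le> 1 + M * (v * (1 + v))"
    proof (cases "1 \<le> u")
      case True
      then show ?thesis using False by linarith
    next
      case False
      moreover have "0 \<le> M * (v * (1 + v))" using M(1) v by simp
      ultimately show ?thesis by linarith
    qed
    also have "\<dots> \<le> 1 + M * (1 + v)\<^sup>2" using M(1) v2 by (intro add_mono mult_left_mono) auto
    finally have "1 + u \<le> (2 + M) * (1 + v)\<^sup>2" using v2(2) by (simp add: distrib_right)
    then have "A * (1 + u) ^ k * (1 + v) \<le> A * ((2 + M) * (1 + v)\<^sup>2) ^ k * (1 + v)"
      using A u v by (intro mult_right_mono mult_left_mono power_mono) auto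
    also have "\<dots> = A * (2 + M) ^ k * (1 + v) ^ (2 * k + 1)"
      by (simp add: power_mult_distrib power_mult power_add mult.assoc)
    also have "\<dots> \<le> c * u ^ Suc k / v + \<dots>" using c u v by simp
    finally show ?thesis .
  qed
qed

context heavy_traffic
begin

definition dist2 :: "('r \<Rightarrow> nat Matrix.vec) \<Rightarrow> real" where
  "dist2 n = (M_norm net (perp net Ls (real_state n)))\<^sup>2"

text \<open>The cone point stays fixed during the jump. The choice of zero coefficients covers the
  squared norm of the state itself.\<close>

lemma form_etgt:
  assumes "n \<in> states net" "j \<in> events" "erate \<theta> j n \<noteq> 0"
  shows "sq (dev (etgt j n) \<alpha>)
    = sq (dev n \<alpha>)
      + 2 * form (dev n \<alpha>) (inc j) + sq (inc j)"
proof -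
  have "sq (dev (etgt j n) \<alpha>)
      = form (\<lambda>r i. (vals n r i - cvec \<alpha> r i) + inc j r i) (\<lambda>r i. (vals n r i - cvec \<alpha> r i) + inc j r i)"
    by (intro form_cong) (simp_all add: vals_etgt[OF assms])
  then show ?thesis by (simp only: form_add_sq)
qed

lemma inc_bound:
  obtains A where "0 \<le> A" "\<And>j. j \<in> events \<Longrightarrow> sq (inc j) \<le> A"
  using finite_positive_upper_bound[OF finite_events, of "\<lambda>j. sq (inc j)"] by (metis less_imp_le)

lemma inc_cross_bound:
  assumes "sq (inc j) \<le> A"
  shows "(form y (inc j))\<^sup>2 \<le> A * form y y"
proof -
  have "(form y (inc j))\<^sup>2 \<le> form y y * sq (inc j)" by (rule form_Cauchy_Schwarz)
  also have "\<dots> \<le> form y y * A" using assms form_nonneg[of y] by (rule mult_left_mono)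
  finally show ?thesis by (simp add: mult.commute)
qed

context
  fixes N :: "real \<Rightarrow> ('r \<Rightarrow> nat Matrix.vec) pmf"
  assumes stat: "\<And>\<epsilon>. 0 < \<epsilon> \<Longrightarrow> \<epsilon> < 1 \<Longrightarrow>
    stationary_distribution (states net) (flow_rate net x \<epsilon>) (N \<epsilon>)"
begin

lemma supp_states: "0 < \<epsilon> \<Longrightarrow> \<epsilon> < 1 \<Longrightarrow> set_pmf (N \<epsilon>) \<subseteq> states net"
  using stat[of \<epsilon>] by (simp add: stationary_distribution_def)

lemma comparison:
  assumes \<epsilon>: "0 < \<epsilon>" "\<epsilon> < 1"
    and "\<And>n. n \<in> states net \<Longrightarrow> 0 \<le> V n" "\<And>n. n \<in> states net \<Longrightarrow> 0 \<le> g n" "\<And>n. n \<in> states net \<Longrightarrow> 0 \<le> b n"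
    and "\<And>n. n \<in> states net \<Longrightarrow> (\<Sum>j\<in>events. erate (1 - \<epsilon>) j n * (V (etgt j n) - V n)) \<le> b n - g n"
  shows "(\<integral>\<^sup>+n. ennreal (g n) \<partial>N \<epsilon>) \<le> (\<integral>\<^sup>+n. ennreal (b n) \<partial>N \<epsilon>)"
proof -
  obtain \<Lambda> where \<Lambda>: "\<And>n \<theta>. n \<in> states net \<Longrightarrow> 0 \<le> \<theta> \<Longrightarrow> \<theta> \<le> 1 \<Longrightarrow> (\<Sum>j\<in>events. erate \<theta> j n) \<le> \<Lambda>"
    by (rule erate_bounded) blast
  show ?thesis
    by (rule stationary_drift_comparison[OF stat[OF \<epsilon>] countable_states finite_events,
      where rate = "erate (1 - \<epsilon>)" and tgt = etgt and V = V and \<Lambda> = \<Lambda>])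
      (use assms in \<open>auto intro: erate_nonneg etgt_states \<Lambda> simp: flow_rate_eq\<close>)
qed

text \<open>The Lyapunov function is the power k + 1 of the squared norm. Its drift is of order -
  \<epsilon> |n|^(2k+1) up to terms of order |n|^(2k), so odd moments come out.\<close>

lemma total_moment:
  obtains B where "0 \<le> B" "\<And>\<epsilon>. 0 < \<epsilon> \<Longrightarrow> \<epsilon> \<le> 1 / 2 \<Longrightarrow>
    (\<integral>\<^sup>+n. ennreal ((\<epsilon> * total n) ^ (2 * k + 1)) \<partial>N \<epsilon>) \<le> ennreal B"
proof -
  obtain c where c: "0 < c" "\<And>n \<epsilon>. n \<in> states net \<Longrightarrow> 0 < \<epsilon> \<Longrightarrow> \<epsilon> \<le> 1 / 2 \<Longrightarrow>
    form (vals n) (drift (1 - \<epsilon>) n) \<le> - c * \<epsilon> * total n" by (rule form_drift_linear) blast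
  obtain c1 where c1: "0 < c1" "\<And>n. n \<in> states net \<Longrightarrow> c1 * (total n)\<^sup>2 \<le> sq (vals n)"
    by (rule form_lower) blast
  obtain C1 where C1: "0 < C1" "\<And>n. n \<in> states net \<Longrightarrow> sq (vals n) \<le> C1 * (total n)\<^sup>2"
    by (rule form_upper) blast
  obtain A where A: "0 \<le> A" "\<And>j. j \<in> events \<Longrightarrow> sq (inc j) \<le> A" by (rule inc_bound) blast
  obtain \<Lambda> where \<Lambda>: "0 < \<Lambda>" "\<And>n \<theta>. n \<in> states net \<Longrightarrow> 0 \<le> \<theta> \<Longrightarrow> \<theta> \<le> 1 \<Longrightarrow> (\<Sum>j\<in>events. erate \<theta> j n) \<le> \<Lambda>"
    by (rule erate_bounded) blast
  define E where "E = (6 + 20 * A + 4 * A\<^sup>2) ^ Suc k * \<Lambda>"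
  define H where "H = (real (Suc k) * (A * \<Lambda>) + E) * (1 + C1) ^ k"
  have E0: "0 \<le> E" using A \<Lambda> by (simp add: E_def)
  have H0: "0 \<le> H" using E0 A \<Lambda> C1 by (simp add: H_def)
  define d where "d = real (Suc k) * c1 ^ k * c"
  have d: "0 < d" using c c1 by (simp add: d_def)
  obtain B where B: "0 \<le> B" "\<And>\<epsilon> t. 0 < \<epsilon> \<Longrightarrow> \<epsilon> \<le> 1 \<Longrightarrow> 0 \<le> t \<Longrightarrow>
      H * (1 + t) ^ (2 * k) \<le> d * \<epsilon> * t ^ Suc (2 * k) + B * (1 / \<epsilon>) ^ (2 * k)"
    by (rule poly_absorb[OF d H0, of "2 * k"]) blast
  have "(\<integral>\<^sup>+n. ennreal ((\<epsilon> * total n) ^ (2 * k + 1)) \<partial>N \<epsilon>) \<le> ennreal (B / d)"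
    if \<epsilon>: "0 < \<epsilon>" "\<epsilon> \<le> 1 / 2" for \<epsilon>
  proof -
    have dr: "(\<Sum>j\<in>events. erate (1 - \<epsilon>) j n * (sq (vals (etgt j n)) ^ Suc k - sq (vals n) ^ Suc k))
        \<le> B * (1 / \<epsilon>) ^ (2 * k) - d * \<epsilon> * total n ^ Suc (2 * k)" if n: "n \<in> states net" for n
    proof -
      define F where "F = sq (vals n)"
      have F0: "0 \<le> F" unfolding F_def by (rule form_nonneg)
      have T0: "0 \<le> total n" by (rule total_nonneg)
      have "(\<Sum>j\<in>events. erate (1 - \<epsilon>) j n * (sq (vals (etgt j n)) ^ Suc k - F ^ Suc k))
          \<le> real (Suc k) * F ^ (Suc k - 1) * (2 * (- c * \<epsilon> * total n) + A * \<Lambda>)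
             + (6 + 20 * A + 4 * A\<^sup>2) ^ Suc k * \<Lambda> * (1 + F) ^ (Suc k - 1)"
      proof (rule power_drift[where l = "\<lambda>j. form (vals n) (inc j)"])
        show "0 \<le> erate (1 - \<epsilon>) j n" if "j \<in> events" for j using n that \<epsilon> by (intro erate_nonneg) auto
        show "(\<Sum>j\<in>events. erate (1 - \<epsilon>) j n) \<le> \<Lambda>" using \<epsilon> by (intro \<Lambda>(2) n) auto
        show "0 \<le> sq (vals (etgt j n)) \<and> sq (vals (etgt j n))
            \<le> F + 2 * form (vals n) (inc j) + A" if "j \<in> events" "erate (1 - \<epsilon>) j n \<noteq> 0" for j
          using form_etgt[OF n that, of "\<lambda>_. 0", unfolded cvec_0 diff_0_right] A(2)[OF that(1)]
            form_nonneg[of "vals (etgt j n)"] unfolding F_def by (intro conjI; linarith)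
        show "(form (vals n) (inc j))\<^sup>2 \<le> A * F" if "j \<in> events" for j
          unfolding F_def by (rule inc_cross_bound[OF A(2)[OF that]])
        show "(\<Sum>j\<in>events. erate (1 - \<epsilon>) j n * form (vals n) (inc j)) \<le> - c * \<epsilon> * total n"
          unfolding sum_erate_form by (rule c(2)[OF n \<epsilon>])
      qed (use A F0 in auto)
      also have "\<dots> = (real (Suc k) * (A * \<Lambda>)) * F ^ k + E * (1 + F) ^ k - 2 * (real (Suc k) * c * \<epsilon> * total n * F ^ k)"
        by (simp add: E_def algebra_simps)
      also have "\<dots> \<le> (real (Suc k) * (A * \<Lambda>)) * (1 + F) ^ k + E * (1 + F) ^ k - 2 * (d * \<epsilon> * total n ^ Suc (2 * k))"
      proof -
        have "F ^ k \<le> (1 + F) ^ k" using F0 by (intro power_mono) auto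
        then have 1: "(real (Suc k) * (A * \<Lambda>)) * F ^ k \<le> (real (Suc k) * (A * \<Lambda>)) * (1 + F) ^ k"
          using A \<Lambda> by (intro mult_left_mono) auto
        have "(c1 * (total n)\<^sup>2) ^ k \<le> F ^ k" unfolding F_def using c1 n by (intro power_mono) auto
        then have "real (Suc k) * c * \<epsilon> * total n * (c1 * (total n)\<^sup>2) ^ k \<le> real (Suc k) * c * \<epsilon> * total n * F ^ k"
          using c(1) \<epsilon> T0 by (intro mult_left_mono) auto
        also have "real (Suc k) * c * \<epsilon> * total n * (c1 * (total n)\<^sup>2) ^ k = d * \<epsilon> * total n ^ Suc (2 * k)"
          by (simp add: d_def power_mult_distrib mult_ac flip: power_mult)
        finally show ?thesis using 1 by linarith
      qed
      also have "(real (Suc k) * (A * \<Lambda>)) * (1 + F) ^ k + E * (1 + F) ^ k \<le> H * (1 + total n) ^ (2 * k)"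
      proof -
        have "1 + F \<le> (1 + C1) * (1 + total n)\<^sup>2"
        proof -
          have "(total n)\<^sup>2 \<le> (1 + total n)\<^sup>2" using T0 by (intro power_mono) auto
          then have "C1 * (total n)\<^sup>2 \<le> C1 * (1 + total n)\<^sup>2" using C1(1) by (intro mult_left_mono) auto
          moreover have "1 \<le> (1 + total n)\<^sup>2" using T0 by (simp add: power2_eq_square algebra_simps)
          ultimately show ?thesis using C1(2)[OF n] by (simp add: F_def distrib_right)
        qed
        then have "(1 + F) ^ k \<le> ((1 + C1) * (1 + total n)\<^sup>2) ^ k" using F0 by (intro power_mono) auto
        then have "(real (Suc k) * (A * \<Lambda>) + E) * (1 + F) ^ k
            \<le> (real (Suc k) * (A * \<Lambda>) + E) * ((1 + C1) * (1 + total n)\<^sup>2) ^ k"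
          using A \<Lambda> E0 by (intro mult_left_mono) auto
        also have "\<dots> = H * (1 + total n) ^ (2 * k)" by (simp add: H_def power_mult_distrib mult_ac flip: power_mult)
        finally show ?thesis by (simp add: distrib_right)
      qed
      \<comment> \<open>The lower-order terms use up one of the two copies of the dissipation; the
        other remains for the comparison.\<close>
      also have "H * (1 + total n) ^ (2 * k) \<le> d * \<epsilon> * total n ^ Suc (2 * k) + B * (1 / \<epsilon>) ^ (2 * k)"
        using \<epsilon> T0 by (intro B(2)) auto
      finally have "(\<Sum>j\<in>events. erate (1 - \<epsilon>) j n * (sq (vals (etgt j n)) ^ Suc k - F ^ Suc k))
          \<le> d * \<epsilon> * total n ^ Suc (2 * k) + B * (1 / \<epsilon>) ^ (2 * k) - 2 * (d * \<epsilon> * total n ^ Suc (2 * k))"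
        by this linarith+
      then show ?thesis unfolding F_def by linarith
    qed
    have "(\<integral>\<^sup>+n. ennreal (d * \<epsilon> * total n ^ Suc (2 * k)) \<partial>N \<epsilon>) \<le> (\<integral>\<^sup>+n. ennreal (B * (1 / \<epsilon>) ^ (2 * k)) \<partial>N \<epsilon>)"
      by (rule comparison[where V = "\<lambda>n. sq (vals n) ^ Suc k"])
        (use \<epsilon> d B(1) total_nonneg form_nonneg dr in auto)
    then have le: "(\<integral>\<^sup>+n. ennreal (d * \<epsilon> * total n ^ Suc (2 * k)) \<partial>N \<epsilon>) \<le> ennreal (B * (1 / \<epsilon>) ^ (2 * k))"
      by simp
    have "(\<integral>\<^sup>+n. ennreal ((\<epsilon> * total n) ^ (2 * k + 1)) \<partial>N \<epsilon>)
        = (\<integral>\<^sup>+n. ennreal (\<epsilon> ^ (2 * k) / d) * ennreal (d * \<epsilon> * total n ^ Suc (2 * k)) \<partial>N \<epsilon>)"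
      using \<epsilon> d total_nonneg
      by (intro nn_integral_cong) (simp add: ennreal_mult[symmetric] power_mult_distrib mult_ac)
    also have "\<dots> = ennreal (\<epsilon> ^ (2 * k) / d) * (\<integral>\<^sup>+n. ennreal (d * \<epsilon> * total n ^ Suc (2 * k)) \<partial>N \<epsilon>)"
      by (rule nn_integral_cmult) simp
    also have "\<dots> \<le> ennreal (\<epsilon> ^ (2 * k) / d) * ennreal (B * (1 / \<epsilon>) ^ (2 * k))"
      by (intro mult_left_mono le) simp
    also have "\<dots> = ennreal (B / d)"
      using \<epsilon> d B(1) by (simp add: ennreal_mult[symmetric] power_one_over)
    finally show ?thesis .
  qed
  moreover have "0 \<le> B / d" using B(1) d by simp
  ultimately show ?thesis using that by blast
qed

text \<open>The displacement from the nearest point is the state minus a cone point. The state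
  contributes the dissipation of \<open>form_drift_quadratic\<close>, by minimality of the distance;
  the cone point costs at most \<epsilon> times its coefficients, which are linear in the number of
  flows.\<close>

lemma dist2_properties:
  obtains c C where "0 < c" "0 < C"
    "\<And>n \<epsilon>. n \<in> states net \<Longrightarrow> 0 < \<epsilon> \<Longrightarrow> \<epsilon> \<le> 1 / 2 \<Longrightarrow> \<exists>\<alpha>. (\<forall>l\<in>Ls. 0 \<le> \<alpha> l) \<and>
      dist2 n = sq (dev n \<alpha>) \<and>
      form (dev n \<alpha>) (drift (1 - \<epsilon>) n) \<le> C * \<epsilon> * total n - c * dist2 n / (1 + total n)"
    "\<And>n \<beta>. n \<in> states net \<Longrightarrow> (\<And>l. l \<in> Ls \<Longrightarrow> 0 \<le> \<beta> l) \<Longrightarrow>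
      dist2 n \<le> sq (dev n \<beta>)"
proof -
  obtain K1 where K1: "0 < K1" "\<And>n \<epsilon>. n \<in> states net \<Longrightarrow> 0 < \<epsilon> \<Longrightarrow> \<epsilon> \<le> 1 / 2 \<Longrightarrow>
    \<exists>\<alpha>. (\<forall>l. 0 \<le> \<alpha> l) \<and>
      sq (dev n \<alpha>)
        \<le> K1 * total n * - form (vals n) (drift (1 - \<epsilon>) n)" by (rule form_drift_quadratic) blast
  obtain c0 where c0: "0 < c0" "\<And>n \<epsilon>. n \<in> states net \<Longrightarrow> 0 < \<epsilon> \<Longrightarrow> \<epsilon> \<le> 1 / 2 \<Longrightarrow>
    form (vals n) (drift (1 - \<epsilon>) n) \<le> - c0 * \<epsilon> * total n" by (rule form_drift_linear) blast
  obtain G where G: "0 < G" "\<And>\<alpha> l. (\<And>l. l \<in> Ls \<Longrightarrow> 0 \<le> \<alpha> l) \<Longrightarrow> l \<in> Ls \<Longrightarrow> G * (\<alpha> l)\<^sup>2 \<le> sq (cvec \<alpha>)"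
    by (rule cvec_lower) blast
  obtain C1 where C1: "0 < C1" "\<And>n. n \<in> states net \<Longrightarrow> sq (vals n) \<le> C1 * (total n)\<^sup>2"
    by (rule form_upper) blast
  \<comment> \<open>The nearest point has squared norm at most four times that of the state, so
    \<open>cvec_lower\<close> bounds its coefficients by \<open>R * total n\<close>.\<close>
  define R where "R = sqrt (4 * C1 / G)"
  have R0: "0 < R" using C1(1) G(1) by (simp add: R_def)
  define C where "C = 1 + (\<Sum>l\<in>Ls. R * capacity net l)"
  have C0: "0 < C" unfolding C_def using R0 C_pos by (intro add_pos_nonneg sum_nonneg) (auto simp: less_imp_le)
  have min: "dist2 n \<le> sq (dev n \<beta>)"
    if "n \<in> states net" "\<And>l. l \<in> Ls \<Longrightarrow> 0 \<le> \<beta> l" for n \<beta>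
    unfolding dist2_def by (rule perp_norm[OF that(1)]) (use that(2) in blast)
  have ex: "\<exists>\<alpha>. (\<forall>l\<in>Ls. 0 \<le> \<alpha> l) \<and>
      dist2 n = sq (dev n \<alpha>) \<and>
      form (dev n \<alpha>) (drift (1 - \<epsilon>) n) \<le> C * \<epsilon> * total n - 1 / K1 * dist2 n / (1 + total n)"
    if n: "n \<in> states net" and \<epsilon>: "0 < \<epsilon>" "\<epsilon> \<le> 1 / 2" for n \<epsilon>
  proof -
    have T0: "0 \<le> total n" by (rule total_nonneg)
    obtain \<alpha> where \<alpha>: "\<And>l. l \<in> Ls \<Longrightarrow> 0 \<le> \<alpha> l"
      "dist2 n = sq (dev n \<alpha>)"
      unfolding dist2_def by (rule perp_norm[OF n]) blast
    have d_le: "dist2 n \<le> sq (vals n)"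
      using min[OF n, of "\<lambda>_. 0"] by (simp add: cvec_0)
    have \<alpha>_le: "\<alpha> l \<le> R * total n" if l: "l \<in> Ls" for l
    proof -
      have "G * (\<alpha> l)\<^sup>2 \<le> sq (cvec \<alpha>)" by (rule G(2)[OF \<alpha>(1) l])
      also have "\<dots> = form (\<lambda>r i. vals n r i - (vals n r i - cvec \<alpha> r i)) (\<lambda>r i. vals n r i - (vals n r i - cvec \<alpha> r i))" by simp
      also have "\<dots> \<le> 2 * sq (vals n) + 2 * dist2 n" unfolding \<alpha>(2) by (rule form_diff_le)
      also have "\<dots> \<le> 4 * (C1 * (total n)\<^sup>2)" using d_le C1(2)[OF n] by linarith
      finally have "(\<alpha> l)\<^sup>2 \<le> 4 * C1 / G * (total n)\<^sup>2" using G(1) by (simp add: field_simps)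
      then have "\<alpha> l \<le> sqrt (4 * C1 / G * (total n)\<^sup>2)" by (rule real_le_rsqrt)
      also have "sqrt (4 * C1 / G * (total n)\<^sup>2) = R * total n"
        unfolding R_def real_sqrt_mult using T0 by simp
      finally show ?thesis .
    qed
    have "- (C * \<epsilon> * total n) \<le> form (cvec \<alpha>) (drift (1 - \<epsilon>) n)"
    proof -
      have "(\<Sum>l\<in>Ls. \<alpha> l * capacity net l) \<le> (\<Sum>l\<in>Ls. (R * total n) * capacity net l)"
        using \<alpha>_le C_pos by (intro sum_mono mult_right_mono) (auto simp: less_imp_le)
      also have "\<dots> = (C - 1) * total n" by (simp add: C_def sum_distrib_left sum_distrib_right mult_ac)
      also have "\<dots> \<le> C * total n" using T0 by (simp add: algebra_simps)
      finally have "\<epsilon> * (\<Sum>l\<in>Ls. \<alpha> l * capacity net l) \<le> \<epsilon> * (C * total n)" using \<epsilon> by (intro mult_left_mono) auto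
      with form_cvec_drift_ge[OF n, of \<alpha> \<epsilon>] \<alpha>(1) show ?thesis by (simp add: mult_ac)
    qed
    moreover have "form (vals n) (drift (1 - \<epsilon>) n) \<le> - (1 / K1 * dist2 n / (1 + total n))"
    proof -
      define Nn where "Nn = - form (vals n) (drift (1 - \<epsilon>) n)"
      have "0 \<le> c0 * \<epsilon> * total n" using c0(1) \<epsilon> T0 by simp
      then have N0: "0 \<le> Nn" using c0(2)[OF n \<epsilon>] by (simp add: Nn_def)
      obtain \<beta> where \<beta>: "\<forall>l. 0 \<le> \<beta> l" "sq (dev n \<beta>)
          \<le> K1 * total n * Nn" using K1(2)[OF n \<epsilon>] unfolding Nn_def by blast
      have "dist2 n \<le> K1 * total n * Nn" using min[OF n, of \<beta>] \<beta> by simp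
      \<comment> \<open>The summand 1 avoids division by zero in the empty network.\<close>
      also have "\<dots> \<le> K1 * (1 + total n) * Nn" using K1(1) N0 T0 by (intro mult_right_mono) auto
      finally have "1 / K1 * dist2 n / (1 + total n) \<le> Nn"
        using K1(1) T0 by (simp add: divide_le_eq mult_ac add_pos_nonneg)
      then show ?thesis by (simp add: Nn_def)
    qed
    moreover have "form (dev n \<alpha>) (drift (1 - \<epsilon>) n)
        = form (vals n) (drift (1 - \<epsilon>) n) - form (cvec \<alpha>) (drift (1 - \<epsilon>) n)"
      using form_diff[of "drift (1 - \<epsilon>) n" "vals n" "cvec \<alpha>"] by (simp only: form_commute[of _ "drift (1 - \<epsilon>) n"])
    ultimately have "form (dev n \<alpha>) (drift (1 - \<epsilon>) n)
        \<le> C * \<epsilon> * total n - 1 / K1 * dist2 n / (1 + total n)" by linarith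
    then show ?thesis using \<alpha> by blast
  qed
  have "0 < 1 / K1" using K1(1) by simp
  from that[OF this C0 ex min] show ?thesis by blast
qed

text \<open>The power k + 1 of \<open>dist2\<close> is scaled by only \<epsilon>^k, since one power
  is lost in the drift. In u and v the drift is bounded by a multiple of (1 + u)^k (1 + v) minus a
  multiple of u^(k+1) / v, to which \<open>ratio_absorb\<close> applies.\<close>

lemma dist2_moment:
  obtains B where "0 \<le> B" "\<And>\<epsilon>. 0 < \<epsilon> \<Longrightarrow> \<epsilon> \<le> 1 / 2 \<Longrightarrow>
    (\<integral>\<^sup>+n. ennreal ((\<epsilon> * dist2 n) ^ Suc k / (\<epsilon> * (1 + total n))) \<partial>N \<epsilon>) \<le> ennreal B"
    "\<And>\<epsilon>. 0 < \<epsilon> \<Longrightarrow> \<epsilon> \<le> 1 / 2 \<Longrightarrow>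
    (\<integral>\<^sup>+n. ennreal ((1 + \<epsilon> * (1 + total n)) ^ (2 * k + 1)) \<partial>N \<epsilon>) \<le> ennreal B"
proof -
  obtain c C where c: "0 < c" and C: "0 < C" and
    ex: "\<And>n \<epsilon>. n \<in> states net \<Longrightarrow> 0 < \<epsilon> \<Longrightarrow> \<epsilon> \<le> 1 / 2 \<Longrightarrow> \<exists>\<alpha>. (\<forall>l\<in>Ls. 0 \<le> \<alpha> l) \<and>
      dist2 n = sq (dev n \<alpha>) \<and>
      form (dev n \<alpha>) (drift (1 - \<epsilon>) n) \<le> C * \<epsilon> * total n - c * dist2 n / (1 + total n)" and
    min: "\<And>n \<beta>. n \<in> states net \<Longrightarrow> (\<And>l. l \<in> Ls \<Longrightarrow> 0 \<le> \<beta> l) \<Longrightarrow>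
      dist2 n \<le> sq (dev n \<beta>)"
    by (rule dist2_properties) blast
  obtain A where A: "0 \<le> A" "\<And>j. j \<in> events \<Longrightarrow> sq (inc j) \<le> A" by (rule inc_bound) blast
  obtain \<Lambda> where \<Lambda>: "0 < \<Lambda>" "\<And>n \<theta>. n \<in> states net \<Longrightarrow> 0 \<le> \<theta> \<Longrightarrow> \<theta> \<le> 1 \<Longrightarrow> (\<Sum>j\<in>events. erate \<theta> j n) \<le> \<Lambda>"
    by (rule erate_bounded) blast
  define s where "s = real (Suc k)"
  define E where "E = (6 + 20 * A + 4 * A\<^sup>2) ^ Suc k * \<Lambda>"
  define H where "H = s * (2 * C + A * \<Lambda>) + E"
  have s0: "0 < s" by (simp add: s_def)
  have E0: "0 \<le> E" using A \<Lambda> by (simp add: E_def)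
  have H0: "0 \<le> H" using E0 A \<Lambda> C s0 by (simp add: H_def)
  have sc: "0 < s * c" using s0 c by simp
  obtain B where B: "0 \<le> B" "\<And>u v. 0 \<le> u \<Longrightarrow> 0 < v \<Longrightarrow>
      H * (1 + u) ^ k * (1 + v) \<le> s * c * u ^ Suc k / v + B * (1 + v) ^ (2 * k + 1)"
    by (rule ratio_absorb[OF sc H0, of k]) blast
  obtain B2 where B2: "0 \<le> B2" "\<And>\<epsilon>. 0 < \<epsilon> \<Longrightarrow> \<epsilon> \<le> 1 / 2 \<Longrightarrow>
    (\<integral>\<^sup>+n. ennreal ((\<epsilon> * total n) ^ (2 * k + 1)) \<partial>N \<epsilon>) \<le> ennreal B2" by (rule total_moment[of k]) blast
  \<comment> \<open>From (2 + a)^(2k+1) \<le> 2^(2k+1) (2^(2k+1) + a^(2k+1)) with a = \<epsilon>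
    |n|, by comparing a with 2.\<close>
  define B3 where "B3 = 4 ^ (2 * k + 1) + 2 ^ (2 * k + 1) * B2"
  have B30: "0 \<le> B3" using B2(1) by (simp add: B3_def)
  have vmom: "(\<integral>\<^sup>+n. ennreal ((1 + \<epsilon> * (1 + total n)) ^ (2 * k + 1)) \<partial>N \<epsilon>) \<le> ennreal B3"
    if \<epsilon>: "0 < \<epsilon>" "\<epsilon> \<le> 1 / 2" for \<epsilon>
  proof -
    have "(\<integral>\<^sup>+n. ennreal ((1 + \<epsilon> * (1 + total n)) ^ (2 * k + 1)) \<partial>N \<epsilon>)
        \<le> (\<integral>\<^sup>+n. ennreal (4 ^ (2 * k + 1)) + ennreal (2 ^ (2 * k + 1)) * ennreal ((\<epsilon> * total n) ^ (2 * k + 1)) \<partial>N \<epsilon>)"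
    proof (intro nn_integral_mono)
      fix n
      define a where "a = \<epsilon> * total n"
      have a0: "0 \<le> a" using \<epsilon> total_nonneg by (simp add: a_def)
      have "1 + \<epsilon> * (1 + total n) \<le> 2 + a" using \<epsilon> by (simp add: a_def algebra_simps)
      then have "(1 + \<epsilon> * (1 + total n)) ^ (2 * k + 1) \<le> (2 + a) ^ (2 * k + 1)"
        using \<epsilon> total_nonneg[of n] by (intro power_mono add_nonneg_nonneg mult_nonneg_nonneg) auto
      also have "\<dots> \<le> (2 * max 2 a) ^ (2 * k + 1)" using a0 by (intro power_mono) auto
      also have "\<dots> = 2 ^ (2 * k + 1) * (max 2 a) ^ (2 * k + 1)" by (rule power_mult_distrib)
      also have "(max 2 a) ^ (2 * k + 1) \<le> 2 ^ (2 * k + 1) + a ^ (2 * k + 1)"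
        using a0 by (cases "2 \<le> a") (auto simp: max_def simp del: power_Suc)
      finally have "(1 + \<epsilon> * (1 + total n)) ^ (2 * k + 1) \<le> 2 ^ (2 * k + 1) * (2 ^ (2 * k + 1) + a ^ (2 * k + 1))" by simp
      also have "\<dots> = 4 ^ (2 * k + 1) + 2 ^ (2 * k + 1) * a ^ (2 * k + 1)"
        by (simp only: distrib_left power_mult_distrib[symmetric]) simp
      finally show "ennreal ((1 + \<epsilon> * (1 + total n)) ^ (2 * k + 1))
          \<le> ennreal (4 ^ (2 * k + 1)) + ennreal (2 ^ (2 * k + 1)) * ennreal ((\<epsilon> * total n) ^ (2 * k + 1))"
        using a0 unfolding a_def[symmetric]
        by (simp add: ennreal_mult[symmetric] ennreal_plus[symmetric] del: ennreal_plus power_Suc power_add) 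
    qed
    also have "\<dots> = ennreal (4 ^ (2 * k + 1)) + ennreal (2 ^ (2 * k + 1)) * (\<integral>\<^sup>+n. ennreal ((\<epsilon> * total n) ^ (2 * k + 1)) \<partial>N \<epsilon>)"
      by (subst nn_integral_add) (simp_all add: nn_integral_cmult)
    also have "\<dots> \<le> ennreal (4 ^ (2 * k + 1)) + ennreal (2 ^ (2 * k + 1)) * ennreal B2"
      by (intro add_left_mono mult_left_mono B2(2) \<epsilon>) simp
    also have "\<dots> = ennreal B3"
      using B2(1) by (simp add: B3_def ennreal_mult[symmetric] ennreal_plus[symmetric] del: ennreal_plus power_Suc)
    finally show ?thesis .
  qed
  have umom: "(\<integral>\<^sup>+n. ennreal ((\<epsilon> * dist2 n) ^ Suc k / (\<epsilon> * (1 + total n))) \<partial>N \<epsilon>) \<le> ennreal (B * B3 / (s * c))"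
    if \<epsilon>: "0 < \<epsilon>" "\<epsilon> \<le> 1 / 2" for \<epsilon>
  proof -
    define u where "u n = \<epsilon> * dist2 n" for n
    define v where "v n = \<epsilon> * (1 + total n)" for n
    have D0: "0 \<le> dist2 n" for n by (simp add: dist2_def)
    have u0: "0 \<le> u n" for n using \<epsilon> D0 by (simp add: u_def)
    have v0: "0 < v n" for n using \<epsilon> total_nonneg[of n] by (simp add: v_def)
    have dr: "(\<Sum>j\<in>events. erate (1 - \<epsilon>) j n * (\<epsilon> ^ k * dist2 (etgt j n) ^ Suc k - \<epsilon> ^ k * dist2 n ^ Suc k))
        \<le> B * (1 + v n) ^ (2 * k + 1) - s * c * u n ^ Suc k / v n" if n: "n \<in> states net" for n
    proof -
      define F where "F = dist2 n"
      have F0: "0 \<le> F" by (simp add: F_def D0)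
      obtain \<alpha> where \<alpha>: "\<And>l. l \<in> Ls \<Longrightarrow> 0 \<le> \<alpha> l"
        "F = sq (dev n \<alpha>)"
        "form (dev n \<alpha>) (drift (1 - \<epsilon>) n) \<le> C * \<epsilon> * total n - c * F / (1 + total n)"
        using ex[OF n \<epsilon>] unfolding F_def by blast
      have "(\<Sum>j\<in>events. erate (1 - \<epsilon>) j n * (dist2 (etgt j n) ^ Suc k - F ^ Suc k))
          \<le> real (Suc k) * F ^ (Suc k - 1) * (2 * (C * \<epsilon> * total n - c * F / (1 + total n)) + A * \<Lambda>)
             + (6 + 20 * A + 4 * A\<^sup>2) ^ Suc k * \<Lambda> * (1 + F) ^ (Suc k - 1)"
      proof (rule power_drift[where l = "\<lambda>j. form (dev n \<alpha>) (inc j)"])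
        show "0 \<le> erate (1 - \<epsilon>) j n" if "j \<in> events" for j using n that \<epsilon> by (intro erate_nonneg) auto
        show "(\<Sum>j\<in>events. erate (1 - \<epsilon>) j n) \<le> \<Lambda>" using \<epsilon> by (intro \<Lambda>(2) n) auto
        \<comment> \<open>The old nearest point is a competitor for the new state and bounds the new
          distance from above.\<close>
        show "0 \<le> dist2 (etgt j n) \<and> dist2 (etgt j n)
            \<le> F + 2 * form (dev n \<alpha>) (inc j) + A" if "j \<in> events" "erate (1 - \<epsilon>) j n \<noteq> 0" for j
          using min[of "etgt j n" \<alpha>, OF etgt_states[OF n] \<alpha>(1)] form_etgt[OF n that, of \<alpha>] A(2)[OF that(1)] D0[of "etgt j n"]
          unfolding \<alpha>(2)[symmetric] by (intro conjI; linarith)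
        show "(form (dev n \<alpha>) (inc j))\<^sup>2 \<le> A * F" if "j \<in> events" for j
          unfolding \<alpha>(2) by (rule inc_cross_bound[OF A(2)[OF that]])
        show "(\<Sum>j\<in>events. erate (1 - \<epsilon>) j n * form (dev n \<alpha>) (inc j))
            \<le> C * \<epsilon> * total n - c * F / (1 + total n)"
          unfolding sum_erate_form by (rule \<alpha>(3))
      qed (use A F0 in auto)
      also have "\<dots> = s * (2 * C * (\<epsilon> * total n) + A * \<Lambda>) * F ^ k + E * (1 + F) ^ k - 2 * (s * c * (F ^ Suc k / (1 + total n)))"
        by (simp add: E_def s_def algebra_simps)
      finally have 1: "(\<Sum>j\<in>events. erate (1 - \<epsilon>) j n * (dist2 (etgt j n) ^ Suc k - F ^ Suc k))
        \<le> s * (2 * C * (\<epsilon> * total n) + A * \<Lambda>) * F ^ k + E * (1 + F) ^ k - 2 * (s * c * (F ^ Suc k / (1 + total n)))" .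
      have uF: "\<epsilon> ^ k * F ^ k = u n ^ k" by (simp add: u_def F_def power_mult_distrib)
      have "(\<Sum>j\<in>events. erate (1 - \<epsilon>) j n * (\<epsilon> ^ k * dist2 (etgt j n) ^ Suc k - \<epsilon> ^ k * dist2 n ^ Suc k))
          = \<epsilon> ^ k * (\<Sum>j\<in>events. erate (1 - \<epsilon>) j n * (dist2 (etgt j n) ^ Suc k - F ^ Suc k))"
        unfolding sum_distrib_left F_def by (intro sum.cong) (auto simp: algebra_simps)
      also have "\<dots> \<le> \<epsilon> ^ k * (s * (2 * C * (\<epsilon> * total n) + A * \<Lambda>) * F ^ k + E * (1 + F) ^ k - 2 * (s * c * (F ^ Suc k / (1 + total n))))"
        using 1 \<epsilon> by (intro mult_left_mono) auto
      also have "\<dots> = s * (2 * C * (\<epsilon> * total n) + A * \<Lambda>) * (\<epsilon> ^ k * F ^ k) + E * (\<epsilon> ^ k * (1 + F) ^ k)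
          - 2 * (s * c * (\<epsilon> ^ k * F ^ Suc k / (1 + total n)))"
        by (simp add: algebra_simps)
      \<comment> \<open>The missing factor \<epsilon> of the numerator is supplied by the one
        contained in \<open>v n\<close>.\<close>
      also have "\<epsilon> ^ k * F ^ Suc k / (1 + total n) = u n ^ Suc k / v n"
        using \<epsilon> by (simp add: u_def v_def F_def power_mult_distrib)
      also have "s * (2 * C * (\<epsilon> * total n) + A * \<Lambda>) * (\<epsilon> ^ k * F ^ k) \<le> s * (2 * C + A * \<Lambda>) * (1 + v n) * (1 + u n) ^ k"
      proof -
        have t: "\<epsilon> * total n \<le> v n" using \<epsilon> by (simp add: v_def algebra_simps)
        have "2 * C * (\<epsilon> * total n) + A * \<Lambda> \<le> 2 * C * (1 + v n) + A * \<Lambda> * (1 + v n)"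
          using t C A(1) \<Lambda>(1) v0[of n] by (intro add_mono mult_left_mono) (auto simp: mult_left_le algebra_simps)
        then have "2 * C * (\<epsilon> * total n) + A * \<Lambda> \<le> (2 * C + A * \<Lambda>) * (1 + v n)" by (simp add: distrib_right)
        then have 2: "s * (2 * C * (\<epsilon> * total n) + A * \<Lambda>) \<le> s * (2 * C + A * \<Lambda>) * (1 + v n)"
          using s0 by (simp add: mult.assoc mult_left_mono)
        have "u n ^ k \<le> (1 + u n) ^ k" using u0 by (intro power_mono) auto
        then show ?thesis unfolding uF using s0 C A(1) \<Lambda>(1) v0[of n] u0[of n]
          by (intro mult_mono[OF 2]) auto
      qed
      also have "E * (\<epsilon> ^ k * (1 + F) ^ k) \<le> E * ((1 + u n) ^ k * (1 + v n))"
      proof -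
        have "\<epsilon> ^ k * (1 + F) ^ k = (\<epsilon> + u n) ^ k" by (simp add: power_mult_distrib[symmetric] u_def F_def distrib_left)
        also have "\<dots> \<le> (1 + u n) ^ k" using \<epsilon> u0[of n] by (intro power_mono) auto
        also have "\<dots> \<le> (1 + u n) ^ k * (1 + v n)" using u0[of n] v0[of n] by (simp add: algebra_simps)
        finally show ?thesis using E0 by (intro mult_left_mono) auto
      qed
      also have "s * (2 * C + A * \<Lambda>) * (1 + v n) * (1 + u n) ^ k + E * ((1 + u n) ^ k * (1 + v n)) = H * (1 + u n) ^ k * (1 + v n)"
        by (simp add: H_def algebra_simps)
      also have "\<dots> \<le> s * c * u n ^ Suc k / v n + B * (1 + v n) ^ (2 * k + 1)"
        by (rule B(2)[OF u0 v0])
      finally have "(\<Sum>j\<in>events. erate (1 - \<epsilon>) j n * (\<epsilon> ^ k * dist2 (etgt j n) ^ Suc k - \<epsilon> ^ k * dist2 n ^ Suc k))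
        \<le> s * c * u n ^ Suc k / v n + B * (1 + v n) ^ (2 * k + 1) - 2 * (s * c * (u n ^ Suc k / v n))"
        by this linarith+
      moreover have "s * c * (u n ^ Suc k / v n) = s * c * u n ^ Suc k / v n" by simp
      ultimately show ?thesis by linarith
    qed
    have "(\<integral>\<^sup>+n. ennreal (s * c * u n ^ Suc k / v n) \<partial>N \<epsilon>) \<le> (\<integral>\<^sup>+n. ennreal (B * (1 + v n) ^ (2 * k + 1)) \<partial>N \<epsilon>)"
    proof (rule comparison[where V = "\<lambda>n. \<epsilon> ^ k * dist2 n ^ Suc k"])
      show "0 \<le> s * c * u n ^ Suc k / v n" for n using sc u0[of n] v0[of n] by simp
      show "0 \<le> B * (1 + v n) ^ (2 * k + 1)" for n using B(1) v0[of n] by simp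
      show "0 \<le> \<epsilon> ^ k * dist2 n ^ Suc k" for n using \<epsilon> D0[of n] by simp
    qed (use \<epsilon> dr in auto)
    also have "\<dots> = ennreal B * (\<integral>\<^sup>+n. ennreal ((1 + v n) ^ (2 * k + 1)) \<partial>N \<epsilon>)"
      using B(1) v0 by (subst nn_integral_cmult[symmetric]) (auto intro!: nn_integral_cong simp: ennreal_mult less_imp_le)
    also have "\<dots> \<le> ennreal B * ennreal B3"
      using vmom[OF \<epsilon>] by (intro mult_left_mono) (auto simp: v_def)
    finally have le: "(\<integral>\<^sup>+n. ennreal (s * c * u n ^ Suc k / v n) \<partial>N \<epsilon>) \<le> ennreal B * ennreal B3" .
    have "(\<integral>\<^sup>+n. ennreal (u n ^ Suc k / v n) \<partial>N \<epsilon>) = (\<integral>\<^sup>+n. ennreal (1 / (s * c)) * ennreal (s * c * u n ^ Suc k / v n) \<partial>N \<epsilon>)"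
      using s0 c u0 v0
      by (intro nn_integral_cong) (simp add: ennreal_mult[symmetric] less_imp_le)
    also have "\<dots> = ennreal (1 / (s * c)) * (\<integral>\<^sup>+n. ennreal (s * c * u n ^ Suc k / v n) \<partial>N \<epsilon>)"
      by (rule nn_integral_cmult) simp
    also have "\<dots> \<le> ennreal (1 / (s * c)) * (ennreal B * ennreal B3)" by (intro mult_left_mono le) simp
    also have "\<dots> = ennreal (B * B3 / (s * c))"
      using sc B(1) B30 by (simp add: ennreal_mult[symmetric])
    finally show ?thesis by (simp add: u_def v_def)
  qed
  show ?thesis
  proof (rule that[of "B * B3 / (s * c) + B3"])
    show "0 \<le> B * B3 / (s * c) + B3" using B(1) B30 sc by simp
  next
    fix \<epsilon> :: real assume \<epsilon>: "0 < \<epsilon>" "\<epsilon> \<le> 1 / 2"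
    show "(\<integral>\<^sup>+n. ennreal ((\<epsilon> * dist2 n) ^ Suc k / (\<epsilon> * (1 + total n))) \<partial>N \<epsilon>) \<le> ennreal (B * B3 / (s * c) + B3)"
      by (rule order_trans[OF umom[OF \<epsilon>]]) (use B30 in \<open>auto intro!: ennreal_leI\<close>)
    show "(\<integral>\<^sup>+n. ennreal ((1 + \<epsilon> * (1 + total n)) ^ (2 * k + 1)) \<partial>N \<epsilon>) \<le> ennreal (B * B3 / (s * c) + B3)"
      by (rule order_trans[OF vmom[OF \<epsilon>]]) (use B(1) B30 sc in \<open>auto intro!: ennreal_leI\<close>)
  qed
qed

text \<open>With y = sqrt u a pointwise inequality takes the place of Hoelder's: for y \<le> 1 + v
  the power of 1 + v dominates y^m, otherwise v \<le> y and y^m is at most y^(2m+2) / v. Both right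
  sides have bounded mean by \<open>dist2_moment\<close> with k = m.\<close>

lemma perp_moment:
  obtains B where "0 \<le> B" "\<And>\<epsilon>. 0 < \<epsilon> \<Longrightarrow> \<epsilon> \<le> 1 / 2 \<Longrightarrow>
    (\<integral>\<^sup>+n. ennreal ((sqrt \<epsilon> * M_norm net (perp net Ls (real_state n))) ^ m) \<partial>N \<epsilon>) \<le> ennreal B"
proof -
  obtain B where B: "0 \<le> B" "\<And>\<epsilon>. 0 < \<epsilon> \<Longrightarrow> \<epsilon> \<le> 1 / 2 \<Longrightarrow>
    (\<integral>\<^sup>+n. ennreal ((\<epsilon> * dist2 n) ^ Suc m / (\<epsilon> * (1 + total n))) \<partial>N \<epsilon>) \<le> ennreal B"
    "\<And>\<epsilon>. 0 < \<epsilon> \<Longrightarrow> \<epsilon> \<le> 1 / 2 \<Longrightarrow>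
    (\<integral>\<^sup>+n. ennreal ((1 + \<epsilon> * (1 + total n)) ^ (2 * m + 1)) \<partial>N \<epsilon>) \<le> ennreal B"
    by (rule dist2_moment[of m]) blast
  have "(\<integral>\<^sup>+n. ennreal ((sqrt \<epsilon> * M_norm net (perp net Ls (real_state n))) ^ m) \<partial>N \<epsilon>) \<le> ennreal (B + B)"
    if \<epsilon>: "0 < \<epsilon>" "\<epsilon> \<le> 1 / 2" for \<epsilon>
  proof -
    have "(\<integral>\<^sup>+n. ennreal ((sqrt \<epsilon> * M_norm net (perp net Ls (real_state n))) ^ m) \<partial>N \<epsilon>)
        \<le> (\<integral>\<^sup>+n. ennreal ((\<epsilon> * dist2 n) ^ Suc m / (\<epsilon> * (1 + total n)))
            + ennreal ((1 + \<epsilon> * (1 + total n)) ^ (2 * m + 1)) \<partial>N \<epsilon>)"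
    proof (rule nn_integral_mono_AE, unfold AE_measure_pmf_iff, intro ballI)
      fix n assume "n \<in> set_pmf (N \<epsilon>)"
      then have n: "n \<in> states net" using supp_states[of \<epsilon>] \<epsilon> by auto
      define y where "y = sqrt \<epsilon> * M_norm net (perp net Ls (real_state n))"
      define v where "v = \<epsilon> * (1 + total n)"
      have v0: "0 < v" using \<epsilon> total_nonneg[of n] by (simp add: v_def)
      have y2: "\<epsilon> * dist2 n = y\<^sup>2" using \<epsilon> by (simp add: y_def dist2_def power_mult_distrib)
      have quot: "(\<epsilon> * dist2 n) ^ Suc m / v = y ^ (2 * m + 2) / v" unfolding y2 by (simp only: power_mult[symmetric]) simp
      have nn: "0 \<le> (\<epsilon> * dist2 n) ^ Suc m / v" unfolding y2 using v0 by simp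
      have "y ^ m \<le> y ^ (2 * m + 2) / v + (1 + v) ^ (2 * m + 1)"
      proof (cases "y \<le> 1 + v")
        case True
        show ?thesis
        proof (cases "0 \<le> y")
          case y0: True
          have "y ^ m \<le> (1 + v) ^ m" using True y0 by (intro power_mono)
          also have "\<dots> \<le> (1 + v) ^ (2 * m + 1)" using v0 by (intro power_increasing) auto
          finally show ?thesis using nn quot by linarith
        next
          case False
          then have "M_norm net (perp net Ls (real_state n)) < 0" using \<epsilon> by (simp add: y_def zero_le_mult_iff)
          moreover have "0 \<le> M_norm net (perp net Ls (real_state n))" by (rule perp_norm[OF n])
          ultimately show ?thesis by simp
        qed
      next
        case False
        then have y1: "1 \<le> y" "v \<le> y" using v0 by auto
        have "y ^ m \<le> y ^ (2 * m + 1)" using y1 by (intro power_increasing) auto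
        also have "\<dots> = y ^ (2 * m + 1) * v / v" using v0 by simp
        also have "\<dots> \<le> y ^ (2 * m + 1) * y / v" using y1 v0 by (intro divide_right_mono mult_left_mono) auto
        also have "y ^ (2 * m + 1) * y = y ^ (2 * m + 2)" by (simp add: power_add power2_eq_square mult_ac)
        also have "y ^ (2 * m + 2) / v \<le> y ^ (2 * m + 2) / v + (1 + v) ^ (2 * m + 1)" using v0 by simp
        finally show ?thesis .
      qed
      then show "ennreal ((sqrt \<epsilon> * M_norm net (perp net Ls (real_state n))) ^ m)
          \<le> ennreal ((\<epsilon> * dist2 n) ^ Suc m / (\<epsilon> * (1 + total n))) + ennreal ((1 + \<epsilon> * (1 + total n)) ^ (2 * m + 1))"
        unfolding y_def[symmetric] v_def[symmetric] quot[symmetric]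
        by (subst ennreal_plus[symmetric, OF nn]) (use v0 in simp, rule ennreal_leI)
    qed
    also have "\<dots> = (\<integral>\<^sup>+n. ennreal ((\<epsilon> * dist2 n) ^ Suc m / (\<epsilon> * (1 + total n))) \<partial>N \<epsilon>)
        + (\<integral>\<^sup>+n. ennreal ((1 + \<epsilon> * (1 + total n)) ^ (2 * m + 1)) \<partial>N \<epsilon>)"
      by (rule nn_integral_add) auto
    also have "\<dots> \<le> ennreal B + ennreal B" by (intro add_mono B(2,3) \<epsilon>)
    also have "\<dots> = ennreal (B + B)" by (rule ennreal_plus[OF B(1) B(1), symmetric])
    finally show ?thesis .
  qed
  moreover have "0 \<le> B + B" using B(1) by simp
  ultimately show ?thesis using that by blast
qed

end

end

theorem theorem3:
  fixes net :: "('l::finite, 'r::finite) network"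
    and Ls :: "'l set"
    and x :: "('r \<Rightarrow> nat Matrix.vec) \<Rightarrow> 'r \<Rightarrow> real"
    and N :: "real \<Rightarrow> ('r \<Rightarrow> nat Matrix.vec) pmf"
    and m :: nat
  assumes "bandwidth_sharing_network net"
    and "critically_loaded net Ls"
    and "weighted_proportionally_fair net x"
    and "\<And>\<epsilon>. 0 < \<epsilon> \<Longrightarrow> \<epsilon> < 1 \<Longrightarrow>
           stationary_distribution (states net) (flow_rate net x \<epsilon>) (N \<epsilon>)"
  shows "(\<forall>\<^sub>F \<epsilon> in at_right 0.
            integrable (measure_pmf (N \<epsilon>)) (\<lambda>n. M_norm net (perp net Ls (real_state n)) ^ m)) \<and>
         (\<lambda>\<epsilon>. measure_pmf.expectation (N \<epsilon>) (\<lambda>n. M_norm net (perp net Ls (real_state n)) ^ m))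
           \<in> O[at_right 0](\<lambda>\<epsilon>. (1 / sqrt \<epsilon>) ^ m)"
proof -
  interpret heavy_traffic net Ls x using assms(1-3) by unfold_locales
  define f where "f n = M_norm net (perp net Ls (real_state n)) ^ m" for n
  obtain B where B: "0 \<le> B" "\<And>\<epsilon>. 0 < \<epsilon> \<Longrightarrow> \<epsilon> \<le> 1 / 2 \<Longrightarrow>
    (\<integral>\<^sup>+n. ennreal ((sqrt \<epsilon> * M_norm net (perp net Ls (real_state n))) ^ m) \<partial>N \<epsilon>) \<le> ennreal B"
    by (rule perp_moment[of N m, OF assms(4)]) (assumption | blast)+
  have main: "integrable (N \<epsilon>) f \<and> norm (measure_pmf.expectation (N \<epsilon>) f) \<le> B * norm ((1 / sqrt \<epsilon>) ^ m)"
    if \<epsilon>: "0 < \<epsilon>" "\<epsilon> \<le> 1 / 2" for \<epsilon>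
  proof -
    have f0: "0 \<le> f n" if "n \<in> set_pmf (N \<epsilon>)" for n
    proof -
      have "n \<in> states net" using that supp_states[OF assms(4), of \<epsilon>] \<epsilon> by auto
      then have "0 \<le> M_norm net (perp net Ls (real_state n))" using perp_norm by blast
      then show ?thesis by (simp add: f_def)
    qed
    then have AE0: "AE n in N \<epsilon>. 0 \<le> f n" by (simp add: AE_measure_pmf_iff)
    \<comment> \<open>Extracts the claimed order, leaving the scaled moment that
      \<open>perp_moment\<close> bounds uniformly in \<epsilon>.\<close>
    have scale: "f n = (1 / sqrt \<epsilon>) ^ m * (sqrt \<epsilon> * M_norm net (perp net Ls (real_state n))) ^ m" for n
      using \<epsilon> by (simp add: f_def power_mult_distrib power_divide)
    have "(\<integral>\<^sup>+n. ennreal (f n) \<partial>N \<epsilon>)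
        = (\<integral>\<^sup>+n. ennreal ((1 / sqrt \<epsilon>) ^ m) * ennreal ((sqrt \<epsilon> * M_norm net (perp net Ls (real_state n))) ^ m) \<partial>N \<epsilon>)"
      unfolding scale using \<epsilon> by (intro nn_integral_cong ennreal_mult') simp
    also have "\<dots> = ennreal ((1 / sqrt \<epsilon>) ^ m) * (\<integral>\<^sup>+n. ennreal ((sqrt \<epsilon> * M_norm net (perp net Ls (real_state n))) ^ m) \<partial>N \<epsilon>)"
      by (rule nn_integral_cmult) simp
    also have "\<dots> \<le> ennreal ((1 / sqrt \<epsilon>) ^ m) * ennreal B"
      by (intro mult_left_mono B(2) \<epsilon>) simp
    also have "\<dots> = ennreal (B * (1 / sqrt \<epsilon>) ^ m)"
      using \<epsilon> B(1) by (subst ennreal_mult[symmetric]) (auto simp: mult.commute)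
    finally have le: "(\<integral>\<^sup>+n. ennreal (f n) \<partial>N \<epsilon>) \<le> ennreal (B * (1 / sqrt \<epsilon>) ^ m)" .
    have "(\<integral>\<^sup>+n. ennreal (norm (f n)) \<partial>N \<epsilon>) = (\<integral>\<^sup>+n. ennreal (f n) \<partial>N \<epsilon>)"
      using AE0 by (intro nn_integral_cong_AE) auto
    also have "\<dots> < \<infinity>" using le by (rule le_less_trans) simp
    finally have int: "integrable (N \<epsilon>) f" by (intro integrableI_bounded) auto
    have "ennreal (measure_pmf.expectation (N \<epsilon>) f) = (\<integral>\<^sup>+n. ennreal (f n) \<partial>N \<epsilon>)"
      by (rule nn_integral_eq_integral[OF int AE0, symmetric])
    with le have "ennreal (measure_pmf.expectation (N \<epsilon>) f) \<le> ennreal (B * (1 / sqrt \<epsilon>) ^ m)" by simp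
    then have "measure_pmf.expectation (N \<epsilon>) f \<le> B * (1 / sqrt \<epsilon>) ^ m"
      using B(1) \<epsilon> by (subst (asm) ennreal_le_iff) auto
    moreover have "0 \<le> measure_pmf.expectation (N \<epsilon>) f" using AE0 by (rule integral_nonneg_AE)
    ultimately show ?thesis using int \<epsilon> by simp
  qed
  have ev: "\<forall>\<^sub>F \<epsilon> in at_right (0::real). 0 < \<epsilon> \<and> \<epsilon> \<le> 1 / 2"
  proof -
    have "\<forall>\<^sub>F \<epsilon> in at_right (0::real). \<epsilon> \<in> {0<..<1 / 2}" by (rule eventually_at_right_real) simp
    then show ?thesis by (rule eventually_mono) auto
  qed
  have "\<forall>\<^sub>F \<epsilon> in at_right 0. integrable (N \<epsilon>) f"
    using ev by eventually_elim (use main in blast)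
  moreover have "(\<lambda>\<epsilon>. measure_pmf.expectation (N \<epsilon>) f) \<in> O[at_right 0](\<lambda>\<epsilon>. (1 / sqrt \<epsilon>) ^ m)"
    by (rule bigoI[where c = B]) (use ev in eventually_elim, use main in blast)
  ultimately show ?thesis by (simp add: f_def[abs_def])
qed

end
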